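(* Let $H$ be a Hopf algebra over a field $k$ and let $Q=H/I$ where $I$ is a left ideal coideal of $H$. Then $Q$ is a closed element of the Galois connection $$\psi(K)=H/HK^+,\qquad \phi(Q)={}^{co\,Q}H$$ between right coideal subalgebras $K$ of $H$ and quotients of $H$ by left ideal coideals (that is, $\psi\phi(Q)=Q$) if and only if ${}^{co\,Q}H\subseteq H$ is a $Q$-Galois extension.
   Context: Write $\Delta(h)=h_{(1)}\otimes h_{(2)}$. A right coideal subalgebra is a subalgebra $K$ with $\Delta(K)\subseteq K\otimes H$; $K^+=K\cap\ker\epsilon$. A left ideal coideal is a coideal of $H$ which is also a left ideal. For $Q=H/I$ with quotient map $\pi$, ${}^{co\,Q}H=\{h\in H:\pi(h_{(1)})\otimes h_{(2)}=\pi(1)\otimes h\}$, a right coideal subalgebra; $HK^+$ is always a left ideal coideal. Right coideal subalgebras are ordered by inclusion and quotients by $H/I\geq H/J$ iff $I\subseteq J$; $(\phi,\psi)$ is a Galois connection: both maps are order reversing, $K\subseteq\phi\psi(K)$ and $Q\le\psi\phi(Q)$. The extension ${}^{co\,Q}H\subseteq H$ is $Q$-Galois if $\mathrm{can}:H\otimes_{{}^{co\,Q}H}H\to Q\otimes H$, $x\otimes y\mapsto\pi(x_{(1)})\otimes x_{(2)}y$, is bijective. *)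

theory Defs
  imports
    "HOL-Algebra.Free_Abelian_Groups"
    "HOL-Algebra.Galois_Connection"
    "HOL-Algebra.Generated_Groups"
    "HOL-Algebra.Ideal_Product"
    "HOL-Algebra.Module"
    "HOL-Algebra.QuotRing"
    "HOL-Algebra.Subrings"
begin

section \<open>Tensor products\<close>

text \<open>
  The tensor product of a right and a left module over a set \<open>A\<close> of scalars is the free
  abelian group on \<open>carrier M \<times> carrier N\<close> modulo the subgroup generated by the biadditivity
  relations and the relations \<open>(x \<cdot> a, y) - (x, a \<cdot> y)\<close>.  The right action \<open>ra\<close> on \<open>M\<close> and the
  left action \<open>la\<close> on \<open>N\<close> are parameters.  Its group operation is written multiplicatively, and
  its elements are cosets of formal sums.
\<close>

type_synonym ('a, 'b) tensor = "('a \<times> 'b \<Rightarrow>\<^sub>0 int) set"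

definition balanced_rels ::
  "'r set \<Rightarrow> ('a \<Rightarrow> 'r \<Rightarrow> 'a) \<Rightarrow> ('r \<Rightarrow> 'b \<Rightarrow> 'b) \<Rightarrow>
    ('a, 'm) ring_scheme \<Rightarrow> ('b, 'n) ring_scheme \<Rightarrow> ('a, 'b) tensor" where
  "balanced_rels A ra la M N =
     {frag_of (x \<oplus>\<^bsub>M\<^esub> x', y) - frag_of (x, y) - frag_of (x', y) | x x' y.
        x \<in> carrier M \<and> x' \<in> carrier M \<and> y \<in> carrier N} \<union>
     {frag_of (x, y \<oplus>\<^bsub>N\<^esub> y') - frag_of (x, y) - frag_of (x, y') | x y y'.
        x \<in> carrier M \<and> y \<in> carrier N \<and> y' \<in> carrier N} \<union>
     {frag_of (ra x a, y) - frag_of (x, la a y) | x a y.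
        x \<in> carrier M \<and> a \<in> A \<and> y \<in> carrier N}"

definition balanced_tensor ::
  "'r set \<Rightarrow> ('a \<Rightarrow> 'r \<Rightarrow> 'a) \<Rightarrow> ('r \<Rightarrow> 'b \<Rightarrow> 'b) \<Rightarrow>
    ('a, 'm) ring_scheme \<Rightarrow> ('b, 'n) ring_scheme \<Rightarrow> ('a, 'b) tensor monoid" where
  "balanced_tensor A ra la M N =
     (let F = free_Abelian_group (carrier M \<times> carrier N)
      in F Mod generate F (balanced_rels A ra la M N))"

text \<open>The pure tensor \<open>x \<otimes> y\<close>: the unit of \<open>T\<close> is the subgroup of relations.\<close>

definition pure_tensor :: "('a, 'b) tensor monoid \<Rightarrow> 'a \<Rightarrow> 'b \<Rightarrow> ('a, 'b) tensor" where
  "pure_tensor T x y = (\<lambda>t. t + frag_of (x, y)) ` \<one>\<^bsub>T\<^esub>"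

text \<open>
  The homomorphism from a tensor product to a commutative group \<open>G\<close> induced by a balanced map
  \<open>\<beta>\<close>: all representatives of a coset have the same value, so the image is a singleton.
  With \<open>X\<close> the coproduct of \<open>h\<close>, \<open>tensor_lift G \<beta> X\<close> is the Sweedler expression in which
  \<open>\<beta>\<close> is applied to the two tensor legs of \<open>h\<close>.
\<close>

definition formal_sum_eval ::
  "('c, 'm) monoid_scheme \<Rightarrow> ('a \<Rightarrow> 'b \<Rightarrow> 'c) \<Rightarrow> ('a \<times> 'b \<Rightarrow>\<^sub>0 int) \<Rightarrow> 'c" where
  "formal_sum_eval G \<beta> t =
     finprod G (\<lambda>p. \<beta> (fst p) (snd p) [^]\<^bsub>G\<^esub> poly_mapping.lookup t p) (Poly_Mapping.keys t)"

definition tensor_lift ::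
  "('c, 'm) monoid_scheme \<Rightarrow> ('a \<Rightarrow> 'b \<Rightarrow> 'c) \<Rightarrow> ('a, 'b) tensor \<Rightarrow> 'c" where
  "tensor_lift G \<beta> X = the_elem (formal_sum_eval G \<beta> ` X)"

definition tensor_group ::
  "('k, 'f) ring_scheme \<Rightarrow> ('k, 'a, 'm) module_scheme \<Rightarrow> ('k, 'b, 'n) module_scheme \<Rightarrow>
    ('a, 'b) tensor monoid" where
  "tensor_group k M N =
     balanced_tensor (carrier k) (\<lambda>x c. c \<odot>\<^bsub>M\<^esub> x) (\<lambda>c y. c \<odot>\<^bsub>N\<^esub> y) M N"

text \<open>
  The tensor product over the base field as a module; its \<open>mult\<close> and \<open>one\<close> fields are only
  meaningful if both factors are algebras.
\<close>

definition tensor_module ::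
  "('k, 'f) ring_scheme \<Rightarrow> ('k, 'a, 'm) module_scheme \<Rightarrow> ('k, 'b, 'n) module_scheme \<Rightarrow>
    ('k, ('a, 'b) tensor) module" where
  "tensor_module k M N =
     (let T = tensor_group k M N in
      \<lparr> carrier = carrier T,
        mult = (\<lambda>t u. tensor_lift T (\<lambda>a b. tensor_lift T (\<lambda>c d.
                  pure_tensor T (a \<otimes>\<^bsub>M\<^esub> c) (b \<otimes>\<^bsub>N\<^esub> d)) u) t),
        one = pure_tensor T \<one>\<^bsub>M\<^esub> \<one>\<^bsub>N\<^esub>,
        zero = \<one>\<^bsub>T\<^esub>,
        add = (\<otimes>\<^bsub>T\<^esub>),
        smult = (\<lambda>c. tensor_lift T (\<lambda>x y. pure_tensor T (c \<odot>\<^bsub>M\<^esub> x) y)) \<rparr>)"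

definition tensor_assoc ::
  "('k, 'f) ring_scheme \<Rightarrow> ('k, 'a, 'l) module_scheme \<Rightarrow> ('k, 'b, 'm) module_scheme \<Rightarrow>
    ('k, 'c, 'n) module_scheme \<Rightarrow> ('a, ('b, 'c) tensor) tensor \<Rightarrow> (('a, 'b) tensor, 'c) tensor" where
  "tensor_assoc k L M N =
     (let T = tensor_group k (tensor_module k L M) N in
      tensor_lift T (\<lambda>x. tensor_lift T (\<lambda>y z.
        pure_tensor T (pure_tensor (tensor_group k L M) x y) z)))"

text \<open>For subspaces \<open>A\<close> of \<open>M\<close> and \<open>B\<close> of \<open>N\<close>, the subspace \<open>A \<otimes> B\<close> of \<open>M \<otimes> N\<close>.\<close>

definition tensor_subspace ::
  "('k, 'f) ring_scheme \<Rightarrow> ('k, 'a, 'm) module_scheme \<Rightarrow> ('k, 'b, 'n) module_scheme \<Rightarrow>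
    'a set \<Rightarrow> 'b set \<Rightarrow> ('a, 'b) tensor set" where
  "tensor_subspace k M N A B =
     generate (tensor_group k M N) {pure_tensor (tensor_group k M N) x y | x y. x \<in> A \<and> y \<in> B}"


section \<open>Hopf algebras\<close>

definition linear_map ::
  "('k, 'f) ring_scheme \<Rightarrow> ('k, 'a, 'm) module_scheme \<Rightarrow> ('k, 'b, 'n) module_scheme \<Rightarrow>
    ('a \<Rightarrow> 'b) \<Rightarrow> bool" where
  "linear_map k M N f \<longleftrightarrow>
     f \<in> carrier M \<rightarrow> carrier N \<and>
     (\<forall>x\<in>carrier M. \<forall>y\<in>carrier M. f (x \<oplus>\<^bsub>M\<^esub> y) = f x \<oplus>\<^bsub>N\<^esub> f y) \<and>
     (\<forall>c\<in>carrier k. \<forall>x\<in>carrier M. f (c \<odot>\<^bsub>M\<^esub> x) = c \<odot>\<^bsub>N\<^esub> f x)"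

record ('k, 'h) hopf = "('k, 'h) module" +
  comult :: "'h \<Rightarrow> ('h, 'h) tensor"
  counit :: "'h \<Rightarrow> 'k"
  antipode :: "'h \<Rightarrow> 'h"

text \<open>The locale \<^locale>\<open>algebra\<close> is restricted to commutative algebras.\<close>

locale assoc_algebra = module R M + ring M for R and M (structure) +
  assumes smult_mult_left:
      "\<lbrakk>a \<in> carrier R; x \<in> carrier M; y \<in> carrier M\<rbrakk> \<Longrightarrow>
        (a \<odot>\<^bsub>M\<^esub> x) \<otimes>\<^bsub>M\<^esub> y = a \<odot>\<^bsub>M\<^esub> (x \<otimes>\<^bsub>M\<^esub> y)"
    and smult_mult_right:
      "\<lbrakk>a \<in> carrier R; x \<in> carrier M; y \<in> carrier M\<rbrakk> \<Longrightarrow>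
        x \<otimes>\<^bsub>M\<^esub> (a \<odot>\<^bsub>M\<^esub> y) = a \<odot>\<^bsub>M\<^esub> (x \<otimes>\<^bsub>M\<^esub> y)"

locale hopf_algebra = k: field k + H: assoc_algebra k H
  for k :: "('k, 'f) ring_scheme" and H :: "('k, 'h, 'm) hopf_scheme" +
  assumes comult_linear: "linear_map k H (tensor_module k H H) (comult H)"
    and comult_coassoc:
      "h \<in> carrier H \<Longrightarrow>
        (let L = tensor_group k (tensor_module k H H) H;
             R = tensor_group k H (tensor_module k H H)
         in tensor_lift L (\<lambda>x y. pure_tensor L (comult H x) y) (comult H h) =
            tensor_assoc k H H H
              (tensor_lift R (\<lambda>x y. pure_tensor R x (comult H y)) (comult H h)))"
    and counit_smult:
      "\<lbrakk>c \<in> carrier k; h \<in> carrier H\<rbrakk> \<Longrightarrow> counit H (c \<odot>\<^bsub>H\<^esub> h) = c \<otimes>\<^bsub>k\<^esub> counit H h"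
    and counit_left:
      "h \<in> carrier H \<Longrightarrow>
        tensor_lift (add_monoid H) (\<lambda>x y. counit H x \<odot>\<^bsub>H\<^esub> y) (comult H h) = h"
    and counit_right:
      "h \<in> carrier H \<Longrightarrow>
        tensor_lift (add_monoid H) (\<lambda>x y. counit H y \<odot>\<^bsub>H\<^esub> x) (comult H h) = h"
    and comult_ring_hom: "comult H \<in> ring_hom H (tensor_module k H H)"
    and counit_ring_hom: "counit H \<in> ring_hom H k"
    and antipode_linear: "linear_map k H H (antipode H)"
    and antipode_left:
      "h \<in> carrier H \<Longrightarrow>
        tensor_lift (add_monoid H) (\<lambda>x y. antipode H x \<otimes>\<^bsub>H\<^esub> y) (comult H h) =
        counit H h \<odot>\<^bsub>H\<^esub> \<one>\<^bsub>H\<^esub>"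
    and antipode_right:
      "h \<in> carrier H \<Longrightarrow>
        tensor_lift (add_monoid H) (\<lambda>x y. x \<otimes>\<^bsub>H\<^esub> antipode H y) (comult H h) =
        counit H h \<odot>\<^bsub>H\<^esub> \<one>\<^bsub>H\<^esub>"


section \<open>Right coideal subalgebras and quotients by left ideal coideals\<close>

definition right_coideal_subalgebra ::
  "('k, 'f) ring_scheme \<Rightarrow> ('k, 'h, 'm) hopf_scheme \<Rightarrow> 'h set \<Rightarrow> bool" where
  "right_coideal_subalgebra k H K \<longleftrightarrow>
     subring K H \<and> submodule K k H \<and>
     comult H ` K \<subseteq> tensor_subspace k H H K (carrier H)"

definition augmentation :: "('k, 'f) ring_scheme \<Rightarrow> ('k, 'h, 'm) hopf_scheme \<Rightarrow> 'h set \<Rightarrow> 'h set" where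
  "augmentation k H K = {x \<in> K. counit H x = \<zero>\<^bsub>k\<^esub>}"

definition coideal :: "('k, 'f) ring_scheme \<Rightarrow> ('k, 'h, 'm) hopf_scheme \<Rightarrow> 'h set \<Rightarrow> bool" where
  "coideal k H I \<longleftrightarrow>
     submodule I k H \<and>
     comult H ` I \<subseteq> tensor_subspace k H H I (carrier H) <#>\<^bsub>tensor_group k H H\<^esub>
                    tensor_subspace k H H (carrier H) I \<and>
     (\<forall>x\<in>I. counit H x = \<zero>\<^bsub>k\<^esub>)"

definition left_ideal_coideal ::
  "('k, 'f) ring_scheme \<Rightarrow> ('k, 'h, 'm) hopf_scheme \<Rightarrow> 'h set \<Rightarrow> bool" where
  "left_ideal_coideal k H I \<longleftrightarrow>
     coideal k H I \<and> (\<forall>h\<in>carrier H. \<forall>x\<in>I. h \<otimes>\<^bsub>H\<^esub> x \<in> I)"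

text \<open>
  The quotient vector space \<open>H / I\<close>, with cosets as elements.  Since \<open>I\<close> is only a left ideal,
  the fields \<open>mult\<close> and \<open>one\<close> (those of \<^const>\<open>FactRing\<close>) carry no meaning.
\<close>

definition quotient_module :: "('k, 'h, 'm) module_scheme \<Rightarrow> 'h set \<Rightarrow> ('k, 'h set) module" where
  "quotient_module H I =
     ring.extend (H Quot I) \<lparr> smult = (\<lambda>c X. \<Union>x\<in>X. I +>\<^bsub>H\<^esub> (c \<odot>\<^bsub>H\<^esub> x)) \<rparr>"

text \<open>The projection \<open>H \<rightarrow> Q\<close> for \<open>Q = H / I\<close>: the zero element of \<open>Q\<close> is the coset \<open>I\<close>.\<close>

definition quotient_proj ::
  "('k, 'h, 'm) module_scheme \<Rightarrow> ('k, 'h set) module \<Rightarrow> 'h \<Rightarrow> 'h set" where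
  "quotient_proj H Q h = \<zero>\<^bsub>Q\<^esub> +>\<^bsub>H\<^esub> h"

definition coinvariants ::
  "('k, 'f) ring_scheme \<Rightarrow> ('k, 'h, 'm) hopf_scheme \<Rightarrow> ('k, 'h set) module \<Rightarrow> 'h set" where
  "coinvariants k H Q =
     (let T = tensor_group k Q H; \<pi> = quotient_proj H Q in
      {h \<in> carrier H. tensor_lift T (\<lambda>x y. pure_tensor T (\<pi> x) y) (comult H h) =
                      pure_tensor T (\<pi> \<one>\<^bsub>H\<^esub>) h})"

text \<open>\<open>ideal_prod\<close> is the set of sums of products, here \<open>HK\<^sup>+\<close>.\<close>

definition subalgebra_quotient ::
  "('k, 'f) ring_scheme \<Rightarrow> ('k, 'h, 'm) hopf_scheme \<Rightarrow> 'h set \<Rightarrow> ('k, 'h set) module" where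
  "subalgebra_quotient k H K =
     quotient_module H (ideal_prod H (carrier H) (augmentation k H K))"


section \<open>The Galois connection and Galois extensions\<close>

definition right_coideal_subalgebras ::
  "('k, 'f) ring_scheme \<Rightarrow> ('k, 'h, 'm) hopf_scheme \<Rightarrow> 'h set gorder" where
  "right_coideal_subalgebras k H =
     \<lparr> carrier = {K. right_coideal_subalgebra k H K}, eq = (=), le = (\<subseteq>) \<rparr>"

definition left_ideal_coideal_quotients ::
  "('k, 'f) ring_scheme \<Rightarrow> ('k, 'h, 'm) hopf_scheme \<Rightarrow> ('k, 'h set) module gorder" where
  "left_ideal_coideal_quotients k H =
     \<lparr> carrier = {quotient_module H I | I. left_ideal_coideal k H I},
       eq = (=), le = (\<lambda>Q Q'. \<zero>\<^bsub>Q'\<^esub> \<subseteq> \<zero>\<^bsub>Q\<^esub>) \<rparr>"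

text \<open>
  In \<^theory>\<open>HOL-Algebra.Galois_Connection\<close> the two maps of a Galois connection are isotone;
  the order on quotients is therefore dualised.
\<close>

definition hopf_galcon ::
  "('k, 'f) ring_scheme \<Rightarrow> ('k, 'h, 'm) hopf_scheme \<Rightarrow> ('h set, ('k, 'h set) module) galois" where
  "hopf_galcon k H =
     \<lparr> orderA = right_coideal_subalgebras k H,
       orderB = inv_gorder (left_ideal_coideal_quotients k H),
       lower = subalgebra_quotient k H,
       upper = coinvariants k H \<rparr>"

definition closed_in_orderB :: "('a, 'b, 'c, 'd) galcon \<Rightarrow> 'b \<Rightarrow> bool" where
  "closed_in_orderB G y \<longleftrightarrow> y \<in> carrier (orderB G) \<and> lower G (upper G y) = y"

text \<open>The map \<open>x \<otimes> y \<mapsto> \<pi>(x\<^sub>1) \<otimes> x\<^sub>2 y\<close> in Sweedler notation.\<close>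

definition canonical_map ::
  "('k, 'f) ring_scheme \<Rightarrow> ('k, 'h, 'm) hopf_scheme \<Rightarrow> ('k, 'h set) module \<Rightarrow>
    ('h, 'h) tensor \<Rightarrow> ('h set, 'h) tensor" where
  "canonical_map k H Q =
     (let T = tensor_group k Q H in
      tensor_lift T (\<lambda>x y.
        tensor_lift T (\<lambda>a b. pure_tensor T (quotient_proj H Q a) (b \<otimes>\<^bsub>H\<^esub> y)) (comult H x)))"

definition galois_extension ::
  "('k, 'f) ring_scheme \<Rightarrow> ('k, 'h, 'm) hopf_scheme \<Rightarrow> ('k, 'h set) module \<Rightarrow> bool" where
  "galois_extension k H Q \<longleftrightarrow>
     bij_betw (canonical_map k H Q)
       (carrier (balanced_tensor (coinvariants k H Q) (\<otimes>\<^bsub>H\<^esub>) (\<otimes>\<^bsub>H\<^esub>) H H))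
       (carrier (tensor_group k Q H))"

end

theory Submission
  imports Defs
begin

text \<open>
  Write \<open>K\<close> for the coinvariants of \<open>Q = H / I\<close> and \<open>can: H \<otimes>\<^sub>K H \<rightarrow> Q \<otimes> H\<close> for the canonical map.
  Applying \<open>\<epsilon>\<close> to the second leg of \<open>\<pi>(\<kappa>\<^sub>1) \<otimes> \<kappa>\<^sub>2 = \<pi>(1) \<otimes> \<kappa>\<close> gives \<open>\<pi>(\<kappa>) = \<epsilon>(\<kappa>) \<pi>(1)\<close>, so
  \<open>K\<^sup>+ \<subseteq> I\<close> and, \<open>I\<close> being a left ideal, \<open>HK\<^sup>+ \<subseteq> I\<close>.  As \<open>Q\<close> determines \<open>I\<close>, it is closed exactly when
  \<open>HK\<^sup>+ = I\<close>.  The theorem therefore says that \<open>can\<close> is bijective if and only if \<open>HK\<^sup>+ = I\<close>.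

  Everything turns on the translation map \<open>x \<otimes> y \<mapsto> x\<^sub>1 \<otimes> S(x\<^sub>2) y\<close> from \<open>H \<otimes> H\<close> to
  \<open>H \<otimes>\<^sub>K H\<close>.  The antipode identities give \<open>can (x\<^sub>1 \<otimes> S(x\<^sub>2) y) = \<pi>(x) \<otimes> y\<close>, so \<open>can\<close> is always
  surjective, and they give \<open>x\<^sub>1 \<otimes> S(x\<^sub>2) x\<^sub>3 y = x \<otimes> y\<close>, so \<open>can\<close> is injective as soon as the
  translation map factors through \<open>Q \<otimes> H\<close>, that is, vanishes for \<open>x \<in> I\<close>.

  If \<open>HK\<^sup>+ = I\<close>, it does vanish: for \<open>\<kappa> \<in> K\<^sup>+\<close>, the elements \<open>\<kappa>\<^sub>1\<close> may be moved across \<open>\<otimes>\<^sub>K\<close>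
  because \<open>\<Delta>(K) \<subseteq> K \<otimes> H\<close>, and
  \<open>h\<^sub>1 \<kappa>\<^sub>1 \<otimes> S(h\<^sub>2 \<kappa>\<^sub>2) y = h\<^sub>1 \<otimes> \<kappa>\<^sub>1 S(\<kappa>\<^sub>2) S(h\<^sub>2) y = \<epsilon>(\<kappa>) h\<^sub>1 \<otimes> S(h\<^sub>2) y = 0\<close>.
  Conversely, if \<open>can\<close> is injective and \<open>x \<in> I\<close>, then \<open>x\<^sub>1 \<otimes> S(x\<^sub>2)\<close> is sent by \<open>can\<close> to
  \<open>\<pi>(x) \<otimes> 1 = 0\<close>, hence is zero in \<open>H \<otimes>\<^sub>K H\<close>; applying the map \<open>x \<otimes> y \<mapsto> \<epsilon>(y) x\<close> to \<open>H / HK\<^sup>+\<close>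
  gives \<open>x \<in> HK\<^sup>+\<close>.

  Two facts used here need an argument of their own.  The inclusion \<open>\<Delta>(K) \<subseteq> K \<otimes> H\<close> holds because \<open>K\<close>
  is the kernel of a linear map and tensoring with \<open>H\<close> is exact over a field; exactness enters through a linear
  generalised inverse (\<open>linear_map_generalised_inverse\<close>, from Zorn's lemma), and the inclusion is
  used in the form \<open>sw_cong_coinvariant\<close>.  That \<open>S\<close> reverses products (\<open>antipode_mult\<close>) is
  derived from the antipode identities.
\<close>

section \<open>Tensor products over a set of scalars\<close>

text \<open>
  Over a fixed finite index set, the value of a formal sum is visibly additive in its coefficients; the
  key set in the definition varies with the formal sum.
\<close>

lemma formal_sum_eval_superset:
  assumes "comm_group G" "\<And>p. p \<in> S \<Longrightarrow> \<beta> (fst p) (snd p) \<in> carrier G"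
    "Poly_Mapping.keys t \<subseteq> S" "finite S"
  shows "formal_sum_eval G \<beta> t =
    finprod G (\<lambda>p. \<beta> (fst p) (snd p) [^]\<^bsub>G\<^esub> poly_mapping.lookup t p) S"
proof -
  interpret G: comm_group G by fact
  show ?thesis unfolding formal_sum_eval_def
    by (rule G.finprod_mono_neutral_cong_left)
       (use assms in \<open>auto simp: in_keys_iff Pi_iff\<close>)
qed

lemma formal_sum_eval_hom:
  assumes "comm_group G" "\<And>x y. x \<in> A \<Longrightarrow> y \<in> B \<Longrightarrow> \<beta> x y \<in> carrier G"
  shows "formal_sum_eval G \<beta> \<in> hom (free_Abelian_group (A \<times> B)) G"
proof -
  interpret G: comm_group G by fact
  have \<beta>: "\<beta> (fst p) (snd p) \<in> carrier G" if "p \<in> A \<times> B" for p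
    using assms(2) that by auto
  show ?thesis
  proof (rule homI)
    fix t assume "t \<in> carrier (free_Abelian_group (A \<times> B))"
    then show "formal_sum_eval G \<beta> t \<in> carrier G"
      unfolding formal_sum_eval_def by (intro G.finprod_closed Pi_I G.int_pow_closed \<beta>) auto
  next
    fix s t assume "s \<in> carrier (free_Abelian_group (A \<times> B))" "t \<in> carrier (free_Abelian_group (A \<times> B))"
    then have st: "Poly_Mapping.keys s \<subseteq> A \<times> B" "Poly_Mapping.keys t \<subseteq> A \<times> B" by auto
    define U where "U = Poly_Mapping.keys s \<union> Poly_Mapping.keys t"
    have U: "finite U" "U \<subseteq> A \<times> B" "Poly_Mapping.keys s \<subseteq> U" "Poly_Mapping.keys t \<subseteq> U"
      "Poly_Mapping.keys (s + t) \<subseteq> U"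
      using st by (auto simp: U_def dest: subsetD[OF keys_add])
    have \<beta>U: "p \<in> U \<Longrightarrow> \<beta> (fst p) (snd p) \<in> carrier G" for p using U \<beta> by blast
    show "formal_sum_eval G \<beta> (s \<otimes>\<^bsub>free_Abelian_group (A \<times> B)\<^esub> t) =
      formal_sum_eval G \<beta> s \<otimes>\<^bsub>G\<^esub> formal_sum_eval G \<beta> t"
      using U \<beta>U by (simp add: formal_sum_eval_superset[OF assms(1), where S = U and \<beta> = \<beta>]
        Pi_iff lookup_add G.int_pow_mult cong: G.finprod_cong)
  qed
qed

lemma formal_sum_eval_frag_of:
  assumes "comm_group G" "\<beta> x y \<in> carrier G"
  shows "formal_sum_eval G \<beta> (frag_of (x, y)) = \<beta> x y"
proof -
  interpret G: comm_group G by fact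
  show ?thesis using assms(2) by (simp add: formal_sum_eval_def)
qed

lemma free_Abelian_group_hom_eqI:
  assumes "group G" "f \<in> hom (free_Abelian_group S) G" "g \<in> hom (free_Abelian_group S) G"
    and "\<And>p. p \<in> S \<Longrightarrow> f (frag_of p) = g (frag_of p)"
    and "Poly_Mapping.keys t \<subseteq> S"
  shows "f t = g t"
proof -
  interpret f: group_hom "free_Abelian_group S" G f
    using assms by (simp add: group_hom_def group_hom_axioms_def)
  interpret g: group_hom "free_Abelian_group S" G g
    using assms by (simp add: group_hom_def group_hom_axioms_def)
  show ?thesis
  proof (rule free_Abelian_group_induct[where P = "\<lambda>t. f t = g t", OF assms(5)])
    show "f 0 = g 0" using f.hom_one g.hom_one by simp
  next
    fix x y assume xy: "Poly_Mapping.keys x \<subseteq> S" "Poly_Mapping.keys y \<subseteq> S" "f x = g x" "f y = g y"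
    have "x - y = x \<otimes>\<^bsub>free_Abelian_group S\<^esub> inv\<^bsub>free_Abelian_group S\<^esub> y" using xy by simp
    then show "f (x - y) = g (x - y)"
      using xy f.hom_mult[of x "inv\<^bsub>free_Abelian_group S\<^esub> y"] g.hom_mult[of x "inv\<^bsub>free_Abelian_group S\<^esub> y"]
        f.hom_inv[of y] g.hom_inv[of y]
      by simp
  qed (use assms in auto)
qed

lemma formal_sum_eval_closed:
  assumes "comm_group G" "\<And>x y. x \<in> A \<Longrightarrow> y \<in> B \<Longrightarrow> \<beta> x y \<in> carrier G"
    "Poly_Mapping.keys t \<subseteq> A \<times> B"
  shows "formal_sum_eval G \<beta> t \<in> carrier G"
proof -
  have "t \<in> carrier (free_Abelian_group (A \<times> B))" using assms(3) by simp
  then show ?thesis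
    using hom_in_carrier[of "formal_sum_eval G \<beta>"] formal_sum_eval_hom[of G A B \<beta>] assms(1,2) by blast
qed

lemma formal_sum_eval_comp_hom:
  assumes "comm_group G" "comm_group G'" "\<phi> \<in> hom G G'"
    "\<And>x y. x \<in> A \<Longrightarrow> y \<in> B \<Longrightarrow> \<beta> x y \<in> carrier G"
    "Poly_Mapping.keys t \<subseteq> A \<times> B"
  shows "\<phi> (formal_sum_eval G \<beta> t) = formal_sum_eval G' (\<lambda>x y. \<phi> (\<beta> x y)) t"
proof -
  have "(\<phi> \<circ> formal_sum_eval G \<beta>) t = formal_sum_eval G' (\<lambda>x y. \<phi> (\<beta> x y)) t"
  proof (rule free_Abelian_group_hom_eqI)
    show "group G'" using assms(2) by (simp add: comm_group_def)
    show "\<phi> \<circ> formal_sum_eval G \<beta> \<in> hom (free_Abelian_group (A \<times> B)) G'"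
      by (rule hom_compose[OF formal_sum_eval_hom]) (use assms in auto)
    show "formal_sum_eval G' (\<lambda>x y. \<phi> (\<beta> x y)) \<in> hom (free_Abelian_group (A \<times> B)) G'"
      by (rule formal_sum_eval_hom) (use assms in \<open>auto intro: hom_in_carrier\<close>)
  qed (use assms in \<open>auto simp: formal_sum_eval_frag_of hom_in_carrier\<close>)
  then show ?thesis by simp
qed

lemma formal_sum_eval_cong:
  assumes "comm_group G" "Poly_Mapping.keys t \<subseteq> A \<times> B"
    "\<And>x y. x \<in> A \<Longrightarrow> y \<in> B \<Longrightarrow> \<beta> x y = \<beta>' x y \<and> \<beta>' x y \<in> carrier G"
  shows "formal_sum_eval G \<beta> t = formal_sum_eval G \<beta>' t"
proof -
  interpret G: comm_group G by fact
  show ?thesis unfolding formal_sum_eval_def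
    using assms(2,3) by (intro G.finprod_cong') fastforce+
qed

lemma formal_sum_eval_mult:
  assumes "comm_group G" "Poly_Mapping.keys t \<subseteq> A \<times> B"
    "\<And>x y. x \<in> A \<Longrightarrow> y \<in> B \<Longrightarrow> \<beta> x y \<in> carrier G"
    "\<And>x y. x \<in> A \<Longrightarrow> y \<in> B \<Longrightarrow> \<beta>' x y \<in> carrier G"
  shows "formal_sum_eval G (\<lambda>x y. \<beta> x y \<otimes>\<^bsub>G\<^esub> \<beta>' x y) t =
    formal_sum_eval G \<beta> t \<otimes>\<^bsub>G\<^esub> formal_sum_eval G \<beta>' t"
proof -
  interpret G: comm_group G by fact
  have "\<beta> (fst p) (snd p) \<in> carrier G" "\<beta>' (fst p) (snd p) \<in> carrier G"
    if "p \<in> Poly_Mapping.keys t" for p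
    using that assms(2-4) by auto
  then show ?thesis unfolding formal_sum_eval_def
    by (simp add: Pi_iff G.int_pow_distrib cong: G.finprod_cong)
qed

text \<open>
  Iterated Sweedler sums are evaluations of fixed formal sums, so this is what allows the order of
  summation to be exchanged without any linearity of \<open>\<tau>\<close>.
\<close>

lemma formal_sum_eval_swap:
  assumes "comm_group G" "Poly_Mapping.keys s \<subseteq> A \<times> B" "Poly_Mapping.keys t \<subseteq> C \<times> D"
    "\<And>a b c d. a \<in> A \<Longrightarrow> b \<in> B \<Longrightarrow> c \<in> C \<Longrightarrow> d \<in> D \<Longrightarrow> \<tau> a b c d \<in> carrier G"
  shows "formal_sum_eval G (\<lambda>a b. formal_sum_eval G (\<tau> a b) t) s =
    formal_sum_eval G (\<lambda>c d. formal_sum_eval G (\<lambda>a b. \<tau> a b c d) s) t"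
proof -
  interpret G: comm_group G by fact
  let ?F = "free_Abelian_group (A \<times> B)"
  have 1: "formal_sum_eval G (\<lambda>a b. formal_sum_eval G (\<tau> a b) t) \<in> hom ?F G"
    by (rule formal_sum_eval_hom[OF assms(1)])
       (rule formal_sum_eval_closed[OF assms(1) _ assms(3)], auto intro: assms(4))
  have cl: "formal_sum_eval G (\<lambda>a b. \<tau> a b c d) s \<in> carrier G"
    if "Poly_Mapping.keys s \<subseteq> A \<times> B" "c \<in> C" "d \<in> D" for s c d
    by (rule formal_sum_eval_closed[OF assms(1) _ that(1)]) (use assms(4) that in auto)
  have 2: "(\<lambda>s. formal_sum_eval G (\<lambda>c d. formal_sum_eval G (\<lambda>a b. \<tau> a b c d) s) t) \<in> hom ?F G"
  proof (rule homI)
    fix s assume "s \<in> carrier ?F"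
    then show "formal_sum_eval G (\<lambda>c d. formal_sum_eval G (\<lambda>a b. \<tau> a b c d) s) t \<in> carrier G"
      by (intro formal_sum_eval_closed[OF assms(1) _ assms(3)] cl) auto
  next
    fix s s' assume s: "s \<in> carrier ?F" "s' \<in> carrier ?F"
    have h: "formal_sum_eval G (\<lambda>a b. \<tau> a b c d) (s + s') =
      formal_sum_eval G (\<lambda>a b. \<tau> a b c d) s \<otimes>\<^bsub>G\<^esub> formal_sum_eval G (\<lambda>a b. \<tau> a b c d) s'"
      if "c \<in> C" "d \<in> D" for c d
      using hom_mult[OF formal_sum_eval_hom[OF assms(1), where A = A and B = B and \<beta> = "\<lambda>a b. \<tau> a b c d"] s] assms(4) that
      by simp
    have "formal_sum_eval G (\<lambda>c d. formal_sum_eval G (\<lambda>a b. \<tau> a b c d) (s + s')) t =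
      formal_sum_eval G (\<lambda>c d. formal_sum_eval G (\<lambda>a b. \<tau> a b c d) s \<otimes>\<^bsub>G\<^esub>
        formal_sum_eval G (\<lambda>a b. \<tau> a b c d) s') t"
      by (rule formal_sum_eval_cong[OF assms(1,3)]) (use s h cl in auto)
    then show "formal_sum_eval G (\<lambda>c d. formal_sum_eval G (\<lambda>a b. \<tau> a b c d) (s \<otimes>\<^bsub>?F\<^esub> s')) t =
      formal_sum_eval G (\<lambda>c d. formal_sum_eval G (\<lambda>a b. \<tau> a b c d) s) t \<otimes>\<^bsub>G\<^esub>
      formal_sum_eval G (\<lambda>c d. formal_sum_eval G (\<lambda>a b. \<tau> a b c d) s') t"
      using s cl by (simp add: formal_sum_eval_mult[OF assms(1,3)])
  qed
  show ?thesis
  proof (rule free_Abelian_group_hom_eqI[OF _ 1 2 _ assms(2)])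
    fix p assume "p \<in> A \<times> B"
    then obtain a b where p: "p = (a, b)" "a \<in> A" "b \<in> B" by auto
    have e: "formal_sum_eval G (\<tau> a b) t \<in> carrier G"
      by (rule formal_sum_eval_closed[OF assms(1) _ assms(3)]) (use p assms(4) in auto)
    show "formal_sum_eval G (\<lambda>a b. formal_sum_eval G (\<tau> a b) t) (frag_of p) =
      formal_sum_eval G (\<lambda>c d. formal_sum_eval G (\<lambda>a b. \<tau> a b c d) (frag_of p)) t"
      unfolding p(1) formal_sum_eval_frag_of[OF assms(1), of "\<lambda>a b. formal_sum_eval G (\<tau> a b) t", OF e]
      by (rule formal_sum_eval_cong[OF assms(1,3)])
         (use p assms(4) in \<open>auto simp: formal_sum_eval_frag_of[OF assms(1)]\<close>)
  qed (rule G.is_group)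
qed

definition balanced_map ::
  "'r set \<Rightarrow> ('a \<Rightarrow> 'r \<Rightarrow> 'a) \<Rightarrow> ('r \<Rightarrow> 'b \<Rightarrow> 'b) \<Rightarrow> ('a, 'm) ring_scheme \<Rightarrow>
    ('b, 'n) ring_scheme \<Rightarrow> ('c, 'l) monoid_scheme \<Rightarrow> ('a \<Rightarrow> 'b \<Rightarrow> 'c) \<Rightarrow> bool" where
  "balanced_map A ra la M N G \<beta> \<longleftrightarrow>
     (\<forall>x\<in>carrier M. \<forall>y\<in>carrier N. \<beta> x y \<in> carrier G) \<and>
     (\<forall>x\<in>carrier M. \<forall>x'\<in>carrier M. \<forall>y\<in>carrier N. \<beta> (x \<oplus>\<^bsub>M\<^esub> x') y = \<beta> x y \<otimes>\<^bsub>G\<^esub> \<beta> x' y) \<and>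
     (\<forall>x\<in>carrier M. \<forall>y\<in>carrier N. \<forall>y'\<in>carrier N. \<beta> x (y \<oplus>\<^bsub>N\<^esub> y') = \<beta> x y \<otimes>\<^bsub>G\<^esub> \<beta> x y') \<and>
     (\<forall>x\<in>carrier M. \<forall>a\<in>A. \<forall>y\<in>carrier N. \<beta> (ra x a) y = \<beta> x (la a y))"

lemma balanced_mapI:
  assumes "\<And>x y. x \<in> carrier M \<Longrightarrow> y \<in> carrier N \<Longrightarrow> \<beta> x y \<in> carrier G"
    and "\<And>x x' y. x \<in> carrier M \<Longrightarrow> x' \<in> carrier M \<Longrightarrow> y \<in> carrier N \<Longrightarrow>
      \<beta> (x \<oplus>\<^bsub>M\<^esub> x') y = \<beta> x y \<otimes>\<^bsub>G\<^esub> \<beta> x' y"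
    and "\<And>x y y'. x \<in> carrier M \<Longrightarrow> y \<in> carrier N \<Longrightarrow> y' \<in> carrier N \<Longrightarrow>
      \<beta> x (y \<oplus>\<^bsub>N\<^esub> y') = \<beta> x y \<otimes>\<^bsub>G\<^esub> \<beta> x y'"
    and "\<And>x a y. x \<in> carrier M \<Longrightarrow> a \<in> A \<Longrightarrow> y \<in> carrier N \<Longrightarrow> \<beta> (ra x a) y = \<beta> x (la a y)"
  shows "balanced_map A ra la M N G \<beta>"
  using assms by (simp add: balanced_map_def)

lemma balanced_mapD:
  assumes "balanced_map A ra la M N G \<beta>"
  shows "x \<in> carrier M \<Longrightarrow> y \<in> carrier N \<Longrightarrow> \<beta> x y \<in> carrier G"
    and "x \<in> carrier M \<Longrightarrow> x' \<in> carrier M \<Longrightarrow> y \<in> carrier N \<Longrightarrow>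
      \<beta> (x \<oplus>\<^bsub>M\<^esub> x') y = \<beta> x y \<otimes>\<^bsub>G\<^esub> \<beta> x' y"
    and "x \<in> carrier M \<Longrightarrow> y \<in> carrier N \<Longrightarrow> y' \<in> carrier N \<Longrightarrow>
      \<beta> x (y \<oplus>\<^bsub>N\<^esub> y') = \<beta> x y \<otimes>\<^bsub>G\<^esub> \<beta> x y'"
    and "x \<in> carrier M \<Longrightarrow> a \<in> A \<Longrightarrow> y \<in> carrier N \<Longrightarrow> \<beta> (ra x a) y = \<beta> x (la a y)"
  using assms by (simp_all add: balanced_map_def)

locale tensor_factors = M: abelian_group M + N: abelian_group N
  for M :: "('a, 'm) ring_scheme" and N :: "('b, 'n) ring_scheme" +
  fixes A :: "'r set" and ra :: "'a \<Rightarrow> 'r \<Rightarrow> 'a" and la :: "'r \<Rightarrow> 'b \<Rightarrow> 'b"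
  assumes ra_closed: "x \<in> carrier M \<Longrightarrow> a \<in> A \<Longrightarrow> ra x a \<in> carrier M"
    and la_closed: "a \<in> A \<Longrightarrow> y \<in> carrier N \<Longrightarrow> la a y \<in> carrier N"
begin

abbreviation "F \<equiv> free_Abelian_group (carrier M \<times> carrier N)"
abbreviation "rels \<equiv> generate F (balanced_rels A ra la M N)"
abbreviation "T \<equiv> balanced_tensor A ra la M N"

lemma balanced_rels_subset: "balanced_rels A ra la M N \<subseteq> carrier F"
proof -
  have d: "x \<in> carrier F \<Longrightarrow> y \<in> carrier F \<Longrightarrow> x - y \<in> carrier F" for x y
    using keys_diff[of x y] by auto
  have f: "x \<in> carrier M \<Longrightarrow> y \<in> carrier N \<Longrightarrow> frag_of (x, y) \<in> carrier F" for x y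
    by simp
  show ?thesis unfolding balanced_rels_def Un_subset_iff
    by (safe; intro d f ra_closed la_closed M.a_closed N.a_closed; assumption)
qed

lemma balanced_relsI:
  shows "x \<in> carrier M \<Longrightarrow> x' \<in> carrier M \<Longrightarrow> y \<in> carrier N \<Longrightarrow>
      frag_of (x \<oplus>\<^bsub>M\<^esub> x', y) - frag_of (x, y) - frag_of (x', y) \<in> balanced_rels A ra la M N"
    and "x \<in> carrier M \<Longrightarrow> y \<in> carrier N \<Longrightarrow> y' \<in> carrier N \<Longrightarrow>
      frag_of (x, y \<oplus>\<^bsub>N\<^esub> y') - frag_of (x, y) - frag_of (x, y') \<in> balanced_rels A ra la M N"
    and "x \<in> carrier M \<Longrightarrow> a \<in> A \<Longrightarrow> y \<in> carrier N \<Longrightarrow>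
      frag_of (ra x a, y) - frag_of (x, la a y) \<in> balanced_rels A ra la M N"
  unfolding balanced_rels_def by blast+

lemma rels_normal: "rels \<lhd> F"
  by (rule comm_group.subgroup_imp_normal[OF abelian_free_Abelian_group
        group.generate_is_subgroup[OF group_free_Abelian_group balanced_rels_subset]])

lemma T_eq: "T = F Mod rels"
  by (simp add: balanced_tensor_def Let_def)

lemma one_tensor: "\<one>\<^bsub>T\<^esub> = rels"
  by (simp add: T_eq)

lemma tensor_comm_group: "comm_group T"
  unfolding T_eq
  by (rule comm_group.abelian_FactGroup[OF abelian_free_Abelian_group normal_imp_subgroup[OF rels_normal]])

lemma coset_hom: "r_coset F rels \<in> hom F T"
  unfolding T_eq by (rule normal.r_coset_hom_Mod[OF rels_normal])

lemma pure_tensor_eq_coset: "pure_tensor T x y = r_coset F rels (frag_of (x, y))"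
  unfolding pure_tensor_def one_tensor r_coset_def by auto

lemma in_coset: "Poly_Mapping.keys t \<subseteq> carrier M \<times> carrier N \<Longrightarrow> t \<in> r_coset F rels t"
  by (metis group_free_Abelian_group carrier_free_Abelian_group_iff group.rcos_self normal_imp_subgroup rels_normal)

lemma tensor_repr:
  assumes "X \<in> carrier T"
  obtains t where "Poly_Mapping.keys t \<subseteq> carrier M \<times> carrier N" "X = r_coset F rels t"
  using assms unfolding T_eq carrier_FactGroup by auto

lemma tensor_repr_mem:
  assumes "X \<in> carrier T" "t \<in> X"
  shows "Poly_Mapping.keys t \<subseteq> carrier M \<times> carrier N" "X = r_coset F rels t"
proof -
  obtain s where s: "Poly_Mapping.keys s \<subseteq> carrier M \<times> carrier N" "X = r_coset F rels s"
    using tensor_repr[OF assms(1)] by blast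
  interpret group F by simp
  have sub: "subgroup rels F" by (rule normal_imp_subgroup[OF rels_normal])
  have "r_coset F rels s \<subseteq> carrier F"
    by (rule r_coset_subset_G[OF subgroup.subset[OF sub]]) (use s in simp)
  then have "t \<in> carrier F" using s assms(2) by blast
  then show "Poly_Mapping.keys t \<subseteq> carrier M \<times> carrier N" by simp
  show "X = r_coset F rels t"
    using repr_independence[of t rels s] s assms(2) sub by auto
qed

lemma pure_tensor_balanced: "balanced_map A ra la M N T (pure_tensor T)"
proof -
  interpret F: group F by simp
  interpret rels: normal rels F by (rule rels_normal)
  let ?k = "r_coset F rels"
  have add: "?k (s + t) = ?k s \<otimes>\<^bsub>T\<^esub> ?k t"
    if "s \<in> carrier F" "t \<in> carrier F" for s t
    using hom_mult[OF coset_hom that] by simp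
  have eq: "?k s = ?k t" if "s \<in> carrier F" "t \<in> carrier F" "s - t \<in> balanced_rels A ra la M N" for s t
  proof -
    have "s - t \<in> rels" by (rule generate.incl[OF that(3)])
    then have "s \<in> ?k t" unfolding r_coset_def by (intro UN_I[of "s - t"]) simp_all
    then show ?thesis
      by (rule F.repr_independence[OF _ that(2) normal_imp_subgroup[OF rels_normal], symmetric])
  qed
  have fc: "frag_of (x, y) \<in> carrier F" if "x \<in> carrier M" "y \<in> carrier N" for x y
    using that by simp
  have fc2: "s + t \<in> carrier F" if "s \<in> carrier F" "t \<in> carrier F" for s t
    using F.m_closed[OF that] by simp
  show ?thesis
  proof (rule balanced_mapI, unfold pure_tensor_eq_coset)
    fix x y assume "x \<in> carrier M" "y \<in> carrier N"
    then show "?k (frag_of (x, y)) \<in> carrier T" by (intro hom_in_carrier[OF coset_hom] fc)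
  next
    fix x x' y assume x: "x \<in> carrier M" "x' \<in> carrier M" "y \<in> carrier N"
    have "?k (frag_of (x \<oplus>\<^bsub>M\<^esub> x', y)) = ?k (frag_of (x, y) + frag_of (x', y))"
      by (rule eq; (intro fc fc2 M.a_closed N.a_closed x)?) (unfold diff_diff_eq[symmetric], rule balanced_relsI(1)[OF x])
    then show "?k (frag_of (x \<oplus>\<^bsub>M\<^esub> x', y)) = ?k (frag_of (x, y)) \<otimes>\<^bsub>T\<^esub> ?k (frag_of (x', y))"
      using add[OF fc fc] x by simp
  next
    fix x y y' assume x: "x \<in> carrier M" "y \<in> carrier N" "y' \<in> carrier N"
    have "?k (frag_of (x, y \<oplus>\<^bsub>N\<^esub> y')) = ?k (frag_of (x, y) + frag_of (x, y'))"
      by (rule eq; (intro fc fc2 M.a_closed N.a_closed x)?) (unfold diff_diff_eq[symmetric], rule balanced_relsI(2)[OF x])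
    then show "?k (frag_of (x, y \<oplus>\<^bsub>N\<^esub> y')) = ?k (frag_of (x, y)) \<otimes>\<^bsub>T\<^esub> ?k (frag_of (x, y'))"
      using add[OF fc fc] x by simp
  next
    fix x a y assume x: "x \<in> carrier M" "a \<in> A" "y \<in> carrier N"
    show "?k (frag_of (ra x a, y)) = ?k (frag_of (x, la a y))"
      by (rule eq; (intro fc ra_closed la_closed x)?) (rule balanced_relsI(3)[OF x])
  qed
qed

lemma pure_tensor_closed [intro, simp]:
  "x \<in> carrier M \<Longrightarrow> y \<in> carrier N \<Longrightarrow> pure_tensor T x y \<in> carrier T"
  by (rule balanced_mapD(1)[OF pure_tensor_balanced])

lemma tensor_hom_eqI:
  assumes "group G" "f \<in> hom T G" "g \<in> hom T G"
    and "\<And>x y. x \<in> carrier M \<Longrightarrow> y \<in> carrier N \<Longrightarrow> f (pure_tensor T x y) = g (pure_tensor T x y)"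
    and "X \<in> carrier T"
  shows "f X = g X"
proof -
  obtain t where t: "Poly_Mapping.keys t \<subseteq> carrier M \<times> carrier N" "X = r_coset F rels t"
    using tensor_repr[OF assms(5)] by blast
  have "(f \<circ> r_coset F rels) t = (g \<circ> r_coset F rels) t"
    by (rule free_Abelian_group_hom_eqI[OF assms(1) hom_compose[OF coset_hom assms(2)]
          hom_compose[OF coset_hom assms(3)] _ t(1)])
       (use assms(4) in \<open>auto simp: pure_tensor_eq_coset\<close>)
  then show ?thesis by (simp add: t)
qed

text \<open>
  Balancedness is exactly the vanishing of the evaluation on the three families of generating relations.
\<close>

lemma formal_sum_eval_rels:
  assumes G: "comm_group G" and \<beta>: "balanced_map A ra la M N G \<beta>"
    and "r \<in> rels"
  shows "formal_sum_eval G \<beta> r = \<one>\<^bsub>G\<^esub>"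
proof -
  interpret G: comm_group G by fact
  let ?h = "formal_sum_eval G \<beta>"
  have hom: "?h \<in> hom F G"
    by (rule formal_sum_eval_hom[OF G balanced_mapD(1)[OF \<beta>]])
  interpret h: group_hom F G ?h
    using hom G.is_group by (simp add: group_hom_def group_hom_axioms_def)
  have fo: "?h (frag_of (x, y)) = \<beta> x y" if "x \<in> carrier M" "y \<in> carrier N" for x y
    using formal_sum_eval_frag_of[OF G, of \<beta>] balanced_mapD(1)[OF \<beta> that] by blast
  have diff: "?h (s - t) = ?h s \<otimes>\<^bsub>G\<^esub> inv\<^bsub>G\<^esub> (?h t) \<and> s - t \<in> carrier F"
    if "s \<in> carrier F" "t \<in> carrier F" for s t
  proof -
    have "s - t = s \<otimes>\<^bsub>F\<^esub> inv\<^bsub>F\<^esub> t" using that by simp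
    then show ?thesis
      using that h.hom_mult[of s "inv\<^bsub>F\<^esub> t"] h.hom_inv[of t]
      by (metis h.G.inv_closed h.G.m_closed)
  qed
  have fc: "frag_of (x, y) \<in> carrier F" if "x \<in> carrier M" "y \<in> carrier N" for x y
    using that by simp
  have rel: "?h (u - v - w) = \<one>\<^bsub>G\<^esub>"
    if "u \<in> carrier F" "v \<in> carrier F" "w \<in> carrier F" "?h u = ?h v \<otimes>\<^bsub>G\<^esub> ?h w" for u v w
  proof -
    have c: "?h v \<in> carrier G" "?h w \<in> carrier G" using that hom_in_carrier[OF hom] by blast+
    have "?h (u - v - w) = ?h u \<otimes>\<^bsub>G\<^esub> inv\<^bsub>G\<^esub> (?h v) \<otimes>\<^bsub>G\<^esub> inv\<^bsub>G\<^esub> (?h w)"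
      using diff[of "u - v" w] diff[of u v] that by metis
    also have "\<dots> = ?h w \<otimes>\<^bsub>G\<^esub> ?h v \<otimes>\<^bsub>G\<^esub> inv\<^bsub>G\<^esub> (?h v) \<otimes>\<^bsub>G\<^esub> inv\<^bsub>G\<^esub> (?h w)"
      using G.m_comm[OF c] that(4) by metis
    also have "\<dots> = \<one>\<^bsub>G\<^esub>" using c by (simp add: G.m_assoc)
    finally show ?thesis .
  qed
  have "?h r = \<one>\<^bsub>G\<^esub>" if "r \<in> balanced_rels A ra la M N" for r
  proof -
    show ?thesis
      using that unfolding balanced_rels_def Un_iff mem_Collect_eq
    proof (elim disjE exE conjE, goal_cases)
      case (1 x x' y)
      show ?thesis unfolding 1(1)
        by (rule rel[OF fc fc fc])
          (use 1 balanced_mapD(2)[OF \<beta>, of x x' y] fo in simp_all)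
    next
      case (2 x y y')
      show ?thesis unfolding 2(1)
        by (rule rel[OF fc fc fc])
          (use 2 balanced_mapD(3)[OF \<beta>, of x y y'] fo in simp_all)
    next
      case (3 x a y)
      have "?h r = ?h (frag_of (ra x a, y)) \<otimes>\<^bsub>G\<^esub> inv\<^bsub>G\<^esub> ?h (frag_of (x, la a y))"
        unfolding 3(1) by (intro conjunct1[OF diff] fc ra_closed la_closed 3)
      also have "\<dots> = \<beta> x (la a y) \<otimes>\<^bsub>G\<^esub> inv\<^bsub>G\<^esub> \<beta> x (la a y)"
        using 3 balanced_mapD(4)[OF \<beta>, of x a y] by (simp add: fo ra_closed la_closed)
      also have "\<dots> = \<one>\<^bsub>G\<^esub>" using 3 balanced_mapD(1)[OF \<beta>] la_closed by simp
      finally show ?thesis .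
    qed
  qed
  then have "balanced_rels A ra la M N \<subseteq> kernel F G ?h"
    using balanced_rels_subset unfolding kernel_def by blast
  then have "rels \<subseteq> kernel F G ?h"
    by (rule h.G.generate_subgroup_incl[OF _ h.subgroup_kernel])
  then show ?thesis using assms(3) by (auto simp: kernel_def)
qed

text \<open>
  By the vanishing on relations, all representatives of a coset have the same value, so the image whose
  element defines \<open>tensor_lift\<close> is a singleton.
\<close>

lemma tensor_lift_coset:
  assumes G: "comm_group G" and \<beta>: "balanced_map A ra la M N G \<beta>"
    and t: "Poly_Mapping.keys t \<subseteq> carrier M \<times> carrier N"
  shows "tensor_lift G \<beta> (r_coset F rels t) = formal_sum_eval G \<beta> t"
proof -
  interpret G: comm_group G by fact
  have hom: "formal_sum_eval G \<beta> \<in> hom F G"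
    by (rule formal_sum_eval_hom[OF G balanced_mapD(1)[OF \<beta>]])
  have "formal_sum_eval G \<beta> s = formal_sum_eval G \<beta> t" if s: "s \<in> r_coset F rels t" for s
  proof -
    obtain r where r: "r \<in> rels" "s = r \<otimes>\<^bsub>F\<^esub> t" using s by (auto simp: r_coset_def)
    have "r \<in> carrier F"
      by (rule subsetD[OF subgroup.subset[OF normal_imp_subgroup[OF rels_normal]] r(1)])
    then have "formal_sum_eval G \<beta> s = formal_sum_eval G \<beta> r \<otimes>\<^bsub>G\<^esub> formal_sum_eval G \<beta> t"
      unfolding r(2) using t by (intro hom_mult[OF hom]) auto
    then show ?thesis
      using formal_sum_eval_rels[OF G \<beta> r(1)] hom_in_carrier[OF hom, of t] t by simp
  qed
  then have "formal_sum_eval G \<beta> ` r_coset F rels t = {formal_sum_eval G \<beta> t}"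
    using in_coset[OF t] by blast
  then show ?thesis by (simp add: tensor_lift_def)
qed

lemma tensor_lift_repr:
  assumes "comm_group G" "balanced_map A ra la M N G \<beta>" "X \<in> carrier T" "t \<in> X"
  shows "tensor_lift G \<beta> X = formal_sum_eval G \<beta> t"
  using tensor_lift_coset[OF assms(1,2)] tensor_repr_mem[OF assms(3,4)] by simp

lemma tensor_nonempty: "X \<in> carrier T \<Longrightarrow> X \<noteq> {}"
  using tensor_repr in_coset by blast

lemma tensor_lift_hom:
  assumes G: "comm_group G" and \<beta>: "balanced_map A ra la M N G \<beta>"
  shows "tensor_lift G \<beta> \<in> hom T G"
proof -
  have hom: "formal_sum_eval G \<beta> \<in> hom F G"
    by (rule formal_sum_eval_hom[OF G balanced_mapD(1)[OF \<beta>]])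
  show ?thesis
  proof (rule homI)
    fix X assume "X \<in> carrier T"
    then obtain t where t: "Poly_Mapping.keys t \<subseteq> carrier M \<times> carrier N" "X = r_coset F rels t"
      using tensor_repr by blast
    then show "tensor_lift G \<beta> X \<in> carrier G"
      using hom_in_carrier[OF hom, of t] by (simp add: tensor_lift_coset[OF G \<beta>])
  next
    fix X Y assume "X \<in> carrier T" "Y \<in> carrier T"
    then obtain s t where s: "Poly_Mapping.keys s \<subseteq> carrier M \<times> carrier N" "X = r_coset F rels s"
      and t: "Poly_Mapping.keys t \<subseteq> carrier M \<times> carrier N" "Y = r_coset F rels t"
      using tensor_repr by metis
    have "X \<otimes>\<^bsub>T\<^esub> Y = r_coset F rels (s + t)"
      using hom_mult[OF coset_hom, of s t] s t by simp
    moreover have "Poly_Mapping.keys (s + t) \<subseteq> carrier M \<times> carrier N"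
      using keys_add[of s t] s(1) t(1) by blast
    moreover have "formal_sum_eval G \<beta> (s + t) = formal_sum_eval G \<beta> s \<otimes>\<^bsub>G\<^esub> formal_sum_eval G \<beta> t"
      using hom_mult[OF hom, of s t] s t by simp
    ultimately show "tensor_lift G \<beta> (X \<otimes>\<^bsub>T\<^esub> Y) = tensor_lift G \<beta> X \<otimes>\<^bsub>G\<^esub> tensor_lift G \<beta> Y"
      using s t by (simp add: tensor_lift_coset[OF G \<beta>])
  qed
qed

lemma tensor_lift_pure:
  assumes "comm_group G" "balanced_map A ra la M N G \<beta>" "x \<in> carrier M" "y \<in> carrier N"
  shows "tensor_lift G \<beta> (pure_tensor T x y) = \<beta> x y"
  using assms tensor_lift_coset[OF assms(1,2), of "frag_of (x, y)"] balanced_mapD(1)[OF assms(2)]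
  by (simp add: pure_tensor_eq_coset formal_sum_eval_frag_of)

lemma tensor_lift_cong:
  assumes "comm_group G" "balanced_map A ra la M N G \<beta>'" "X \<in> carrier T"
    and "\<And>x y. x \<in> carrier M \<Longrightarrow> y \<in> carrier N \<Longrightarrow> \<beta> x y = \<beta>' x y"
  shows "tensor_lift G \<beta> X = tensor_lift G \<beta>' X"
proof -
  have "formal_sum_eval G \<beta> t = formal_sum_eval G \<beta>' t" if "t \<in> X" for t
    by (rule formal_sum_eval_cong[OF assms(1) tensor_repr_mem(1)[OF assms(3) that]])
      (use assms(4) balanced_mapD(1)[OF assms(2)] in simp)
  then have "formal_sum_eval G \<beta> ` X = formal_sum_eval G \<beta>' ` X"
    by (intro image_cong refl)
  then show ?thesis by (simp add: tensor_lift_def)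
qed

lemma tensor_induct:
  assumes X: "X \<in> carrier T" and one: "P \<one>\<^bsub>T\<^esub>"
    and pure: "\<And>x y. x \<in> carrier M \<Longrightarrow> y \<in> carrier N \<Longrightarrow> P (pure_tensor T x y)"
    and diff: "\<And>X Y. X \<in> carrier T \<Longrightarrow> Y \<in> carrier T \<Longrightarrow> P X \<Longrightarrow> P Y \<Longrightarrow> P (X \<otimes>\<^bsub>T\<^esub> inv\<^bsub>T\<^esub> Y)"
  shows "P X"
proof -
  interpret T: comm_group T by (rule tensor_comm_group)
  interpret c: group_hom F T "r_coset F rels"
    using coset_hom T.is_group by (simp add: group_hom_def group_hom_axioms_def)
  obtain t where t: "Poly_Mapping.keys t \<subseteq> carrier M \<times> carrier N" "X = r_coset F rels t"
    using tensor_repr[OF X] by blast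
  show ?thesis unfolding t(2)
  proof (rule free_Abelian_group_induct[where P = "\<lambda>t. P (r_coset F rels t)", OF t(1)])
    show "P (r_coset F rels 0)" using one c.hom_one by simp
  next
    fix x y assume xy: "Poly_Mapping.keys x \<subseteq> carrier M \<times> carrier N" "Poly_Mapping.keys y \<subseteq> carrier M \<times> carrier N"
      "P (r_coset F rels x)" "P (r_coset F rels y)"
    have "r_coset F rels (x - y) = r_coset F rels x \<otimes>\<^bsub>T\<^esub> inv\<^bsub>T\<^esub> r_coset F rels y"
      using xy c.hom_mult[of x "inv\<^bsub>F\<^esub> y"] c.hom_inv[of y] by simp
    then show "P (r_coset F rels (x - y))"
      using diff xy hom_in_carrier[OF coset_hom] by simp
  next
    fix p assume "p \<in> carrier M \<times> carrier N"
    then show "P (r_coset F rels (frag_of p))" using pure by (auto simp: pure_tensor_eq_coset)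
  qed
qed

end

section \<open>Tensor products and quotients of vector spaces\<close>

lemma linear_mapD:
  assumes "linear_map k M N f"
  shows "x \<in> carrier M \<Longrightarrow> f x \<in> carrier N"
    and "x \<in> carrier M \<Longrightarrow> y \<in> carrier M \<Longrightarrow> f (x \<oplus>\<^bsub>M\<^esub> y) = f x \<oplus>\<^bsub>N\<^esub> f y"
    and "c \<in> carrier k \<Longrightarrow> x \<in> carrier M \<Longrightarrow> f (c \<odot>\<^bsub>M\<^esub> x) = c \<odot>\<^bsub>N\<^esub> f x"
  using assms by (auto simp: linear_map_def)

abbreviation k_balanced ::
  "('k, 'f) ring_scheme \<Rightarrow> ('k, 'a, 'm) module_scheme \<Rightarrow> ('k, 'b, 'n) module_scheme \<Rightarrow>
    ('c, 'l) monoid_scheme \<Rightarrow> ('a \<Rightarrow> 'b \<Rightarrow> 'c) \<Rightarrow> bool" where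
  "k_balanced k M N G \<beta> \<equiv>
     balanced_map (carrier k) (\<lambda>x c. c \<odot>\<^bsub>M\<^esub> x) (\<lambda>c y. c \<odot>\<^bsub>N\<^esub> y) M N G \<beta>"

locale tensor_modules = M: module k M + N: module k N
  for k :: "('k, 'f) ring_scheme" and M :: "('k, 'a, 'm) module_scheme"
    and N :: "('k, 'b, 'n) module_scheme"
begin

sublocale tensor_factors M N "carrier k" "\<lambda>x c. c \<odot>\<^bsub>M\<^esub> x" "\<lambda>c y. c \<odot>\<^bsub>N\<^esub> y"
  rewrites "balanced_tensor (carrier k) (\<lambda>x c. c \<odot>\<^bsub>M\<^esub> x) (\<lambda>c y. c \<odot>\<^bsub>N\<^esub> y) M N = tensor_group k M N"
proof -
  show "tensor_factors M N (carrier k) (\<lambda>x c. c \<odot>\<^bsub>M\<^esub> x) (\<lambda>c y. c \<odot>\<^bsub>N\<^esub> y)"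
    by unfold_locales auto
qed (simp add: tensor_group_def)

abbreviation "TM \<equiv> tensor_module k M N"

lemma tensor_module_simps:
  "carrier TM = carrier (tensor_group k M N)"
  "\<zero>\<^bsub>TM\<^esub> = \<one>\<^bsub>tensor_group k M N\<^esub>"
  "X \<oplus>\<^bsub>TM\<^esub> Y = X \<otimes>\<^bsub>tensor_group k M N\<^esub> Y"
  by (simp_all add: tensor_module_def Let_def)

text \<open>
  Scalars left_action through the left factor; this is well defined because scalars commute.
\<close>

lemma smult_balanced:
  assumes "c \<in> carrier k"
  shows "k_balanced k M N (tensor_group k M N) (\<lambda>x y. pure_tensor (tensor_group k M N) (c \<odot>\<^bsub>M\<^esub> x) y)"
proof (rule balanced_mapI)
  fix x a y assume x: "x \<in> carrier M" "a \<in> carrier k" "y \<in> carrier N"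
  have "c \<odot>\<^bsub>M\<^esub> (a \<odot>\<^bsub>M\<^esub> x) = a \<odot>\<^bsub>M\<^esub> (c \<odot>\<^bsub>M\<^esub> x)"
    using x assms M.smult_assoc1[symmetric] M.R.m_comm by simp
  then show "pure_tensor (tensor_group k M N) (c \<odot>\<^bsub>M\<^esub> (a \<odot>\<^bsub>M\<^esub> x)) y =
      pure_tensor (tensor_group k M N) (c \<odot>\<^bsub>M\<^esub> x) (a \<odot>\<^bsub>N\<^esub> y)"
    using balanced_mapD(4)[OF pure_tensor_balanced, of "c \<odot>\<^bsub>M\<^esub> x" a y] x assms by simp
qed (use assms balanced_mapD[OF pure_tensor_balanced] M.smult_r_distr in simp_all)

lemma smult_hom:
  "c \<in> carrier k \<Longrightarrow> (\<lambda>X. c \<odot>\<^bsub>TM\<^esub> X) \<in> hom (tensor_group k M N) (tensor_group k M N)"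
  using tensor_lift_hom[OF tensor_comm_group smult_balanced]
  by (simp add: tensor_module_def Let_def)

lemma smult_pure:
  "c \<in> carrier k \<Longrightarrow> x \<in> carrier M \<Longrightarrow> y \<in> carrier N \<Longrightarrow>
    c \<odot>\<^bsub>TM\<^esub> pure_tensor (tensor_group k M N) x y = pure_tensor (tensor_group k M N) (c \<odot>\<^bsub>M\<^esub> x) y"
  using tensor_lift_pure[OF tensor_comm_group smult_balanced]
  by (simp add: tensor_module_def Let_def)

lemma smult_closed_tensor:
  "c \<in> carrier k \<Longrightarrow> X \<in> carrier (tensor_group k M N) \<Longrightarrow> c \<odot>\<^bsub>TM\<^esub> X \<in> carrier (tensor_group k M N)"
  by (rule hom_in_carrier[OF smult_hom])

lemma tensor_module: "module k TM"
proof -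
  let ?T = "tensor_group k M N"
  interpret T: comm_group ?T by (rule tensor_comm_group)
  have ab: "abelian_group TM"
  proof (rule abelian_groupI, unfold tensor_module_simps)
    fix X assume "X \<in> carrier ?T"
    then show "\<exists>Y\<in>carrier ?T. Y \<otimes>\<^bsub>?T\<^esub> X = \<one>\<^bsub>?T\<^esub>"
      using T.l_inv T.inv_closed by blast
  qed (simp_all add: T.m_ac)
  have hom_mult: "(\<lambda>X. f X \<otimes>\<^bsub>?T\<^esub> g X) \<in> hom ?T ?T" if "f \<in> hom ?T ?T" "g \<in> hom ?T ?T" for f g
    using that by (auto simp: hom_def Pi_def T.m_ac)
  show ?thesis
  proof (rule moduleI[OF M.R.is_cring ab], unfold tensor_module_simps)
    fix a b X assume a: "a \<in> carrier k" "b \<in> carrier k" and X: "X \<in> carrier ?T"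
    show "(a \<oplus>\<^bsub>k\<^esub> b) \<odot>\<^bsub>TM\<^esub> X = a \<odot>\<^bsub>TM\<^esub> X \<otimes>\<^bsub>?T\<^esub> (b \<odot>\<^bsub>TM\<^esub> X)"
    proof (rule tensor_hom_eqI[OF T.is_group _ _ _ X])
      show "(\<lambda>X. (a \<oplus>\<^bsub>k\<^esub> b) \<odot>\<^bsub>TM\<^esub> X) \<in> hom ?T ?T" using a smult_hom by simp
      show "(\<lambda>X. a \<odot>\<^bsub>TM\<^esub> X \<otimes>\<^bsub>?T\<^esub> (b \<odot>\<^bsub>TM\<^esub> X)) \<in> hom ?T ?T"
        by (rule hom_mult[OF smult_hom smult_hom]) (use a in simp_all)
    qed (use a in \<open>simp add: smult_pure M.smult_l_distr balanced_mapD(2)[OF pure_tensor_balanced]\<close>)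
    show "(a \<otimes>\<^bsub>k\<^esub> b) \<odot>\<^bsub>TM\<^esub> X = a \<odot>\<^bsub>TM\<^esub> (b \<odot>\<^bsub>TM\<^esub> X)"
    proof (rule tensor_hom_eqI[OF T.is_group _ _ _ X])
      show "(\<lambda>X. (a \<otimes>\<^bsub>k\<^esub> b) \<odot>\<^bsub>TM\<^esub> X) \<in> hom ?T ?T" using a smult_hom by simp
      show "(\<lambda>X. a \<odot>\<^bsub>TM\<^esub> (b \<odot>\<^bsub>TM\<^esub> X)) \<in> hom ?T ?T"
        using hom_compose[OF smult_hom[OF a(2)] smult_hom[OF a(1)]] by (simp add: o_def)
    qed (use a in \<open>simp add: smult_pure M.smult_assoc1\<close>)
  next
    fix X assume X: "X \<in> carrier ?T"
    show "\<one>\<^bsub>k\<^esub> \<odot>\<^bsub>TM\<^esub> X = X"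
    proof (rule tensor_hom_eqI[OF T.is_group _ _ _ X])
      show "(\<lambda>X. \<one>\<^bsub>k\<^esub> \<odot>\<^bsub>TM\<^esub> X) \<in> hom ?T ?T" using smult_hom by simp
      show "(\<lambda>X. X) \<in> hom ?T ?T" by (simp add: hom_def)
    qed (simp add: smult_pure)
  next
    fix a X Y assume "a \<in> carrier k" "X \<in> carrier ?T" "Y \<in> carrier ?T"
    then show "a \<odot>\<^bsub>TM\<^esub> (X \<otimes>\<^bsub>?T\<^esub> Y) = a \<odot>\<^bsub>TM\<^esub> X \<otimes>\<^bsub>?T\<^esub> (a \<odot>\<^bsub>TM\<^esub> Y)"
      by (intro Group.hom_mult[OF smult_hom])
  qed (rule smult_closed_tensor)
qed

end

lemma zero_quotient_module: "\<zero>\<^bsub>quotient_module H I\<^esub> = I"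
  by (simp add: quotient_module_def FactRing_def ring.defs module.defs)

locale quotient_space = M: module k M for k :: "('k, 'f) ring_scheme"
  and M :: "('k, 'a, 'm) module_scheme" +
  fixes J assumes J: "submodule J k M"
begin

abbreviation "Q \<equiv> quotient_module M J"
abbreviation "\<pi> \<equiv> quotient_proj M Q"

sublocale J: abelian_subgroup J M
  using J by (intro abelian_subgroupI3 additive_subgroup.intro M.abelian_group_axioms)
    (simp add: submodule_def)

lemma quotient_simps:
  "carrier Q = a_rcosets\<^bsub>M\<^esub> J" "\<zero>\<^bsub>Q\<^esub> = J" "X \<oplus>\<^bsub>Q\<^esub> Y = X <+>\<^bsub>M\<^esub> Y"
  "c \<odot>\<^bsub>Q\<^esub> X = (\<Union>x\<in>X. J +>\<^bsub>M\<^esub> (c \<odot>\<^bsub>M\<^esub> x))"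
  by (simp_all add: quotient_module_def FactRing_def ring.defs module.defs)

lemma proj_eq: "\<pi> x = J +>\<^bsub>M\<^esub> x"
  by (simp add: quotient_proj_def quotient_simps)

lemma proj_closed [simp, intro]: "x \<in> carrier M \<Longrightarrow> \<pi> x \<in> carrier Q"
  by (simp add: proj_eq quotient_simps M.a_rcosetsI J.a_subset)

lemma proj_surj: "q \<in> carrier Q \<Longrightarrow> \<exists>x\<in>carrier M. q = \<pi> x"
  by (auto simp: proj_eq quotient_simps A_RCOSETS_def')+

lemma proj_add: "x \<in> carrier M \<Longrightarrow> y \<in> carrier M \<Longrightarrow> \<pi> (x \<oplus>\<^bsub>M\<^esub> y) = \<pi> x \<oplus>\<^bsub>Q\<^esub> \<pi> y"
  by (simp add: proj_eq quotient_simps J.a_rcos_sum)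

lemma proj_eq_iff:
  assumes "x \<in> carrier M" "y \<in> carrier M"
  shows "\<pi> x = \<pi> y \<longleftrightarrow> x \<ominus>\<^bsub>M\<^esub> y \<in> J"
proof -
  have m: "x \<in> J +>\<^bsub>M\<^esub> y \<longleftrightarrow> x \<ominus>\<^bsub>M\<^esub> y \<in> J"
    unfolding a_minus_def by (rule J.a_rcos_module[OF assms(2,1)])
  have self: "x \<in> J +>\<^bsub>M\<^esub> x" by (rule J.a_rcos_self[OF assms(1)])
  show ?thesis unfolding proj_eq m[symmetric]
  proof
    assume "J +>\<^bsub>M\<^esub> x = J +>\<^bsub>M\<^esub> y" then show "x \<in> J +>\<^bsub>M\<^esub> y" using self by simp
  next
    assume "x \<in> J +>\<^bsub>M\<^esub> y"
    then show "J +>\<^bsub>M\<^esub> x = J +>\<^bsub>M\<^esub> y"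
      by (rule M.a_repr_independence[OF _ assms(2) J.a_subgroup, symmetric])
  qed
qed

text \<open>
  The scalar action on cosets is a union over representatives; all of them give the same coset because
  \<open>J\<close> is stable under scalars.
\<close>

lemma proj_smult: assumes "c \<in> carrier k" "x \<in> carrier M" shows "\<pi> (c \<odot>\<^bsub>M\<^esub> x) = c \<odot>\<^bsub>Q\<^esub> \<pi> x"
proof -
  have "\<pi> (c \<odot>\<^bsub>M\<^esub> y) = \<pi> (c \<odot>\<^bsub>M\<^esub> x)" if y: "y \<in> \<pi> x" for y
  proof -
    have yM: "y \<in> carrier M"
      using y assms unfolding proj_eq using M.a_r_coset_subset_G[OF J.a_subset] by blast
    have "\<pi> y = \<pi> x"
      using M.a_repr_independence[of y J x] y assms J.a_subgroup unfolding proj_eq by simp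
    then have "y \<ominus>\<^bsub>M\<^esub> x \<in> J" using proj_eq_iff yM assms by blast
    then have "c \<odot>\<^bsub>M\<^esub> (y \<ominus>\<^bsub>M\<^esub> x) \<in> J" using submodule.smult_closed[OF J] assms by blast
    then show ?thesis using assms yM
      by (subst proj_eq_iff) (simp_all add: a_minus_def M.smult_r_distr M.smult_r_minus)
  qed
  moreover have "x \<in> \<pi> x" using J.a_rcos_self assms by (simp add: proj_eq)
  ultimately show ?thesis unfolding quotient_simps(4) proj_eq[symmetric] by blast
qed

lemma quotient_module: "module k Q"
proof -
  have "abelian_group Q"
  proof (rule abelian_groupI)
    fix x assume "x \<in> carrier Q"
    then obtain a where a: "a \<in> carrier M" "x = \<pi> a" using proj_surj by blast
    have "\<pi> (\<ominus>\<^bsub>M\<^esub> a) \<oplus>\<^bsub>Q\<^esub> x = \<zero>\<^bsub>Q\<^esub>"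
      using a proj_add[of "\<ominus>\<^bsub>M\<^esub> a" a] by (simp add: M.l_neg proj_eq quotient_simps(2) J.a_subset)
    then show "\<exists>y\<in>carrier Q. y \<oplus>\<^bsub>Q\<^esub> x = \<zero>\<^bsub>Q\<^esub>" using a by blast
  next
    fix x assume "x \<in> carrier Q"
    then obtain a where a: "a \<in> carrier M" "x = \<pi> a" using proj_surj by blast
    have "\<zero>\<^bsub>Q\<^esub> = \<pi> \<zero>\<^bsub>M\<^esub>" by (simp add: proj_eq quotient_simps(2) J.a_subset)
    then show "\<zero>\<^bsub>Q\<^esub> \<oplus>\<^bsub>Q\<^esub> x = x" using a proj_add[of "\<zero>\<^bsub>M\<^esub>" a] by simp
  next
    show "\<zero>\<^bsub>Q\<^esub> \<in> carrier Q" using proj_closed[of "\<zero>\<^bsub>M\<^esub>"] by (simp add: proj_eq quotient_simps(2) J.a_subset)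
  qed (auto dest!: proj_surj simp: proj_add[symmetric] M.a_ac)
  then show ?thesis
    by (rule moduleI[OF M.R.is_cring])
       (auto dest!: proj_surj simp: proj_add[symmetric] proj_smult[symmetric] M.smult_l_distr
          M.smult_r_distr M.smult_assoc1)
qed

end

section \<open>Generalised inverses of linear maps\<close>

text \<open>
  This is the form in which vector spaces being free is used: \<open>s f\<close> projects \<open>M\<close> onto a complement of
  the kernel of \<open>f\<close>.  Zorn's lemma is applied to graphs of partial linear maps from \<open>W\<close> to \<open>M\<close> that
  invert \<open>f\<close> wherever they are defined on its image.  A maximal graph is total: a missing \<open>w\<close> could be added
  with value a preimage of some \<open>w + d\<close> if the coset of \<open>w\<close> modulo the domain meets the image of \<open>f\<close>, and
  with value zero otherwise.
\<close>

lemma linear_map_generalised_inverse: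
  assumes k: "field k" and M: "module k M" and W: "module k W" and f: "linear_map k M W f"
  shows "\<exists>s. linear_map k W M s \<and> (\<forall>x\<in>carrier M. f (s (f x)) = f x)"
proof -
  interpret k: field k by fact
  interpret M: module k M by fact
  interpret W: module k W by fact
  let ?im = "f ` carrier M"
  have f0: "f \<zero>\<^bsub>M\<^esub> = \<zero>\<^bsub>W\<^esub>"
    using linear_mapD(3)[OF f, of "\<zero>\<^bsub>k\<^esub>" "\<zero>\<^bsub>M\<^esub>"] linear_mapD(1)[OF f, of "\<zero>\<^bsub>M\<^esub>"] by simp
  have im_add: "u \<oplus>\<^bsub>W\<^esub> v \<in> ?im" if "u \<in> ?im" "v \<in> ?im" for u v
  proof -
    from that obtain x y where "x \<in> carrier M" "y \<in> carrier M" "u = f x" "v = f y" by blast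
    then show ?thesis using linear_mapD(2)[OF f] by (intro image_eqI[of _ _ "x \<oplus>\<^bsub>M\<^esub> y"]) simp_all
  qed
  have im_smult: "c \<odot>\<^bsub>W\<^esub> u \<in> ?im" if "c \<in> carrier k" "u \<in> ?im" for c u
  proof -
    from that obtain x where "x \<in> carrier M" "u = f x" by blast
    then show ?thesis
      using linear_mapD(3)[OF f] that(1) by (intro image_eqI[of _ _ "c \<odot>\<^bsub>M\<^esub> x"]) simp_all
  qed
  \<comment> \<open>The last but one clause makes a subspace single-valued.\<close>
  define good where "good G \<longleftrightarrow> G \<subseteq> carrier W \<times> carrier M \<and> (\<zero>\<^bsub>W\<^esub>, \<zero>\<^bsub>M\<^esub>) \<in> G \<and>
    (\<forall>w m w' m'. (w, m) \<in> G \<longrightarrow> (w', m') \<in> G \<longrightarrow> (w \<oplus>\<^bsub>W\<^esub> w', m \<oplus>\<^bsub>M\<^esub> m') \<in> G) \<and>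
    (\<forall>c w m. c \<in> carrier k \<longrightarrow> (w, m) \<in> G \<longrightarrow> (c \<odot>\<^bsub>W\<^esub> w, c \<odot>\<^bsub>M\<^esub> m) \<in> G) \<and>
    (\<forall>m. (\<zero>\<^bsub>W\<^esub>, m) \<in> G \<longrightarrow> m = \<zero>\<^bsub>M\<^esub>) \<and>
    (\<forall>w m. (w, m) \<in> G \<longrightarrow> w \<in> ?im \<longrightarrow> f m = w)" for G
  have "\<exists>G\<in>Collect good. \<forall>X\<in>Collect good. G \<subseteq> X \<longrightarrow> X = G"
  proof (rule subset_Zorn_nonempty)
    have "good {(\<zero>\<^bsub>W\<^esub>, \<zero>\<^bsub>M\<^esub>)}" by (auto simp: good_def f0)
    then show "Collect good \<noteq> {}" by blast
  next
    fix \<C> assume "\<C> \<noteq> {}" and C: "subset.chain (Collect good) \<C>"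
    have g: "good G" if "G \<in> \<C>" for G using C that by (auto simp: subset_chain_def)
    have two: "\<exists>G\<in>\<C>. p \<in> G \<and> q \<in> G" if "p \<in> \<Union>\<C>" "q \<in> \<Union>\<C>" for p q
      using that C unfolding subset_chain_def by blast
    have "good (\<Union>\<C>)"
      unfolding good_def
    proof (intro conjI allI impI)
      show "\<Union>\<C> \<subseteq> carrier W \<times> carrier M" using g unfolding good_def by blast
      show "(\<zero>\<^bsub>W\<^esub>, \<zero>\<^bsub>M\<^esub>) \<in> \<Union>\<C>" using g \<open>\<C> \<noteq> {}\<close> unfolding good_def by blast
    next
      fix w m w' m' assume "(w, m) \<in> \<Union>\<C>" "(w', m') \<in> \<Union>\<C>"
      then obtain G where G: "G \<in> \<C>" "(w, m) \<in> G" "(w', m') \<in> G" using two by blast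
      then have "(w \<oplus>\<^bsub>W\<^esub> w', m \<oplus>\<^bsub>M\<^esub> m') \<in> G" using g[OF G(1)] unfolding good_def by blast
      then show "(w \<oplus>\<^bsub>W\<^esub> w', m \<oplus>\<^bsub>M\<^esub> m') \<in> \<Union>\<C>" using G(1) by blast
    next
      fix c w m assume c: "c \<in> carrier k" "(w, m) \<in> \<Union>\<C>"
      then obtain G where G: "G \<in> \<C>" "(w, m) \<in> G" by blast
      then have "(c \<odot>\<^bsub>W\<^esub> w, c \<odot>\<^bsub>M\<^esub> m) \<in> G" using g[OF G(1)] c(1) unfolding good_def by blast
      then show "(c \<odot>\<^bsub>W\<^esub> w, c \<odot>\<^bsub>M\<^esub> m) \<in> \<Union>\<C>" using G(1) by blast
    next
      fix m assume "(\<zero>\<^bsub>W\<^esub>, m) \<in> \<Union>\<C>"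
      then obtain G where G: "G \<in> \<C>" "(\<zero>\<^bsub>W\<^esub>, m) \<in> G" by blast
      then show "m = \<zero>\<^bsub>M\<^esub>" using g[OF G(1)] unfolding good_def by blast
    next
      fix w m assume w: "(w, m) \<in> \<Union>\<C>" "w \<in> ?im"
      then obtain G where G: "G \<in> \<C>" "(w, m) \<in> G" by blast
      then show "f m = w" using g[OF G(1)] w(2) unfolding good_def by blast
    qed
    then show "\<Union>\<C> \<in> Collect good" by simp
  qed
  then obtain G where G: "good G" and max: "\<And>X. good X \<Longrightarrow> G \<subseteq> X \<Longrightarrow> X = G" by blast
  have "G \<subseteq> carrier W \<times> carrier M" using G unfolding good_def by (rule conjunct1)
  then have GD: "w \<in> carrier W" "m \<in> carrier M" if "(w, m) \<in> G" for w m
    using that by auto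
  have G0: "(\<zero>\<^bsub>W\<^esub>, \<zero>\<^bsub>M\<^esub>) \<in> G" using G unfolding good_def by blast
  have Gadd: "(w \<oplus>\<^bsub>W\<^esub> w', m \<oplus>\<^bsub>M\<^esub> m') \<in> G" if "(w, m) \<in> G" "(w', m') \<in> G" for w m w' m'
    using G that unfolding good_def by blast
  have Gsm: "(c \<odot>\<^bsub>W\<^esub> w, c \<odot>\<^bsub>M\<^esub> m) \<in> G" if "c \<in> carrier k" "(w, m) \<in> G" for c w m
    using G that unfolding good_def by blast
  have Gker: "m = \<zero>\<^bsub>M\<^esub>" if "(\<zero>\<^bsub>W\<^esub>, m) \<in> G" for m
    using G that unfolding good_def by blast
  have Gf: "f m = w" if "(w, m) \<in> G" "w \<in> ?im" for w m
    using G that unfolding good_def by blast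
  have neg: "(\<ominus>\<^bsub>k\<^esub> \<one>\<^bsub>k\<^esub>) \<odot>\<^bsub>W\<^esub> w = \<ominus>\<^bsub>W\<^esub> w" if "w \<in> carrier W" for w
    using that W.smult_l_minus[of "\<one>\<^bsub>k\<^esub>" w] by simp
  have negM: "(\<ominus>\<^bsub>k\<^esub> \<one>\<^bsub>k\<^esub>) \<odot>\<^bsub>M\<^esub> w = \<ominus>\<^bsub>M\<^esub> w" if "w \<in> carrier M" for w
    using that M.smult_l_minus[of "\<one>\<^bsub>k\<^esub>" w] by simp
  have Gneg: "(\<ominus>\<^bsub>W\<^esub> w, \<ominus>\<^bsub>M\<^esub> m) \<in> G" if "(w, m) \<in> G" for w m
    using Gsm[OF _ that, of "\<ominus>\<^bsub>k\<^esub> \<one>\<^bsub>k\<^esub>"] neg negM GD[OF that] by simp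
  have im_neg: "\<ominus>\<^bsub>W\<^esub> u \<in> ?im" if "u \<in> ?im" for u
    using im_smult[OF _ that, of "\<ominus>\<^bsub>k\<^esub> \<one>\<^bsub>k\<^esub>"] neg that linear_mapD(1)[OF f] by auto
  have inv: "c \<odot>\<^bsub>W\<^esub> (inv\<^bsub>k\<^esub> c \<odot>\<^bsub>W\<^esub> w) = w" "inv\<^bsub>k\<^esub> c \<odot>\<^bsub>W\<^esub> (c \<odot>\<^bsub>W\<^esub> w) = w" "inv\<^bsub>k\<^esub> c \<in> carrier k"
    if "c \<in> carrier k" "c \<noteq> \<zero>\<^bsub>k\<^esub>" "w \<in> carrier W" for c w
  proof -
    have u: "c \<in> Units k" using that by (simp add: k.field_Units)
    then show "inv\<^bsub>k\<^esub> c \<in> carrier k" by simp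
    then show "c \<odot>\<^bsub>W\<^esub> (inv\<^bsub>k\<^esub> c \<odot>\<^bsub>W\<^esub> w) = w" "inv\<^bsub>k\<^esub> c \<odot>\<^bsub>W\<^esub> (c \<odot>\<^bsub>W\<^esub> w) = w"
      using u that by (simp_all add: W.smult_assoc1[symmetric])
  qed
  have extend: False
    if w: "w' \<in> carrier W" "m' \<in> carrier M" and nG: "w' \<notin> Domain G"
      and fext: "\<And>c w m. c \<in> carrier k \<Longrightarrow> (w, m) \<in> G \<Longrightarrow> w \<oplus>\<^bsub>W\<^esub> (c \<odot>\<^bsub>W\<^esub> w') \<in> ?im \<Longrightarrow>
        f (m \<oplus>\<^bsub>M\<^esub> (c \<odot>\<^bsub>M\<^esub> m')) = w \<oplus>\<^bsub>W\<^esub> (c \<odot>\<^bsub>W\<^esub> w')" for w' m'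
  proof -
    define X where "X = {(w \<oplus>\<^bsub>W\<^esub> (c \<odot>\<^bsub>W\<^esub> w'), m \<oplus>\<^bsub>M\<^esub> (c \<odot>\<^bsub>M\<^esub> m')) | w m c. (w, m) \<in> G \<and> c \<in> carrier k}"
    have XI: "(w \<oplus>\<^bsub>W\<^esub> (c \<odot>\<^bsub>W\<^esub> w'), m \<oplus>\<^bsub>M\<^esub> (c \<odot>\<^bsub>M\<^esub> m')) \<in> X" if "(w, m) \<in> G" "c \<in> carrier k" for w m c
      using that unfolding X_def by blast
    have XE: "\<exists>w m c. a = w \<oplus>\<^bsub>W\<^esub> (c \<odot>\<^bsub>W\<^esub> w') \<and> b = m \<oplus>\<^bsub>M\<^esub> (c \<odot>\<^bsub>M\<^esub> m') \<and> (w, m) \<in> G \<and> c \<in> carrier k"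
      if "(a, b) \<in> X" for a b
      using that unfolding X_def by simp
    have sub: "G \<subseteq> X"
    proof clarify
      fix w m assume "(w, m) \<in> G"
      then show "(w, m) \<in> X" using XI[of w m "\<zero>\<^bsub>k\<^esub>"] GD w by simp
    qed
    have "good X"
      unfolding good_def
    proof (intro conjI allI impI)
      show "X \<subseteq> carrier W \<times> carrier M" unfolding X_def using GD w by auto
      show "(\<zero>\<^bsub>W\<^esub>, \<zero>\<^bsub>M\<^esub>) \<in> X" using sub G0 by blast
    next
      fix a b a' b' assume ab: "(a, b) \<in> X" "(a', b') \<in> X"
      obtain u m c where
        p: "a = u \<oplus>\<^bsub>W\<^esub> (c \<odot>\<^bsub>W\<^esub> w')" "b = m \<oplus>\<^bsub>M\<^esub> (c \<odot>\<^bsub>M\<^esub> m')" "(u, m) \<in> G" "c \<in> carrier k"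
        using XE[OF ab(1)] by blast
      obtain u2 m2 c2 where
        p2: "a' = u2 \<oplus>\<^bsub>W\<^esub> (c2 \<odot>\<^bsub>W\<^esub> w')" "b' = m2 \<oplus>\<^bsub>M\<^esub> (c2 \<odot>\<^bsub>M\<^esub> m')" "(u2, m2) \<in> G" "c2 \<in> carrier k"
        using XE[OF ab(2)] by blast
      have "a \<oplus>\<^bsub>W\<^esub> a' = (u \<oplus>\<^bsub>W\<^esub> u2) \<oplus>\<^bsub>W\<^esub> ((c \<oplus>\<^bsub>k\<^esub> c2) \<odot>\<^bsub>W\<^esub> w')"
        using p p2 GD w by (simp add: W.smult_l_distr W.a_ac)
      moreover have "b \<oplus>\<^bsub>M\<^esub> b' = (m \<oplus>\<^bsub>M\<^esub> m2) \<oplus>\<^bsub>M\<^esub> ((c \<oplus>\<^bsub>k\<^esub> c2) \<odot>\<^bsub>M\<^esub> m')"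
        using p p2 GD w by (simp add: M.smult_l_distr M.a_ac)
      ultimately show "(a \<oplus>\<^bsub>W\<^esub> a', b \<oplus>\<^bsub>M\<^esub> b') \<in> X"
        using XI[OF Gadd[OF p(3) p2(3)], of "c \<oplus>\<^bsub>k\<^esub> c2"] p(4) p2(4) by simp
    next
      fix e a b assume e: "e \<in> carrier k" and "(a, b) \<in> X"
      from this(2) obtain u m c where
        p: "a = u \<oplus>\<^bsub>W\<^esub> (c \<odot>\<^bsub>W\<^esub> w')" "b = m \<oplus>\<^bsub>M\<^esub> (c \<odot>\<^bsub>M\<^esub> m')" "(u, m) \<in> G" "c \<in> carrier k"
        using XE by blast
      have "e \<odot>\<^bsub>W\<^esub> a = (e \<odot>\<^bsub>W\<^esub> u) \<oplus>\<^bsub>W\<^esub> ((e \<otimes>\<^bsub>k\<^esub> c) \<odot>\<^bsub>W\<^esub> w')"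
        using p GD w e by (simp add: W.smult_r_distr W.smult_assoc1)
      moreover have "e \<odot>\<^bsub>M\<^esub> b = (e \<odot>\<^bsub>M\<^esub> m) \<oplus>\<^bsub>M\<^esub> ((e \<otimes>\<^bsub>k\<^esub> c) \<odot>\<^bsub>M\<^esub> m')"
        using p GD w e by (simp add: M.smult_r_distr M.smult_assoc1)
      ultimately show "(e \<odot>\<^bsub>W\<^esub> a, e \<odot>\<^bsub>M\<^esub> b) \<in> X"
        using XI[OF Gsm[OF e p(3)], of "e \<otimes>\<^bsub>k\<^esub> c"] p e by simp
    next
      fix b assume "(\<zero>\<^bsub>W\<^esub>, b) \<in> X"
      then obtain u m c where
        p: "\<zero>\<^bsub>W\<^esub> = u \<oplus>\<^bsub>W\<^esub> (c \<odot>\<^bsub>W\<^esub> w')" "b = m \<oplus>\<^bsub>M\<^esub> (c \<odot>\<^bsub>M\<^esub> m')" "(u, m) \<in> G" "c \<in> carrier k"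
        using XE by blast
      have u: "\<ominus>\<^bsub>W\<^esub> u = c \<odot>\<^bsub>W\<^esub> w'"
        using p(1,4) w GD[OF p(3)] W.minus_equality[of "c \<odot>\<^bsub>W\<^esub> w'" u] W.a_comm by simp
      have "c = \<zero>\<^bsub>k\<^esub>"
      proof (rule ccontr)
        assume c: "c \<noteq> \<zero>\<^bsub>k\<^esub>"
        have "(inv\<^bsub>k\<^esub> c \<odot>\<^bsub>W\<^esub> (\<ominus>\<^bsub>W\<^esub> u), inv\<^bsub>k\<^esub> c \<odot>\<^bsub>M\<^esub> (\<ominus>\<^bsub>M\<^esub> m)) \<in> G"
          by (rule Gsm[OF inv(3)[OF p(4) c w(1)] Gneg[OF p(3)]])
        then have "w' \<in> Domain G" unfolding u inv(2)[OF p(4) c w(1)] by blast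
        then show False using nG by blast
      qed
      then show "b = \<zero>\<^bsub>M\<^esub>" using p w GD[OF p(3)] Gker[of m] by simp
    next
      fix a b assume "(a, b) \<in> X" "a \<in> ?im"
      then show "f b = a" unfolding X_def using fext by blast
    qed
    then have "X = G" using max sub by blast
    moreover have "(w', m') \<in> X" using XI[OF G0 k.one_closed] w by simp
    ultimately show False using nG by blast
  qed
  have dom: "w \<in> Domain G" if w: "w \<in> carrier W" for w
  proof (rule ccontr)
    assume nG: "w \<notin> Domain G"
    show False
    proof (cases "\<exists>d n. (d, n) \<in> G \<and> w \<oplus>\<^bsub>W\<^esub> d \<in> ?im")
      case True
      then obtain d n m' where d: "(d, n) \<in> G" "w \<oplus>\<^bsub>W\<^esub> d = f m'" "m' \<in> carrier M" by blast
      show False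
      proof (rule extend[of "w \<oplus>\<^bsub>W\<^esub> d" m'])
        show "w \<oplus>\<^bsub>W\<^esub> d \<in> carrier W" "m' \<in> carrier M" using w d(3) GD(1)[OF d(1)] by simp_all
        show "w \<oplus>\<^bsub>W\<^esub> d \<notin> Domain G"
        proof
          assume "w \<oplus>\<^bsub>W\<^esub> d \<in> Domain G"
          then obtain e where "(w \<oplus>\<^bsub>W\<^esub> d, e) \<in> G" by blast
          from Gadd[OF this Gneg[OF d(1)]] have "w \<oplus>\<^bsub>W\<^esub> d \<oplus>\<^bsub>W\<^esub> \<ominus>\<^bsub>W\<^esub> d \<in> Domain G" by blast
          then show False using nG w GD[OF d(1)] by (simp add: W.a_assoc W.r_neg)
        qed
      next
        fix c u m assume c: "c \<in> carrier k" and u: "(u, m) \<in> G"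
          and im: "u \<oplus>\<^bsub>W\<^esub> c \<odot>\<^bsub>W\<^esub> (w \<oplus>\<^bsub>W\<^esub> d) \<in> ?im"
        have cl: "u \<in> carrier W" "f m' \<in> carrier W" using GD[OF u] linear_mapD(1)[OF f d(3)] by auto
        have i: "\<ominus>\<^bsub>W\<^esub> (c \<odot>\<^bsub>W\<^esub> f m') \<in> ?im" using im_neg[OF im_smult[OF c]] d(3) by blast
        have "(u \<oplus>\<^bsub>W\<^esub> c \<odot>\<^bsub>W\<^esub> f m') \<oplus>\<^bsub>W\<^esub> \<ominus>\<^bsub>W\<^esub> (c \<odot>\<^bsub>W\<^esub> f m') \<in> ?im"
          using im_add[OF im i] unfolding d(2) .
        then have "u \<in> ?im" using cl c by (simp add: W.a_assoc W.r_neg)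
        then have "f m = u" using Gf u by blast
        then show "f (m \<oplus>\<^bsub>M\<^esub> c \<odot>\<^bsub>M\<^esub> m') = u \<oplus>\<^bsub>W\<^esub> c \<odot>\<^bsub>W\<^esub> (w \<oplus>\<^bsub>W\<^esub> d)"
          unfolding d(2) using linear_mapD[OF f] GD[OF u] d(3) c by simp
      qed
    next
      case False
      show False
      proof (rule extend[of w "\<zero>\<^bsub>M\<^esub>", OF w M.zero_closed nG])
        fix c u m assume c: "c \<in> carrier k" and u: "(u, m) \<in> G" and im: "u \<oplus>\<^bsub>W\<^esub> c \<odot>\<^bsub>W\<^esub> w \<in> ?im"
        have "c = \<zero>\<^bsub>k\<^esub>"
        proof (rule ccontr)
          assume n: "c \<noteq> \<zero>\<^bsub>k\<^esub>"
          have "inv\<^bsub>k\<^esub> c \<odot>\<^bsub>W\<^esub> (u \<oplus>\<^bsub>W\<^esub> c \<odot>\<^bsub>W\<^esub> w) = w \<oplus>\<^bsub>W\<^esub> inv\<^bsub>k\<^esub> c \<odot>\<^bsub>W\<^esub> u"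
            using inv[OF c n w] GD[OF u] c w by (simp add: W.smult_r_distr W.a_comm)
          then have "w \<oplus>\<^bsub>W\<^esub> inv\<^bsub>k\<^esub> c \<odot>\<^bsub>W\<^esub> u \<in> ?im"
            using im_smult[OF inv(3)[OF c n w] im] by simp
          then show False using False Gsm[OF inv(3)[OF c n w] u] by blast
        qed
        then show "f (m \<oplus>\<^bsub>M\<^esub> c \<odot>\<^bsub>M\<^esub> \<zero>\<^bsub>M\<^esub>) = u \<oplus>\<^bsub>W\<^esub> c \<odot>\<^bsub>W\<^esub> w"
          using Gf[OF u] im GD[OF u] w by simp
      qed
    qed
  qed
  define s where "s w = (SOME m. (w, m) \<in> G)" for w
  have sG: "(w, s w) \<in> G" if "w \<in> carrier W" for w
    using dom[OF that] unfolding s_def by (metis Domain.cases someI_ex)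
  have uniq: "m = m'" if "(w, m) \<in> G" "(w, m') \<in> G" for w m m'
  proof -
    have "(w \<oplus>\<^bsub>W\<^esub> \<ominus>\<^bsub>W\<^esub> w, m \<oplus>\<^bsub>M\<^esub> \<ominus>\<^bsub>M\<^esub> m') \<in> G" by (rule Gadd[OF that(1) Gneg[OF that(2)]])
    then have "m \<oplus>\<^bsub>M\<^esub> \<ominus>\<^bsub>M\<^esub> m' = \<zero>\<^bsub>M\<^esub>" using Gker GD[OF that(1)] by (simp add: W.r_neg)
    moreover have "m = (m \<oplus>\<^bsub>M\<^esub> \<ominus>\<^bsub>M\<^esub> m') \<oplus>\<^bsub>M\<^esub> m'"
      using GD that by (simp add: M.a_assoc M.l_neg)
    ultimately show ?thesis using GD[OF that(2)] by simp
  qed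
  have "linear_map k W M s"
    unfolding linear_map_def
  proof (intro conjI ballI funcsetI)
    fix w assume "w \<in> carrier W" then show "s w \<in> carrier M" using GD sG by blast
  next
    fix w w' assume w: "w \<in> carrier W" "w' \<in> carrier W"
    show "s (w \<oplus>\<^bsub>W\<^esub> w') = s w \<oplus>\<^bsub>M\<^esub> s w'"
      by (rule uniq[OF sG Gadd[OF sG sG]]) (use w in simp_all)
  next
    fix c w assume w: "c \<in> carrier k" "w \<in> carrier W"
    show "s (c \<odot>\<^bsub>W\<^esub> w) = c \<odot>\<^bsub>M\<^esub> s w"
      by (rule uniq[OF sG Gsm[OF _ sG]]) (use w in simp_all)
  qed
  moreover have "f (s (f x)) = f x" if "x \<in> carrier M" for x
    using Gf[OF sG] linear_mapD(1)[OF f that] that by blast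
  ultimately show ?thesis by blast
qed

section \<open>Sweedler sums\<close>

text \<open>
  The Sweedler sum of \<open>\<beta>(h\<^sub>1, h\<^sub>2)\<close>, evaluated on a chosen formal sum representing \<open>\<Delta>(h)\<close>.
  Fixing the representative makes summation a finite operation that commutes with homomorphisms and
  with other such sums even when \<open>\<beta>\<close> is not bilinear; for balanced \<open>\<beta>\<close> the value is independent of
  the choice and equals \<open>tensor_lift G \<beta> (\<Delta> h)\<close>.
\<close>

definition sweedler ::
  "('k, 'h, 'm) hopf_scheme \<Rightarrow> ('c, 'l) monoid_scheme \<Rightarrow> ('h \<Rightarrow> 'h \<Rightarrow> 'c) \<Rightarrow> 'h \<Rightarrow> 'c" where
  "sweedler H G \<beta> h = formal_sum_eval G \<beta> (SOME t. t \<in> comult H h)"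

context hopf_algebra
begin

lemma module_H: "module k H" by (rule H.module_axioms)

sublocale HH: tensor_modules k H H
  by (intro tensor_modules.intro module_H)

sublocale HH_H: tensor_modules k "tensor_module k H H" H
  by (intro tensor_modules.intro module_H HH.tensor_module)

sublocale H_HH: tensor_modules k H "tensor_module k H H"
  by (intro tensor_modules.intro module_H HH.tensor_module)

abbreviation "T2 \<equiv> tensor_group k H H"
abbreviation "T3 \<equiv> tensor_group k (tensor_module k H H) H"
abbreviation "T3' \<equiv> tensor_group k H (tensor_module k H H)"
abbreviation "bal \<equiv> k_balanced k H H"
abbreviation "sw \<equiv> sweedler H"

lemma comult_closed [simp, intro]: "h \<in> carrier H \<Longrightarrow> comult H h \<in> carrier T2"
  using linear_mapD(1)[OF comult_linear] by (simp add: HH.tensor_module_simps)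

lemma sweedler_repr:
  assumes "h \<in> carrier H"
  shows "(SOME t. t \<in> comult H h) \<in> comult H h"
    "Poly_Mapping.keys (SOME t. t \<in> comult H h) \<subseteq> carrier H \<times> carrier H"
proof -
  show m: "(SOME t. t \<in> comult H h) \<in> comult H h"
    using HH.tensor_nonempty[OF comult_closed[OF assms]] by (simp add: some_in_eq)
  show "Poly_Mapping.keys (SOME t. t \<in> comult H h) \<subseteq> carrier H \<times> carrier H"
    by (rule HH.tensor_repr_mem(1)[OF comult_closed[OF assms] m])
qed

lemma tensor_lift_comult:
  assumes "comm_group G" "bal G \<beta>" "h \<in> carrier H"
  shows "tensor_lift G \<beta> (comult H h) = sw G \<beta> h"
  unfolding sweedler_def
  by (rule HH.tensor_lift_repr[OF assms(1,2) comult_closed[OF assms(3)] sweedler_repr(1)[OF assms(3)]])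

lemma sw_closed:
  assumes "comm_group G" "h \<in> carrier H"
    "\<And>a b. a \<in> carrier H \<Longrightarrow> b \<in> carrier H \<Longrightarrow> \<beta> a b \<in> carrier G"
  shows "sw G \<beta> h \<in> carrier G"
  unfolding sweedler_def
  by (rule formal_sum_eval_closed[OF assms(1) assms(3) sweedler_repr(2)[OF assms(2)]])

lemma sw_cong:
  assumes "comm_group G" "h \<in> carrier H"
    "\<And>a b. a \<in> carrier H \<Longrightarrow> b \<in> carrier H \<Longrightarrow> \<beta> a b = \<beta>' a b"
    "\<And>a b. a \<in> carrier H \<Longrightarrow> b \<in> carrier H \<Longrightarrow> \<beta>' a b \<in> carrier G"
  shows "sw G \<beta> h = sw G \<beta>' h"
  unfolding sweedler_def
  by (rule formal_sum_eval_cong[OF assms(1) sweedler_repr(2)[OF assms(2)]]) (simp add: assms(3,4))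

lemma hom_sw:
  assumes "comm_group G" "comm_group G'" "\<phi> \<in> hom G G'" "h \<in> carrier H"
    "\<And>a b. a \<in> carrier H \<Longrightarrow> b \<in> carrier H \<Longrightarrow> \<beta> a b \<in> carrier G"
  shows "\<phi> (sw G \<beta> h) = sw G' (\<lambda>a b. \<phi> (\<beta> a b)) h"
  unfolding sweedler_def
  by (rule formal_sum_eval_comp_hom[OF assms(1,2,3) assms(5) sweedler_repr(2)[OF assms(4)]])

lemma sw_pointwise_mult:
  assumes "comm_group G" "h \<in> carrier H"
    "\<And>a b. a \<in> carrier H \<Longrightarrow> b \<in> carrier H \<Longrightarrow> \<beta> a b \<in> carrier G"
    "\<And>a b. a \<in> carrier H \<Longrightarrow> b \<in> carrier H \<Longrightarrow> \<beta>' a b \<in> carrier G"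
  shows "sw G (\<lambda>a b. \<beta> a b \<otimes>\<^bsub>G\<^esub> \<beta>' a b) h = sw G \<beta> h \<otimes>\<^bsub>G\<^esub> sw G \<beta>' h"
  unfolding sweedler_def
  by (rule formal_sum_eval_mult[OF assms(1) sweedler_repr(2)[OF assms(2)] assms(3,4)])

lemma sw_swap:
  assumes "comm_group G" "x \<in> carrier H" "y \<in> carrier H"
    "\<And>a b c d. a \<in> carrier H \<Longrightarrow> b \<in> carrier H \<Longrightarrow> c \<in> carrier H \<Longrightarrow> d \<in> carrier H \<Longrightarrow>
      \<tau> a b c d \<in> carrier G"
  shows "sw G (\<lambda>a b. sw G (\<tau> a b) y) x = sw G (\<lambda>c d. sw G (\<lambda>a b. \<tau> a b c d) x) y"
  unfolding sweedler_def
  by (rule formal_sum_eval_swap[OF assms(1) sweedler_repr(2)[OF assms(2)] sweedler_repr(2)[OF assms(3)] assms(4)])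

lemma balanced_map_sw:
  assumes G: "comm_group G" and h: "h \<in> carrier H"
    and bal: "\<And>c d. c \<in> carrier H \<Longrightarrow> d \<in> carrier H \<Longrightarrow> balanced_map A ra la M N G (\<lambda>a b. \<sigma> a b c d)"
    and la: "\<And>a y. a \<in> A \<Longrightarrow> y \<in> carrier N \<Longrightarrow> la a y \<in> carrier N"
  shows "balanced_map A ra la M N G (\<lambda>a b. sw G (\<sigma> a b) h)"
proof (rule balanced_mapI)
  fix x y assume "x \<in> carrier M" "y \<in> carrier N"
  then show "sw G (\<sigma> x y) h \<in> carrier G"
    by (intro sw_closed[OF G h] balanced_mapD(1)[OF bal])
next
  interpret G: comm_group G by fact
  fix x x' y assume x: "x \<in> carrier M" "x' \<in> carrier M" "y \<in> carrier N"
  have "sw G (\<sigma> (x \<oplus>\<^bsub>M\<^esub> x') y) h = sw G (\<lambda>c d. \<sigma> x y c d \<otimes>\<^bsub>G\<^esub> \<sigma> x' y c d) h"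
    by (rule sw_cong[OF G h]) (use x balanced_mapD(1,2)[OF bal] in \<open>simp_all\<close>)
  also have "\<dots> = sw G (\<sigma> x y) h \<otimes>\<^bsub>G\<^esub> sw G (\<sigma> x' y) h"
    by (rule sw_pointwise_mult[OF G h]) (use x balanced_mapD(1)[OF bal] in simp_all)
  finally show "sw G (\<sigma> (x \<oplus>\<^bsub>M\<^esub> x') y) h = sw G (\<sigma> x y) h \<otimes>\<^bsub>G\<^esub> sw G (\<sigma> x' y) h" .
next
  interpret G: comm_group G by fact
  fix x y y' assume x: "x \<in> carrier M" "y \<in> carrier N" "y' \<in> carrier N"
  have "sw G (\<sigma> x (y \<oplus>\<^bsub>N\<^esub> y')) h = sw G (\<lambda>c d. \<sigma> x y c d \<otimes>\<^bsub>G\<^esub> \<sigma> x y' c d) h"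
    by (rule sw_cong[OF G h]) (use x balanced_mapD(1,3)[OF bal] in \<open>simp_all\<close>)
  also have "\<dots> = sw G (\<sigma> x y) h \<otimes>\<^bsub>G\<^esub> sw G (\<sigma> x y') h"
    by (rule sw_pointwise_mult[OF G h]) (use x balanced_mapD(1)[OF bal] in simp_all)
  finally show "sw G (\<sigma> x (y \<oplus>\<^bsub>N\<^esub> y')) h = sw G (\<sigma> x y) h \<otimes>\<^bsub>G\<^esub> sw G (\<sigma> x y') h" .
next
  fix x a y assume x: "x \<in> carrier M" "a \<in> A" "y \<in> carrier N"
  show "sw G (\<sigma> (ra x a) y) h = sw G (\<sigma> x (la a y)) h"
    by (rule sw_cong[OF G h balanced_mapD(4)[OF bal] balanced_mapD(1)[OF bal]])
       (use x la in simp_all)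
qed

lemma sw_const_one:
  assumes "comm_group G" shows "sw G (\<lambda>a b. \<one>\<^bsub>G\<^esub>) h = \<one>\<^bsub>G\<^esub>"
proof -
  interpret comm_group G by fact
  show ?thesis by (simp add: sweedler_def formal_sum_eval_def)
qed

lemma sw_hom:
  assumes "comm_group G" "bal G \<beta>"
  shows "sw G \<beta> \<in> hom (add_monoid H) G"
proof -
  have "tensor_lift G \<beta> (comult H (x \<oplus>\<^bsub>H\<^esub> y)) =
    tensor_lift G \<beta> (comult H x) \<otimes>\<^bsub>G\<^esub> tensor_lift G \<beta> (comult H y)"
    if "x \<in> carrier H" "y \<in> carrier H" for x y
    using that hom_mult[OF HH.tensor_lift_hom[OF assms]] linear_mapD(2)[OF comult_linear]
    by (simp add: HH.tensor_module_simps)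
  then show ?thesis
    using sw_closed[OF assms(1) _ balanced_mapD(1)[OF assms(2)]]
    by (intro homI) (simp_all add: tensor_lift_comult[OF assms])
qed

lemma sw_smult:
  assumes "comm_group G" "bal G \<beta>" "c \<in> carrier k" "h \<in> carrier H"
  shows "sw G \<beta> (c \<odot>\<^bsub>H\<^esub> h) = sw G (\<lambda>a b. \<beta> (c \<odot>\<^bsub>H\<^esub> a) b) h"
proof -
  have "sw G \<beta> (c \<odot>\<^bsub>H\<^esub> h) = tensor_lift G \<beta> (tensor_lift T2 (\<lambda>x y. pure_tensor T2 (c \<odot>\<^bsub>H\<^esub> x) y) (comult H h))"
    using assms tensor_lift_comult[OF assms(1,2), of "c \<odot>\<^bsub>H\<^esub> h"] linear_mapD(3)[OF comult_linear, of c h]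
    by (simp add: tensor_module_def Let_def)
  also have "\<dots> = tensor_lift G \<beta> (sw T2 (\<lambda>x y. pure_tensor T2 (c \<odot>\<^bsub>H\<^esub> x) y) h)"
    by (subst tensor_lift_comult[OF HH.tensor_comm_group HH.smult_balanced]) (use assms in simp_all)
  also have "\<dots> = sw G (\<lambda>x y. tensor_lift G \<beta> (pure_tensor T2 (c \<odot>\<^bsub>H\<^esub> x) y)) h"
    by (rule hom_sw[OF HH.tensor_comm_group assms(1) HH.tensor_lift_hom[OF assms(1,2)]])
      (use assms in simp_all)
  also have "\<dots> = sw G (\<lambda>a b. \<beta> (c \<odot>\<^bsub>H\<^esub> a) b) h"
    by (rule sw_cong) (use assms HH.tensor_lift_pure[OF assms(1,2)] balanced_mapD(1)[OF assms(2)] in simp_all)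
  finally show ?thesis .
qed

lemma sw_one:
  assumes "comm_group G" "bal G \<beta>"
  shows "sw G \<beta> \<one>\<^bsub>H\<^esub> = \<beta> \<one>\<^bsub>H\<^esub> \<one>\<^bsub>H\<^esub>"
proof -
  have "comult H \<one>\<^bsub>H\<^esub> = pure_tensor T2 \<one>\<^bsub>H\<^esub> \<one>\<^bsub>H\<^esub>"
    using ring_hom_one[OF comult_ring_hom] by (simp add: tensor_module_def Let_def)
  then show ?thesis
    using tensor_lift_comult[OF assms, of "\<one>\<^bsub>H\<^esub>"] HH.tensor_lift_pure[OF assms, of "\<one>\<^bsub>H\<^esub>" "\<one>\<^bsub>H\<^esub>"] by simp
qed

text \<open>
  Multiplicativity of \<open>\<Delta>\<close>: \<open>(xy)\<^sub>1 \<otimes> (xy)\<^sub>2 = x\<^sub>1 y\<^sub>1 \<otimes> x\<^sub>2 y\<^sub>2\<close>.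
\<close>

lemma sw_of_product:
  assumes G: "comm_group G" and \<beta>: "bal G \<beta>" and x: "x \<in> carrier H" and y: "y \<in> carrier H"
  shows "sw G \<beta> (x \<otimes>\<^bsub>H\<^esub> y) = sw G (\<lambda>a b. sw G (\<lambda>c d. \<beta> (a \<otimes>\<^bsub>H\<^esub> c) (b \<otimes>\<^bsub>H\<^esub> d)) y) x"
proof -
  let ?p = "pure_tensor T2"
  note P = balanced_mapD[OF HH.pure_tensor_balanced]
  interpret T2: comm_group T2 by (rule HH.tensor_comm_group)
  have b1: "bal T2 (\<lambda>c d. ?p (a \<otimes>\<^bsub>H\<^esub> c) (b \<otimes>\<^bsub>H\<^esub> d))" if "a \<in> carrier H" "b \<in> carrier H" for a b
    by (rule balanced_mapI) (use that P in \<open>simp_all add: H.r_distr H.smult_mult_right\<close>)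
  have hom: "tensor_lift T2 (\<lambda>c d. ?p (a \<otimes>\<^bsub>H\<^esub> c) (b \<otimes>\<^bsub>H\<^esub> d)) \<in> hom T2 T2"
    if "a \<in> carrier H" "b \<in> carrier H" for a b
    by (rule HH.tensor_lift_hom[OF HH.tensor_comm_group b1[OF that]])
  have eq: "tensor_lift T2 (\<lambda>c d. ?p (a \<otimes>\<^bsub>H\<^esub> c) (b \<otimes>\<^bsub>H\<^esub> d)) (comult H y) =
     sw T2 (\<lambda>c d. ?p (a \<otimes>\<^bsub>H\<^esub> c) (b \<otimes>\<^bsub>H\<^esub> d)) y"
    if "a \<in> carrier H" "b \<in> carrier H" for a b
    by (rule tensor_lift_comult[OF HH.tensor_comm_group b1[OF that] y])
  have b2: "bal T2 (\<lambda>a b. sw T2 (\<lambda>c d. ?p (a \<otimes>\<^bsub>H\<^esub> c) (b \<otimes>\<^bsub>H\<^esub> d)) y)"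
    by (rule balanced_map_sw[OF HH.tensor_comm_group y]; (rule balanced_mapI)?)
      (use P in \<open>simp_all add: H.l_distr H.smult_mult_left\<close>)
  have "comult H (x \<otimes>\<^bsub>H\<^esub> y) = tensor_lift T2 (\<lambda>a b. tensor_lift T2 (\<lambda>c d.
      ?p (a \<otimes>\<^bsub>H\<^esub> c) (b \<otimes>\<^bsub>H\<^esub> d)) (comult H y)) (comult H x)"
    using ring_hom_mult[OF comult_ring_hom x y] by (simp add: tensor_module_def Let_def)
  also have "\<dots> = tensor_lift T2 (\<lambda>a b. sw T2 (\<lambda>c d. ?p (a \<otimes>\<^bsub>H\<^esub> c) (b \<otimes>\<^bsub>H\<^esub> d)) y) (comult H x)"
    by (rule HH.tensor_lift_cong[OF HH.tensor_comm_group b2 comult_closed[OF x] eq])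
  also have "\<dots> = sw T2 (\<lambda>a b. sw T2 (\<lambda>c d. ?p (a \<otimes>\<^bsub>H\<^esub> c) (b \<otimes>\<^bsub>H\<^esub> d)) y) x"
    by (rule tensor_lift_comult[OF HH.tensor_comm_group b2 x])
  finally have "sw G \<beta> (x \<otimes>\<^bsub>H\<^esub> y) = tensor_lift G \<beta> (sw T2 (\<lambda>a b. sw T2 (\<lambda>c d. ?p (a \<otimes>\<^bsub>H\<^esub> c) (b \<otimes>\<^bsub>H\<^esub> d)) y) x)"
    using tensor_lift_comult[OF G \<beta>, of "x \<otimes>\<^bsub>H\<^esub> y"] x y by simp
  also have "\<dots> = sw G (\<lambda>a b. tensor_lift G \<beta> (sw T2 (\<lambda>c d. ?p (a \<otimes>\<^bsub>H\<^esub> c) (b \<otimes>\<^bsub>H\<^esub> d)) y)) x"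
    by (rule hom_sw[OF HH.tensor_comm_group G HH.tensor_lift_hom[OF G \<beta>] x balanced_mapD(1)[OF b2]])
  also have "\<dots> = sw G (\<lambda>a b. sw G (\<lambda>c d. \<beta> (a \<otimes>\<^bsub>H\<^esub> c) (b \<otimes>\<^bsub>H\<^esub> d)) y) x"
  proof (rule sw_cong[OF G x])
    fix a b assume a: "a \<in> carrier H" "b \<in> carrier H"
    show "sw G (\<lambda>c d. \<beta> (a \<otimes>\<^bsub>H\<^esub> c) (b \<otimes>\<^bsub>H\<^esub> d)) y \<in> carrier G"
      by (rule sw_closed[OF G y]) (use a balanced_mapD(1)[OF \<beta>] in simp)
    have "tensor_lift G \<beta> (sw T2 (\<lambda>c d. ?p (a \<otimes>\<^bsub>H\<^esub> c) (b \<otimes>\<^bsub>H\<^esub> d)) y) =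
      sw G (\<lambda>c d. tensor_lift G \<beta> (?p (a \<otimes>\<^bsub>H\<^esub> c) (b \<otimes>\<^bsub>H\<^esub> d))) y"
      by (rule hom_sw[OF HH.tensor_comm_group G HH.tensor_lift_hom[OF G \<beta>] y]) (use a in simp)
    also have "\<dots> = sw G (\<lambda>c d. \<beta> (a \<otimes>\<^bsub>H\<^esub> c) (b \<otimes>\<^bsub>H\<^esub> d)) y"
      by (rule sw_cong[OF G y]) (use a HH.tensor_lift_pure[OF G \<beta>] balanced_mapD(1)[OF \<beta>] in simp_all)
    finally show "tensor_lift G \<beta> (sw T2 (\<lambda>c d. ?p (a \<otimes>\<^bsub>H\<^esub> c) (b \<otimes>\<^bsub>H\<^esub> d)) y) =
      sw G (\<lambda>c d. \<beta> (a \<otimes>\<^bsub>H\<^esub> c) (b \<otimes>\<^bsub>H\<^esub> d)) y" .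
  qed
  finally show ?thesis .
qed

text \<open>
  The maps out of \<open>H \<otimes> H \<otimes> H\<close>, described through both ways of bracketing it.
\<close>

definition trilinear :: "('c, 'l) monoid_scheme \<Rightarrow> ('h \<Rightarrow> 'h \<Rightarrow> 'h \<Rightarrow> 'c) \<Rightarrow> bool" where
  "trilinear G \<tau> \<longleftrightarrow> (\<forall>z\<in>carrier H. bal G (\<lambda>x y. \<tau> x y z)) \<and> (\<forall>x\<in>carrier H. bal G (\<tau> x))"

lemma trilinearD:
  assumes "trilinear G \<tau>"
  shows "z \<in> carrier H \<Longrightarrow> bal G (\<lambda>x y. \<tau> x y z)" "x \<in> carrier H \<Longrightarrow> bal G (\<tau> x)"
    "x \<in> carrier H \<Longrightarrow> y \<in> carrier H \<Longrightarrow> z \<in> carrier H \<Longrightarrow> \<tau> x y z \<in> carrier G"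
  using assms balanced_mapD(1)[of "carrier k" _ _ H H G "\<tau> x"] by (auto simp: trilinear_def)

lemma trilinearI:
  assumes "\<And>x y z. x \<in> carrier H \<Longrightarrow> y \<in> carrier H \<Longrightarrow> z \<in> carrier H \<Longrightarrow> \<tau> x y z \<in> carrier G"
    and "\<And>x x' y z. x \<in> carrier H \<Longrightarrow> x' \<in> carrier H \<Longrightarrow> y \<in> carrier H \<Longrightarrow> z \<in> carrier H \<Longrightarrow>
      \<tau> (x \<oplus>\<^bsub>H\<^esub> x') y z = \<tau> x y z \<otimes>\<^bsub>G\<^esub> \<tau> x' y z"
    and "\<And>x y y' z. x \<in> carrier H \<Longrightarrow> y \<in> carrier H \<Longrightarrow> y' \<in> carrier H \<Longrightarrow> z \<in> carrier H \<Longrightarrow>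
      \<tau> x (y \<oplus>\<^bsub>H\<^esub> y') z = \<tau> x y z \<otimes>\<^bsub>G\<^esub> \<tau> x y' z"
    and "\<And>x y z z'. x \<in> carrier H \<Longrightarrow> y \<in> carrier H \<Longrightarrow> z \<in> carrier H \<Longrightarrow> z' \<in> carrier H \<Longrightarrow>
      \<tau> x y (z \<oplus>\<^bsub>H\<^esub> z') = \<tau> x y z \<otimes>\<^bsub>G\<^esub> \<tau> x y z'"
    and "\<And>c x y z. c \<in> carrier k \<Longrightarrow> x \<in> carrier H \<Longrightarrow> y \<in> carrier H \<Longrightarrow> z \<in> carrier H \<Longrightarrow>
      \<tau> (c \<odot>\<^bsub>H\<^esub> x) y z = \<tau> x (c \<odot>\<^bsub>H\<^esub> y) z"
    and "\<And>c x y z. c \<in> carrier k \<Longrightarrow> x \<in> carrier H \<Longrightarrow> y \<in> carrier H \<Longrightarrow> z \<in> carrier H \<Longrightarrow>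
      \<tau> x (c \<odot>\<^bsub>H\<^esub> y) z = \<tau> x y (c \<odot>\<^bsub>H\<^esub> z)"
  shows "trilinear G \<tau>"
  using assms by (auto simp: trilinear_def intro!: balanced_mapI)

text \<open>
  With its companion below, this makes a trilinear map a map on \<open>(H \<otimes> H) \<otimes> H\<close> and on
  \<open>H \<otimes> (H \<otimes> H)\<close>, which is what coassociativity compares.
\<close>

lemma trilinear_lift_left:
  assumes G: "comm_group G" and \<tau>: "trilinear G \<tau>"
  shows "k_balanced k (tensor_module k H H) H G (\<lambda>X z. tensor_lift G (\<lambda>x y. \<tau> x y z) X)"
proof -
  interpret G: comm_group G by fact
  note b = trilinearD(1)[OF \<tau>]
  note lh = HH.tensor_lift_hom[OF G b] and lp = HH.tensor_lift_pure[OF G b]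
  show ?thesis
  proof (rule balanced_mapI, unfold HH.tensor_module_simps)
    fix X z assume "X \<in> carrier T2" "z \<in> carrier H"
    then show "tensor_lift G (\<lambda>x y. \<tau> x y z) X \<in> carrier G" using hom_in_carrier[OF lh] by simp
  next
    fix X X' z assume "X \<in> carrier T2" "X' \<in> carrier T2" "z \<in> carrier H"
    then show "tensor_lift G (\<lambda>x y. \<tau> x y z) (X \<otimes>\<^bsub>T2\<^esub> X') =
      tensor_lift G (\<lambda>x y. \<tau> x y z) X \<otimes>\<^bsub>G\<^esub> tensor_lift G (\<lambda>x y. \<tau> x y z) X'"
      by (intro hom_mult[OF lh])
  next
    fix X z z' assume X: "X \<in> carrier T2" and z: "z \<in> carrier H" "z' \<in> carrier H"
    show "tensor_lift G (\<lambda>x y. \<tau> x y (z \<oplus>\<^bsub>H\<^esub> z')) X =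
      tensor_lift G (\<lambda>x y. \<tau> x y z) X \<otimes>\<^bsub>G\<^esub> tensor_lift G (\<lambda>x y. \<tau> x y z') X"
    proof (rule HH.tensor_hom_eqI[OF G.is_group lh _ _ X])
      show "(\<lambda>X. tensor_lift G (\<lambda>x y. \<tau> x y z) X \<otimes>\<^bsub>G\<^esub> tensor_lift G (\<lambda>x y. \<tau> x y z') X) \<in> hom T2 G"
        using lh[OF z(1)] lh[OF z(2)] by (auto simp: hom_def Pi_def G.m_ac)
    qed (use z lp balanced_mapD(3)[OF trilinearD(2)[OF \<tau>]] in simp_all)
  next
    fix X c z assume X: "X \<in> carrier T2" and c: "c \<in> carrier k" and z: "z \<in> carrier H"
    have "(tensor_lift G (\<lambda>x y. \<tau> x y z) \<circ> smult (tensor_module k H H) c) X =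
      tensor_lift G (\<lambda>x y. \<tau> x y (c \<odot>\<^bsub>H\<^esub> z)) X"
      by (rule HH.tensor_hom_eqI[OF G.is_group hom_compose[OF HH.smult_hom[OF c] lh[OF z]] lh _ X])
        (use z c lp HH.smult_pure balanced_mapD(4)[OF trilinearD(1)[OF \<tau>]] balanced_mapD(4)[OF trilinearD(2)[OF \<tau>]] in simp_all)
    then show "tensor_lift G (\<lambda>x y. \<tau> x y z) (c \<odot>\<^bsub>tensor_module k H H\<^esub> X) =
      tensor_lift G (\<lambda>x y. \<tau> x y (c \<odot>\<^bsub>H\<^esub> z)) X" by simp
  qed
qed

lemma trilinear_lift_right:
  assumes G: "comm_group G" and \<tau>: "trilinear G \<tau>"
  shows "k_balanced k H (tensor_module k H H) G (\<lambda>x. tensor_lift G (\<tau> x))"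
proof -
  interpret G: comm_group G by fact
  note b = trilinearD(2)[OF \<tau>]
  note lh = HH.tensor_lift_hom[OF G b] and lp = HH.tensor_lift_pure[OF G b]
  show ?thesis
  proof (rule balanced_mapI, unfold HH.tensor_module_simps)
    fix x X assume "x \<in> carrier H" "X \<in> carrier T2"
    then show "tensor_lift G (\<tau> x) X \<in> carrier G" using hom_in_carrier[OF lh] by simp
  next
    fix x X X' assume "x \<in> carrier H" "X \<in> carrier T2" "X' \<in> carrier T2"
    then show "tensor_lift G (\<tau> x) (X \<otimes>\<^bsub>T2\<^esub> X') =
      tensor_lift G (\<tau> x) X \<otimes>\<^bsub>G\<^esub> tensor_lift G (\<tau> x) X'"
      by (intro hom_mult[OF lh])
  next
    fix z z' X assume X: "X \<in> carrier T2" and z: "z \<in> carrier H" "z' \<in> carrier H"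
    show "tensor_lift G (\<tau> (z \<oplus>\<^bsub>H\<^esub> z')) X = tensor_lift G (\<tau> z) X \<otimes>\<^bsub>G\<^esub> tensor_lift G (\<tau> z') X"
    proof (rule HH.tensor_hom_eqI[OF G.is_group lh _ _ X])
      show "(\<lambda>X. tensor_lift G (\<tau> z) X \<otimes>\<^bsub>G\<^esub> tensor_lift G (\<tau> z') X) \<in> hom T2 G"
        using lh[OF z(1)] lh[OF z(2)] by (auto simp: hom_def Pi_def G.m_ac)
    qed (use z lp balanced_mapD(2)[OF trilinearD(1)[OF \<tau>]] in simp_all)
  next
    fix z c X assume X: "X \<in> carrier T2" and c: "c \<in> carrier k" and z: "z \<in> carrier H"
    have "tensor_lift G (\<tau> (c \<odot>\<^bsub>H\<^esub> z)) X = (tensor_lift G (\<tau> z) \<circ> smult (tensor_module k H H) c) X"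
      by (rule HH.tensor_hom_eqI[OF G.is_group lh hom_compose[OF HH.smult_hom[OF c] lh[OF z]] _ X])
        (use z c lp HH.smult_pure balanced_mapD(4)[OF trilinearD(1)[OF \<tau>]] in simp_all)
    then show "tensor_lift G (\<tau> (c \<odot>\<^bsub>H\<^esub> z)) X = tensor_lift G (\<tau> z) (c \<odot>\<^bsub>tensor_module k H H\<^esub> X)"
      by simp
  qed
qed

text \<open>
  Both sides of the coassociativity axiom live in \<open>(H \<otimes> H) \<otimes> H\<close>; evaluating the map induced by
  \<open>\<tau>\<close> on them gives the two iterated sums.
\<close>

lemma sw_coassoc:
  assumes G: "comm_group G" and \<tau>: "trilinear G \<tau>" and h: "h \<in> carrier H"
  shows "sw G (\<lambda>a b. sw G (\<lambda>c d. \<tau> c d b) a) h = sw G (\<lambda>a b. sw G (\<tau> a) b) h"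
proof -
  let ?p = "pure_tensor T2" and ?p3 = "pure_tensor T3" and ?p3' = "pure_tensor T3'"
  let ?\<Lambda> = "tensor_lift G (\<lambda>X z. tensor_lift G (\<lambda>x y. \<tau> x y z) X)"
  note cg3 = HH_H.tensor_comm_group and cg3' = H_HH.tensor_comm_group
  note P = balanced_mapD[OF HH.pure_tensor_balanced]
    and P3 = balanced_mapD[OF HH_H.pure_tensor_balanced, unfolded HH.tensor_module_simps]
    and P3' = balanced_mapD[OF H_HH.pure_tensor_balanced, unfolded HH.tensor_module_simps]
    and D = linear_mapD[OF comult_linear, unfolded HH.tensor_module_simps]
  note b\<Lambda> = trilinear_lift_left[OF G \<tau>]
  have \<Lambda>: "?\<Lambda> \<in> hom T3 G" by (rule HH_H.tensor_lift_hom[OF G b\<Lambda>])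
  have \<Lambda>p: "?\<Lambda> (?p3 X z) = tensor_lift G (\<lambda>x y. \<tau> x y z) X" if "X \<in> carrier T2" "z \<in> carrier H" for X z
    by (rule HH_H.tensor_lift_pure[OF G b\<Lambda>]) (use that in \<open>simp_all add: HH.tensor_module_simps\<close>)
  have tri3: "trilinear T3 (\<lambda>x y z. ?p3 (?p x y) z)"
  proof -
    have "?p x (c \<odot>\<^bsub>H\<^esub> y) = c \<odot>\<^bsub>tensor_module k H H\<^esub> ?p x y"
      if "c \<in> carrier k" "x \<in> carrier H" "y \<in> carrier H" for c x y
      using that by (simp add: P(4)[symmetric] HH.smult_pure)
    then show ?thesis
      by (intro trilinearI) (simp_all add: P(2,3) P3 HH.smult_pure[symmetric])
  qed
  have bL: "bal T3 (\<lambda>x y. ?p3 (comult H x) y)"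
    by (rule balanced_mapI) (simp_all add: D P3)
  have bR: "bal T3' (\<lambda>x y. ?p3' x (comult H y))"
    by (rule balanced_mapI) (simp_all add: D P3')
  let ?A = "tensor_assoc k H H H"
  have A: "?A = tensor_lift T3 (\<lambda>x. tensor_lift T3 (\<lambda>y z. ?p3 (?p x y) z))"
    by (simp add: tensor_assoc_def Let_def)
  note bA = trilinear_lift_right[OF cg3 tri3]
  have Ah: "?A \<in> hom T3' T3" unfolding A by (rule H_HH.tensor_lift_hom[OF cg3 bA])
  have Ap: "?A (?p3' x X) = tensor_lift T3 (\<lambda>y z. ?p3 (?p x y) z) X" if "x \<in> carrier H" "X \<in> carrier T2" for x X
    unfolding A by (rule H_HH.tensor_lift_pure[OF cg3 bA]) (use that in \<open>simp_all add: HH.tensor_module_simps\<close>)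
  have cl3: "?p3 (comult H x) y \<in> carrier T3" "?p3' x (comult H y) \<in> carrier T3'"
    if "x \<in> carrier H" "y \<in> carrier H" for x y using that by (simp_all add: P3 P3')
  have \<tau>c: "\<tau> x y z \<in> carrier G" if "x \<in> carrier H" "y \<in> carrier H" "z \<in> carrier H" for x y z
    using trilinearD(3)[OF \<tau>] that .
  have "tensor_lift T3 (\<lambda>x y. ?p3 (comult H x) y) (comult H h) =
    ?A (tensor_lift T3' (\<lambda>x y. ?p3' x (comult H y)) (comult H h))"
    using comult_coassoc[OF h] by (simp add: Let_def)
  then have "?\<Lambda> (sw T3 (\<lambda>x y. ?p3 (comult H x) y) h) = ?\<Lambda> (?A (sw T3' (\<lambda>x y. ?p3' x (comult H y)) h))"
    by (simp add: tensor_lift_comult[OF cg3 bL h] tensor_lift_comult[OF cg3' bR h])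
  moreover have "?\<Lambda> (sw T3 (\<lambda>x y. ?p3 (comult H x) y) h) = sw G (\<lambda>a b. sw G (\<lambda>c d. \<tau> c d b) a) h"
    (is "_ = ?L")
  proof -
    have "?\<Lambda> (sw T3 (\<lambda>x y. ?p3 (comult H x) y) h) = sw G (\<lambda>x y. ?\<Lambda> (?p3 (comult H x) y)) h"
      by (rule hom_sw[OF cg3 G \<Lambda> h cl3(1)])
    also have "\<dots> = ?L"
    proof (rule sw_cong[OF G h])
      fix a b assume a: "a \<in> carrier H" "b \<in> carrier H"
      show "?\<Lambda> (?p3 (comult H a) b) = sw G (\<lambda>c d. \<tau> c d b) a"
        using a \<Lambda>p tensor_lift_comult[OF G trilinearD(1)[OF \<tau>]] by simp
      show "sw G (\<lambda>c d. \<tau> c d b) a \<in> carrier G"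
        by (rule sw_closed[OF G]) (use a \<tau>c in simp_all)
    qed
    finally show ?thesis .
  qed
  moreover have "?\<Lambda> (?A (sw T3' (\<lambda>x y. ?p3' x (comult H y)) h)) = sw G (\<lambda>a b. sw G (\<tau> a) b) h"
    (is "_ = ?R")
  proof -
    have "?\<Lambda> (?A (sw T3' (\<lambda>x y. ?p3' x (comult H y)) h)) = (?\<Lambda> \<circ> ?A) (sw T3' (\<lambda>x y. ?p3' x (comult H y)) h)"
      by simp
    also have "\<dots> = sw G (\<lambda>x y. (?\<Lambda> \<circ> ?A) (?p3' x (comult H y))) h"
      by (rule hom_sw[OF cg3' G hom_compose[OF Ah \<Lambda>] h cl3(2)])
    also have "\<dots> = ?R"
    proof (rule sw_cong[OF G h])
      fix a b assume a: "a \<in> carrier H" "b \<in> carrier H"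
      have "(?\<Lambda> \<circ> ?A) (?p3' a (comult H b)) = ?\<Lambda> (sw T3 (\<lambda>y z. ?p3 (?p a y) z) b)"
        using a Ap tensor_lift_comult[OF cg3 trilinearD(2)[OF tri3]] by simp
      also have "\<dots> = sw G (\<lambda>y z. ?\<Lambda> (?p3 (?p a y) z)) b"
        by (rule hom_sw[OF cg3 G \<Lambda> a(2)]) (use a P P3 in simp)
      also have "\<dots> = sw G (\<tau> a) b"
        by (rule sw_cong[OF G a(2)])
          (use a \<tau>c \<Lambda>p HH.tensor_lift_pure[OF G trilinearD(1)[OF \<tau>]] in simp_all)
      finally show "(?\<Lambda> \<circ> ?A) (?p3' a (comult H b)) = sw G (\<tau> a) b" .
      show "sw G (\<tau> a) b \<in> carrier G"
        by (rule sw_closed[OF G]) (use a \<tau>c in simp_all)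
    qed
    finally show ?thesis .
  qed
  ultimately show ?thesis by simp
qed

section \<open>Counit and antipode in Sweedler sums\<close>

abbreviation "AH \<equiv> add_monoid H"
abbreviation "\<epsilon> \<equiv> counit H"
abbreviation "S \<equiv> antipode H"

lemma AH_comm_group: "comm_group AH" by (rule H.a_comm_group)

lemma counit_simps [simp]:
  "x \<in> carrier H \<Longrightarrow> \<epsilon> x \<in> carrier k"
  "x \<in> carrier H \<Longrightarrow> y \<in> carrier H \<Longrightarrow> \<epsilon> (x \<oplus>\<^bsub>H\<^esub> y) = \<epsilon> x \<oplus>\<^bsub>k\<^esub> \<epsilon> y"
  "x \<in> carrier H \<Longrightarrow> y \<in> carrier H \<Longrightarrow> \<epsilon> (x \<otimes>\<^bsub>H\<^esub> y) = \<epsilon> x \<otimes>\<^bsub>k\<^esub> \<epsilon> y"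
  "\<epsilon> \<one>\<^bsub>H\<^esub> = \<one>\<^bsub>k\<^esub>"
  "c \<in> carrier k \<Longrightarrow> x \<in> carrier H \<Longrightarrow> \<epsilon> (c \<odot>\<^bsub>H\<^esub> x) = c \<otimes>\<^bsub>k\<^esub> \<epsilon> x"
  using ring_hom_closed[OF counit_ring_hom] ring_hom_add[OF counit_ring_hom]
    ring_hom_mult[OF counit_ring_hom] ring_hom_one[OF counit_ring_hom] counit_smult
  by simp_all

lemma antipode_simps [simp]:
  "x \<in> carrier H \<Longrightarrow> S x \<in> carrier H"
  "x \<in> carrier H \<Longrightarrow> y \<in> carrier H \<Longrightarrow> S (x \<oplus>\<^bsub>H\<^esub> y) = S x \<oplus>\<^bsub>H\<^esub> S y"
  "c \<in> carrier k \<Longrightarrow> x \<in> carrier H \<Longrightarrow> S (c \<odot>\<^bsub>H\<^esub> x) = c \<odot>\<^bsub>H\<^esub> S x"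
  using linear_mapD[OF antipode_linear] by simp_all

lemma hom_param_sw:
  assumes G: "comm_group G" and x: "x \<in> carrier H"
    and hom: "\<And>a b. a \<in> carrier H \<Longrightarrow> b \<in> carrier H \<Longrightarrow> \<sigma> a b \<in> hom K G"
    and K: "\<And>u v. u \<in> carrier K \<Longrightarrow> v \<in> carrier K \<Longrightarrow> u \<otimes>\<^bsub>K\<^esub> v \<in> carrier K"
  shows "(\<lambda>u. sw G (\<lambda>a b. \<sigma> a b u) x) \<in> hom K G"
proof (rule homI)
  interpret G: comm_group G by fact
  fix u assume "u \<in> carrier K"
  then show "sw G (\<lambda>a b. \<sigma> a b u) x \<in> carrier G"
    by (intro sw_closed[OF G x] hom_in_carrier[OF hom])
next
  interpret G: comm_group G by fact
  fix u v assume u: "u \<in> carrier K" "v \<in> carrier K"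
  have "sw G (\<lambda>a b. \<sigma> a b (u \<otimes>\<^bsub>K\<^esub> v)) x = sw G (\<lambda>a b. \<sigma> a b u \<otimes>\<^bsub>G\<^esub> \<sigma> a b v) x"
    by (rule sw_cong[OF G x]) (use u hom_mult[OF hom] hom_in_carrier[OF hom] in simp_all)
  also have "\<dots> = sw G (\<lambda>a b. \<sigma> a b u) x \<otimes>\<^bsub>G\<^esub> sw G (\<lambda>a b. \<sigma> a b v) x"
    by (rule sw_pointwise_mult[OF G x]) (use u hom_in_carrier[OF hom] in simp_all)
  finally show "sw G (\<lambda>a b. \<sigma> a b (u \<otimes>\<^bsub>K\<^esub> v)) x =
    sw G (\<lambda>a b. \<sigma> a b u) x \<otimes>\<^bsub>G\<^esub> sw G (\<lambda>a b. \<sigma> a b v) x" .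
qed

lemma bal_counit_left: "bal AH (\<lambda>x y. \<epsilon> x \<odot>\<^bsub>H\<^esub> y)"
  by (rule balanced_mapI)
    (simp_all add: H.smult_l_distr H.smult_r_distr H.smult_assoc1[symmetric] k.m_comm)

lemma bal_counit_right: "bal AH (\<lambda>x y. \<epsilon> y \<odot>\<^bsub>H\<^esub> x)"
  by (rule balanced_mapI)
    (simp_all add: H.smult_l_distr H.smult_r_distr H.smult_assoc1[symmetric] k.m_comm)

lemma bal_antipode_left: "bal AH (\<lambda>x y. S x \<otimes>\<^bsub>H\<^esub> y)"
  by (rule balanced_mapI) (simp_all add: H.l_distr H.r_distr H.smult_mult_left H.smult_mult_right)

lemma bal_antipode_right: "bal AH (\<lambda>x y. x \<otimes>\<^bsub>H\<^esub> S y)"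
  by (rule balanced_mapI) (simp_all add: H.l_distr H.r_distr H.smult_mult_left H.smult_mult_right)

lemma
  assumes G: "comm_group G" and \<phi>: "\<phi> \<in> hom AH G" and h: "h \<in> carrier H"
  shows sw_counit_left: "sw G (\<lambda>a b. \<phi> (\<epsilon> a \<odot>\<^bsub>H\<^esub> b)) h = \<phi> h"
    and sw_counit_right: "sw G (\<lambda>a b. \<phi> (\<epsilon> b \<odot>\<^bsub>H\<^esub> a)) h = \<phi> h"
    and sw_antipode_left: "sw G (\<lambda>a b. \<phi> (S a \<otimes>\<^bsub>H\<^esub> b)) h = \<phi> (\<epsilon> h \<odot>\<^bsub>H\<^esub> \<one>\<^bsub>H\<^esub>)"
    and sw_antipode_right: "sw G (\<lambda>a b. \<phi> (a \<otimes>\<^bsub>H\<^esub> S b)) h = \<phi> (\<epsilon> h \<odot>\<^bsub>H\<^esub> \<one>\<^bsub>H\<^esub>)"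
proof -
  have *: "sw G (\<lambda>a b. \<phi> (\<beta> a b)) h = \<phi> (tensor_lift AH \<beta> (comult H h))" if "bal AH \<beta>" for \<beta>
    using hom_sw[OF AH_comm_group G \<phi> h, of \<beta>] tensor_lift_comult[OF AH_comm_group that h]
      balanced_mapD(1)[OF that] by simp
  show "sw G (\<lambda>a b. \<phi> (\<epsilon> a \<odot>\<^bsub>H\<^esub> b)) h = \<phi> h"
    using *[OF bal_counit_left] counit_left[OF h] by simp
  show "sw G (\<lambda>a b. \<phi> (\<epsilon> b \<odot>\<^bsub>H\<^esub> a)) h = \<phi> h"
    using *[OF bal_counit_right] counit_right[OF h] by simp
  show "sw G (\<lambda>a b. \<phi> (S a \<otimes>\<^bsub>H\<^esub> b)) h = \<phi> (\<epsilon> h \<odot>\<^bsub>H\<^esub> \<one>\<^bsub>H\<^esub>)"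
    using *[OF bal_antipode_left] antipode_left[OF h] by simp
  show "sw G (\<lambda>a b. \<phi> (a \<otimes>\<^bsub>H\<^esub> S b)) h = \<phi> (\<epsilon> h \<odot>\<^bsub>H\<^esub> \<one>\<^bsub>H\<^esub>)"
    using *[OF bal_antipode_right] antipode_right[OF h] by simp
qed

text \<open>
  Apply \<open>\<epsilon>\<close> to \<open>S(h\<^sub>1) h\<^sub>2 = \<epsilon>(h) 1\<close>.
\<close>

lemma counit_antipode:
  assumes h: "h \<in> carrier H" shows "\<epsilon> (S h) = \<epsilon> h"
proof -
  let ?Ak = "add_monoid k"
  have K: "comm_group ?Ak" by (rule k.a_comm_group)
  have e: "\<epsilon> \<in> hom AH ?Ak" and eS: "(\<lambda>x. \<epsilon> (S x)) \<in> hom AH ?Ak" by (auto intro!: homI)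
  have "\<epsilon> (S h) = sw ?Ak (\<lambda>a b. \<epsilon> (S (\<epsilon> b \<odot>\<^bsub>H\<^esub> a))) h"
    using sw_counit_right[OF K eS h] by simp
  also have "\<dots> = sw ?Ak (\<lambda>a b. \<epsilon> (S a \<otimes>\<^bsub>H\<^esub> b)) h"
    by (rule sw_cong[OF K h]) (simp_all add: k.m_comm)
  also have "\<dots> = \<epsilon> h" using sw_antipode_left[OF K e h] h by simp
  finally show ?thesis .
qed

text \<open>
  Half of antimultiplicativity.  In \<open>S(x\<^sub>1 y\<^sub>1) x\<^sub>2 y\<^sub>2 S(y\<^sub>3)\<close>, contracting \<open>y\<^sub>2 S(y\<^sub>3)\<close> first gives the
  left-hand side, and contracting \<open>S(x\<^sub>1 y\<^sub>1) x\<^sub>2 y\<^sub>2 = \<epsilon>(x y\<^sub>1)\<close> first gives the right-hand side.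
\<close>

lemma sw_antipode_mult_cancel:
  assumes x: "x \<in> carrier H" and y: "y \<in> carrier H"
  shows "sw AH (\<lambda>a b. S (a \<otimes>\<^bsub>H\<^esub> y) \<otimes>\<^bsub>H\<^esub> b) x = \<epsilon> x \<odot>\<^bsub>H\<^esub> S y"
proof -
  note G = AH_comm_group
  note dist = H.l_distr H.r_distr H.smult_mult_left H.smult_mult_right
  define \<tau> where "\<tau> c d e = sw AH (\<lambda>a b. S (a \<otimes>\<^bsub>H\<^esub> c) \<otimes>\<^bsub>H\<^esub> b \<otimes>\<^bsub>H\<^esub> (d \<otimes>\<^bsub>H\<^esub> S e)) x" for c d e
  have tri: "trilinear AH \<tau>"
    unfolding trilinear_def \<tau>_def
    by (intro conjI ballI; rule balanced_map_sw[OF G x]; (rule balanced_mapI)?)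
       (simp_all add: dist)
  have "sw AH (\<lambda>a b. sw AH (\<lambda>c d. \<tau> c d b) a) y = sw AH (\<lambda>p e. \<epsilon> x \<odot>\<^bsub>H\<^esub> S (\<epsilon> p \<odot>\<^bsub>H\<^esub> e)) y"
  proof (rule sw_cong[OF G y])
    fix p e assume p: "p \<in> carrier H" "e \<in> carrier H"
    have hom: "(\<lambda>u. u \<otimes>\<^bsub>H\<^esub> S e) \<in> hom AH AH" using p by (auto intro!: homI simp: dist)
    have "sw AH (\<lambda>c d. \<tau> c d e) p =
      sw AH (\<lambda>a b. sw AH (\<lambda>c d. S (a \<otimes>\<^bsub>H\<^esub> c) \<otimes>\<^bsub>H\<^esub> b \<otimes>\<^bsub>H\<^esub> (d \<otimes>\<^bsub>H\<^esub> S e)) p) x"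
      unfolding \<tau>_def by (rule sw_swap[OF G p(1) x]) (use p in simp)
    also have "\<dots> = sw AH (\<lambda>a b. (sw AH (\<lambda>c d. S (a \<otimes>\<^bsub>H\<^esub> c) \<otimes>\<^bsub>H\<^esub> (b \<otimes>\<^bsub>H\<^esub> d)) p) \<otimes>\<^bsub>H\<^esub> S e) x"
    proof (rule sw_cong[OF G x])
      fix a b assume a: "a \<in> carrier H" "b \<in> carrier H"
      have "sw AH (\<lambda>c d. S (a \<otimes>\<^bsub>H\<^esub> c) \<otimes>\<^bsub>H\<^esub> (b \<otimes>\<^bsub>H\<^esub> d)) p \<otimes>\<^bsub>H\<^esub> S e =
        sw AH (\<lambda>c d. S (a \<otimes>\<^bsub>H\<^esub> c) \<otimes>\<^bsub>H\<^esub> (b \<otimes>\<^bsub>H\<^esub> d) \<otimes>\<^bsub>H\<^esub> S e) p"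
        by (rule hom_sw[OF G G hom p(1)]) (use a in simp)
      also have "\<dots> = sw AH (\<lambda>c d. S (a \<otimes>\<^bsub>H\<^esub> c) \<otimes>\<^bsub>H\<^esub> b \<otimes>\<^bsub>H\<^esub> (d \<otimes>\<^bsub>H\<^esub> S e)) p"
        by (rule sw_cong[OF G p(1)]) (use a p in \<open>simp_all add: H.m_assoc\<close>)
      finally show "sw AH (\<lambda>c d. S (a \<otimes>\<^bsub>H\<^esub> c) \<otimes>\<^bsub>H\<^esub> b \<otimes>\<^bsub>H\<^esub> (d \<otimes>\<^bsub>H\<^esub> S e)) p =
        sw AH (\<lambda>c d. S (a \<otimes>\<^bsub>H\<^esub> c) \<otimes>\<^bsub>H\<^esub> (b \<otimes>\<^bsub>H\<^esub> d)) p \<otimes>\<^bsub>H\<^esub> S e" ..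
      show "sw AH (\<lambda>c d. S (a \<otimes>\<^bsub>H\<^esub> c) \<otimes>\<^bsub>H\<^esub> (b \<otimes>\<^bsub>H\<^esub> d)) p \<otimes>\<^bsub>H\<^esub> S e \<in> carrier AH"
        by (rule hom_in_carrier[OF hom sw_closed[OF G p(1)]]) (use a in simp)
    qed
    also have "\<dots> = (sw AH (\<lambda>a b. sw AH (\<lambda>c d. S (a \<otimes>\<^bsub>H\<^esub> c) \<otimes>\<^bsub>H\<^esub> (b \<otimes>\<^bsub>H\<^esub> d)) p) x) \<otimes>\<^bsub>H\<^esub> S e"
      by (rule hom_sw[OF G G hom x, symmetric]) (rule sw_closed[OF G p(1)], simp)
    also have "\<dots> = (\<epsilon> (x \<otimes>\<^bsub>H\<^esub> p) \<odot>\<^bsub>H\<^esub> \<one>\<^bsub>H\<^esub>) \<otimes>\<^bsub>H\<^esub> S e"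
      using sw_of_product[OF G bal_antipode_left x p(1)] tensor_lift_comult[OF G bal_antipode_left, of "x \<otimes>\<^bsub>H\<^esub> p"]
        antipode_left[of "x \<otimes>\<^bsub>H\<^esub> p"] x p by simp
    also have "\<dots> = \<epsilon> x \<odot>\<^bsub>H\<^esub> S (\<epsilon> p \<odot>\<^bsub>H\<^esub> e)"
      using x p by (simp add: dist H.smult_assoc1)
    finally show "sw AH (\<lambda>c d. \<tau> c d e) p = \<epsilon> x \<odot>\<^bsub>H\<^esub> S (\<epsilon> p \<odot>\<^bsub>H\<^esub> e)" .
  qed (use x in simp)
  also have "\<dots> = \<epsilon> x \<odot>\<^bsub>H\<^esub> S y"
    by (rule sw_counit_left[OF G _ y]) (use x in \<open>auto intro!: homI simp: H.smult_r_distr\<close>)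
  finally have L: "sw AH (\<lambda>a b. sw AH (\<lambda>c d. \<tau> c d b) a) y = \<epsilon> x \<odot>\<^bsub>H\<^esub> S y" .
  have hom2: "(\<lambda>c. sw AH (\<lambda>a b. S (a \<otimes>\<^bsub>H\<^esub> c) \<otimes>\<^bsub>H\<^esub> b) x) \<in> hom AH AH"
    by (rule hom_param_sw[OF G x]) (auto intro!: homI simp: dist)
  have "sw AH (\<lambda>a b. sw AH (\<tau> a) b) y = sw AH (\<lambda>c q. sw AH (\<lambda>a b. S (a \<otimes>\<^bsub>H\<^esub> (\<epsilon> q \<odot>\<^bsub>H\<^esub> c)) \<otimes>\<^bsub>H\<^esub> b) x) y"
  proof (rule sw_cong[OF G y])
    fix c q assume c: "c \<in> carrier H" "q \<in> carrier H"
    have hom: "(\<lambda>u. sw AH (\<lambda>a b. S (a \<otimes>\<^bsub>H\<^esub> c) \<otimes>\<^bsub>H\<^esub> b \<otimes>\<^bsub>H\<^esub> u) x) \<in> hom AH AH"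
      by (rule hom_param_sw[OF G x]) (use c in \<open>auto intro!: homI simp: dist\<close>)
    have "sw AH (\<tau> c) q = sw AH (\<lambda>a b. S (a \<otimes>\<^bsub>H\<^esub> c) \<otimes>\<^bsub>H\<^esub> b \<otimes>\<^bsub>H\<^esub> (\<epsilon> q \<odot>\<^bsub>H\<^esub> \<one>\<^bsub>H\<^esub>)) x"
      unfolding \<tau>_def by (rule sw_antipode_right[OF G hom c(2)])
    also have "\<dots> = sw AH (\<lambda>a b. S (a \<otimes>\<^bsub>H\<^esub> (\<epsilon> q \<odot>\<^bsub>H\<^esub> c)) \<otimes>\<^bsub>H\<^esub> b) x"
      by (rule sw_cong[OF G x]) (use c in \<open>simp_all add: dist\<close>)
    finally show "sw AH (\<tau> c) q = sw AH (\<lambda>a b. S (a \<otimes>\<^bsub>H\<^esub> (\<epsilon> q \<odot>\<^bsub>H\<^esub> c)) \<otimes>\<^bsub>H\<^esub> b) x" .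
    show "sw AH (\<lambda>a b. S (a \<otimes>\<^bsub>H\<^esub> (\<epsilon> q \<odot>\<^bsub>H\<^esub> c)) \<otimes>\<^bsub>H\<^esub> b) x \<in> carrier AH"
      by (rule sw_closed[OF G x]) (use c in simp)
  qed
  also have "\<dots> = sw AH (\<lambda>a b. S (a \<otimes>\<^bsub>H\<^esub> y) \<otimes>\<^bsub>H\<^esub> b) x"
    by (rule sw_counit_right[OF G hom2 y])
  finally show ?thesis using L sw_coassoc[OF G tri y] by simp
qed

text \<open>
  Evaluate \<open>S(x\<^sub>1 y) x\<^sub>2 S(x\<^sub>3)\<close> in two ways: contracting \<open>x\<^sub>2 S(x\<^sub>3)\<close> leaves \<open>S(xy)\<close>, while the
  preceding lemma contracts \<open>S(x\<^sub>1 y) x\<^sub>2\<close> and leaves \<open>S(y) S(x)\<close>.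
\<close>

lemma antipode_mult:
  assumes x: "x \<in> carrier H" and y: "y \<in> carrier H"
  shows "S (x \<otimes>\<^bsub>H\<^esub> y) = S y \<otimes>\<^bsub>H\<^esub> S x"
proof -
  note G = AH_comm_group
  note dist = H.l_distr H.r_distr H.smult_mult_left H.smult_mult_right
  define \<tau> where "\<tau> a b c = S (a \<otimes>\<^bsub>H\<^esub> y) \<otimes>\<^bsub>H\<^esub> (b \<otimes>\<^bsub>H\<^esub> S c)" for a b c
  have tri: "trilinear AH \<tau>"
    unfolding \<tau>_def by (rule trilinearI) (use y in \<open>simp_all add: dist\<close>)
  have "sw AH (\<lambda>p c. sw AH (\<lambda>a b. \<tau> a b c) p) x = sw AH (\<lambda>p c. S y \<otimes>\<^bsub>H\<^esub> S (\<epsilon> p \<odot>\<^bsub>H\<^esub> c)) x"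
  proof (rule sw_cong[OF G x])
    fix p c assume p: "p \<in> carrier H" "c \<in> carrier H"
    have hom: "(\<lambda>u. u \<otimes>\<^bsub>H\<^esub> S c) \<in> hom AH AH" using p by (auto intro!: homI simp: dist)
    \<comment> \<open>Regrouped so that multiplication by the last factor is one homomorphism applied to the whole sum.\<close>
    have "sw AH (\<lambda>a b. \<tau> a b c) p = sw AH (\<lambda>a b. S (a \<otimes>\<^bsub>H\<^esub> y) \<otimes>\<^bsub>H\<^esub> b \<otimes>\<^bsub>H\<^esub> S c) p"
      unfolding \<tau>_def by (rule sw_cong[OF G p(1)]) (use p y in \<open>simp_all add: H.m_assoc\<close>)
    also have "\<dots> = sw AH (\<lambda>a b. S (a \<otimes>\<^bsub>H\<^esub> y) \<otimes>\<^bsub>H\<^esub> b) p \<otimes>\<^bsub>H\<^esub> S c"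
      by (rule hom_sw[OF G G hom p(1), symmetric]) (use y in simp)
    also have "\<dots> = S y \<otimes>\<^bsub>H\<^esub> S (\<epsilon> p \<odot>\<^bsub>H\<^esub> c)"
      using p y by (simp add: sw_antipode_mult_cancel dist)
    finally show "sw AH (\<lambda>a b. \<tau> a b c) p = S y \<otimes>\<^bsub>H\<^esub> S (\<epsilon> p \<odot>\<^bsub>H\<^esub> c)" .
  qed (use y in simp)
  also have "\<dots> = S y \<otimes>\<^bsub>H\<^esub> S x"
    by (rule sw_counit_left[OF G _ x]) (use y in \<open>auto intro!: homI simp: dist\<close>)
  finally have L: "sw AH (\<lambda>p c. sw AH (\<lambda>a b. \<tau> a b c) p) x = S y \<otimes>\<^bsub>H\<^esub> S x" .
  have "sw AH (\<lambda>a b. sw AH (\<tau> a) b) x = sw AH (\<lambda>a q. S ((\<epsilon> q \<odot>\<^bsub>H\<^esub> a) \<otimes>\<^bsub>H\<^esub> y)) x"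
  proof (rule sw_cong[OF G x])
    fix a q assume a: "a \<in> carrier H" "q \<in> carrier H"
    have hom: "(\<lambda>u. S (a \<otimes>\<^bsub>H\<^esub> y) \<otimes>\<^bsub>H\<^esub> u) \<in> hom AH AH" using a y by (auto intro!: homI simp: dist)
    have "sw AH (\<tau> a) q = S (a \<otimes>\<^bsub>H\<^esub> y) \<otimes>\<^bsub>H\<^esub> (\<epsilon> q \<odot>\<^bsub>H\<^esub> \<one>\<^bsub>H\<^esub>)"
      unfolding \<tau>_def by (rule sw_antipode_right[OF G hom a(2)])
    then show "sw AH (\<tau> a) q = S ((\<epsilon> q \<odot>\<^bsub>H\<^esub> a) \<otimes>\<^bsub>H\<^esub> y)"
      using a y by (simp add: dist)
  qed (use y in simp)
  also have "\<dots> = S (x \<otimes>\<^bsub>H\<^esub> y)"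
    by (rule sw_counit_right[OF G _ x]) (use y in \<open>auto intro!: homI simp: dist\<close>)
  finally show ?thesis using L sw_coassoc[OF G tri x] by simp
qed

end

section \<open>Coinvariants form a right coideal\<close>

lemma eq_one_if_mult_eq_right:
  assumes "comm_group G" "a \<in> carrier G" "b \<in> carrier G" "a \<otimes>\<^bsub>G\<^esub> b = b"
  shows "a = \<one>\<^bsub>G\<^esub>"
proof -
  interpret comm_group G by fact
  show ?thesis using assms(2-4) r_cancel_one by simp
qed

locale hopf_quotient = hopf_algebra k H
  for k :: "('k, 'f) ring_scheme" and H :: "('k, 'h, 'm) hopf_scheme" +
  fixes I :: "'h set"
  assumes I: "left_ideal_coideal k H I"
begin

sublocale QS: quotient_space k H I
  using I module_H
  by (intro quotient_space.intro quotient_space_axioms.intro)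
     (simp_all add: left_ideal_coideal_def coideal_def)

abbreviation "Q \<equiv> quotient_module H I"
abbreviation "\<pi> \<equiv> quotient_proj H Q"

sublocale QH: tensor_modules k Q H
  by (intro tensor_modules.intro module_H QS.quotient_module)

abbreviation "TQ \<equiv> tensor_group k Q H"
abbreviation "pq \<equiv> pure_tensor TQ"
abbreviation "K \<equiv> coinvariants k H Q"

lemma I_left_ideal: "h \<in> carrier H \<Longrightarrow> x \<in> I \<Longrightarrow> h \<otimes>\<^bsub>H\<^esub> x \<in> I"
  using I by (simp add: left_ideal_coideal_def)

lemmas TQ_comm_group = QH.tensor_comm_group
lemmas pq_balanced = balanced_mapD[OF QH.pure_tensor_balanced]

lemma proj_simps [simp]:
  "x \<in> carrier H \<Longrightarrow> \<pi> x \<in> carrier Q"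
  "x \<in> carrier H \<Longrightarrow> y \<in> carrier H \<Longrightarrow> \<pi> (x \<oplus>\<^bsub>H\<^esub> y) = \<pi> x \<oplus>\<^bsub>Q\<^esub> \<pi> y"
  "c \<in> carrier k \<Longrightarrow> x \<in> carrier H \<Longrightarrow> \<pi> (c \<odot>\<^bsub>H\<^esub> x) = c \<odot>\<^bsub>Q\<^esub> \<pi> x"
  by (simp_all add: QS.proj_add QS.proj_smult)

definition "coact h = sw TQ (\<lambda>a b. pq (\<pi> a) b) h"

lemma bal_coact: "bal TQ (\<lambda>a b. pq (\<pi> a) b)"
  by (rule balanced_mapI) (simp_all add: pq_balanced)

lemma mem_K_iff: "h \<in> K \<longleftrightarrow> h \<in> carrier H \<and> coact h = pq (\<pi> \<one>\<^bsub>H\<^esub>) h"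
  unfolding coinvariants_def coact_def Let_def mem_Collect_eq
  using tensor_lift_comult[OF TQ_comm_group bal_coact, of h] by auto

lemma K_subset: "x \<in> K \<Longrightarrow> x \<in> carrier H"
  by (simp add: mem_K_iff)

lemma coact_linear: "linear_map k H (tensor_module k Q H) coact"
proof -
  have h: "coact \<in> hom AH TQ"
    unfolding coact_def by (rule sw_hom[OF TQ_comm_group bal_coact])
  have s: "coact (c \<odot>\<^bsub>H\<^esub> x) = c \<odot>\<^bsub>tensor_module k Q H\<^esub> coact x"
    if c: "c \<in> carrier k" and x: "x \<in> carrier H" for c x
  proof -
    have "c \<odot>\<^bsub>tensor_module k Q H\<^esub> coact x = sw TQ (\<lambda>a b. c \<odot>\<^bsub>tensor_module k Q H\<^esub> pq (\<pi> a) b) x"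
      unfolding coact_def
      by (rule hom_sw[OF TQ_comm_group TQ_comm_group QH.smult_hom[OF c] x]) simp
    also have "\<dots> = sw TQ (\<lambda>a b. pq (\<pi> (c \<odot>\<^bsub>H\<^esub> a)) b) x"
      by (rule sw_cong[OF TQ_comm_group x]) (use c in \<open>simp_all add: QH.smult_pure\<close>)
    finally show ?thesis
      unfolding coact_def using sw_smult[OF TQ_comm_group bal_coact c x] by simp
  qed
  show ?thesis
    unfolding linear_map_def QH.tensor_module_simps
    using h s by (auto simp: hom_def)
qed

text \<open>
  The linear map \<open>h \<mapsto> \<pi>(h\<^sub>1) \<otimes> h\<^sub>2 - \<pi>(1) \<otimes> h\<close>, whose kernel is \<open>K\<close>.
\<close>

definition "coinv_defect h = coact h \<ominus>\<^bsub>tensor_module k Q H\<^esub> pq (\<pi> \<one>\<^bsub>H\<^esub>) h"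

lemma trivial_coact_linear: "linear_map k H (tensor_module k Q H) (pq (\<pi> \<one>\<^bsub>H\<^esub>))"
  by (auto simp: linear_map_def QH.tensor_module_simps pq_balanced QH.smult_pure)

lemma coinv_defect_linear: "linear_map k H (tensor_module k Q H) coinv_defect"
proof -
  interpret TM: module k "tensor_module k Q H" by (rule QH.tensor_module)
  note a = linear_mapD[OF coact_linear] and b = linear_mapD[OF trivial_coact_linear]
  show ?thesis
    unfolding linear_map_def coinv_defect_def
    using a b by (auto simp: a_minus_def TM.minus_add TM.a_ac TM.smult_r_distr TM.smult_r_minus)
qed

lemma coinv_defect_add:
  assumes "h \<in> carrier H"
  shows "coinv_defect h \<otimes>\<^bsub>TQ\<^esub> pq (\<pi> \<one>\<^bsub>H\<^esub>) h = coact h"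
proof -
  interpret TM: module k "tensor_module k Q H" by (rule QH.tensor_module)
  have "coinv_defect h \<oplus>\<^bsub>tensor_module k Q H\<^esub> pq (\<pi> \<one>\<^bsub>H\<^esub>) h = coact h"
    using linear_mapD(1)[OF coact_linear assms] linear_mapD(1)[OF trivial_coact_linear assms]
    by (simp add: coinv_defect_def a_minus_def TM.a_assoc TM.l_neg)
  then show ?thesis by (simp add: QH.tensor_module_simps)
qed

lemma mem_K_iff_defect:
  "h \<in> K \<longleftrightarrow> h \<in> carrier H \<and> coinv_defect h = \<zero>\<^bsub>tensor_module k Q H\<^esub>"
proof -
  interpret TQ: comm_group TQ by (rule TQ_comm_group)
  show ?thesis
    using coinv_defect_add[of h] mem_K_iff linear_mapD(1)[OF coinv_defect_linear, of h]
    by (auto simp: QH.tensor_module_simps intro: eq_one_if_mult_eq_right[OF TQ_comm_group])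
qed

lemma K_submodule: "submodule K k H"
proof -
  interpret TM: module k "tensor_module k Q H" by (rule QH.tensor_module)
  note d = linear_mapD[OF coinv_defect_linear]
  have z: "coinv_defect \<zero>\<^bsub>H\<^esub> = \<zero>\<^bsub>tensor_module k Q H\<^esub>"
    using d(3)[of "\<zero>\<^bsub>k\<^esub>" "\<zero>\<^bsub>H\<^esub>"] d(1)[of "\<zero>\<^bsub>H\<^esub>"] by simp
  have sm: "c \<odot>\<^bsub>H\<^esub> x \<in> K" if "c \<in> carrier k" "x \<in> K" for c x
    using that d by (simp add: mem_K_iff_defect)
  show ?thesis
  proof (rule H.submoduleI)
    show "K \<subseteq> carrier H" using K_subset by blast
    show "\<zero>\<^bsub>H\<^esub> \<in> K" using z by (simp add: mem_K_iff_defect)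
    show "\<ominus>\<^bsub>H\<^esub> a \<in> K" if "a \<in> K" for a
      using sm[OF _ that, of "\<ominus>\<^bsub>k\<^esub> \<one>\<^bsub>k\<^esub>"] K_subset[OF that] H.smult_l_minus[of "\<one>\<^bsub>k\<^esub>" a] by simp
  qed (use d sm in \<open>simp_all add: mem_K_iff_defect\<close>)
qed

lemma one_in_K: "\<one>\<^bsub>H\<^esub> \<in> K"
  using sw_one[OF TQ_comm_group bal_coact] by (simp add: mem_K_iff coact_def)

lemma K_diff: "x \<in> K \<Longrightarrow> y \<in> K \<Longrightarrow> x \<ominus>\<^bsub>H\<^esub> y \<in> K"
  using K_submodule subgroup.m_closed[of K AH x] subgroup.m_inv_closed[of K AH y]
  by (auto simp: submodule_def a_minus_def a_inv_def)

lemma scalar_in_K: "c \<in> carrier k \<Longrightarrow> c \<odot>\<^bsub>H\<^esub> \<one>\<^bsub>H\<^esub> \<in> K"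
  by (rule submodule.smult_closed[OF K_submodule _ one_in_K])

text \<open>
  Let \<open>f\<close> be the defect map.  For \<open>\<kappa> \<in> K\<close> the tensor \<open>f(\<kappa>\<^sub>1) \<otimes> \<kappa>\<^sub>2\<close> vanishes, since by coassociativity
  it is the image of \<open>f(\<kappa>) = 0\<close> under \<open>id \<otimes> \<Delta>\<close>.  The map \<open>E\<close> in the proof is \<open>id \<otimes> \<Delta>\<close> followed by
  \<open>s\<close> on the first two legs and then \<open>\<beta>\<close>.
\<close>

lemma sw_coinv_defect:
  assumes G: "comm_group G" and \<beta>: "bal G \<beta>" and \<kappa>: "\<kappa> \<in> K"
    and s: "linear_map k (tensor_module k Q H) H s"
  shows "sw G (\<lambda>a b. \<beta> (s (coinv_defect a)) b) \<kappa> = \<one>\<^bsub>G\<^esub>"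
proof -
  note s = linear_mapD[OF s, unfolded QH.tensor_module_simps]
  note b = balanced_mapD[OF \<beta>]
  have \<kappa>H: "\<kappa> \<in> carrier H" using K_subset \<kappa> .
  define E where "E q h = sw G (\<lambda>u v. \<beta> (s (pq q u)) v) h" for q h
  have b1: "bal G (\<lambda>u v. \<beta> (s (pq q u)) v)" if "q \<in> carrier Q" for q
  proof (rule balanced_mapI)
    fix x a y assume x: "x \<in> carrier H" "a \<in> carrier k" "y \<in> carrier H"
    have "pq q (a \<odot>\<^bsub>H\<^esub> x) = a \<odot>\<^bsub>tensor_module k Q H\<^esub> pq q x"
      using that x by (simp add: pq_balanced(4)[symmetric] QH.smult_pure)
    then show "\<beta> (s (pq q (a \<odot>\<^bsub>H\<^esub> x))) y = \<beta> (s (pq q x)) (a \<odot>\<^bsub>H\<^esub> y)"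
      using that x s b by simp
  qed (use that s b in \<open>simp_all add: pq_balanced\<close>)
  have bE: "k_balanced k Q H G E"
  proof (rule balanced_mapI)
    fix q h assume "q \<in> carrier Q" "h \<in> carrier H"
    then show "E q h \<in> carrier G"
      unfolding E_def by (intro sw_closed[OF G]) (simp_all add: s b)
  next
    fix q q' h assume q: "q \<in> carrier Q" "q' \<in> carrier Q" "h \<in> carrier H"
    have "E (q \<oplus>\<^bsub>Q\<^esub> q') h = sw G (\<lambda>u v. \<beta> (s (pq q u)) v \<otimes>\<^bsub>G\<^esub> \<beta> (s (pq q' u)) v) h"
      unfolding E_def
    proof (rule sw_cong[OF G q(3)])
      interpret G: comm_group G by fact
      fix u v assume "u \<in> carrier H" "v \<in> carrier H"
      then show "\<beta> (s (pq q u)) v \<otimes>\<^bsub>G\<^esub> \<beta> (s (pq q' u)) v \<in> carrier G" using q by (simp add: s b)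
    qed (use q in \<open>simp add: pq_balanced s b\<close>)
    also have "\<dots> = E q h \<otimes>\<^bsub>G\<^esub> E q' h"
      unfolding E_def by (rule sw_pointwise_mult[OF G q(3)]) (use q in \<open>simp_all add: s b\<close>)
    finally show "E (q \<oplus>\<^bsub>Q\<^esub> q') h = E q h \<otimes>\<^bsub>G\<^esub> E q' h" .
  next
    fix q h h' assume "q \<in> carrier Q" "h \<in> carrier H" "h' \<in> carrier H"
    then show "E q (h \<oplus>\<^bsub>H\<^esub> h') = E q h \<otimes>\<^bsub>G\<^esub> E q h'"
      unfolding E_def using hom_mult[OF sw_hom[OF G b1], of q h h'] by simp
  next
    fix q c h assume q: "q \<in> carrier Q" "c \<in> carrier k" "h \<in> carrier H"
    show "E (c \<odot>\<^bsub>Q\<^esub> q) h = E q (c \<odot>\<^bsub>H\<^esub> h)"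
      unfolding E_def sw_smult[OF G b1[OF q(1)] q(2,3)]
      by (rule sw_cong[OF G q(3)]) (use q in \<open>simp_all add: pq_balanced s b\<close>)
  qed
  let ?E = "tensor_lift G E"
  have E: "?E \<in> hom TQ G" by (rule QH.tensor_lift_hom[OF G bE])
  have Ep: "?E (pq q h) = E q h" if "q \<in> carrier Q" "h \<in> carrier H" for q h
    by (rule QH.tensor_lift_pure[OF G bE that])
  have tri: "trilinear G (\<lambda>a u v. \<beta> (s (pq (\<pi> a) u)) v)"
  proof (rule trilinearI)
    fix c x y z assume x: "c \<in> carrier k" "x \<in> carrier H" "y \<in> carrier H" "z \<in> carrier H"
    show "\<beta> (s (pq (\<pi> x) (c \<odot>\<^bsub>H\<^esub> y))) z = \<beta> (s (pq (\<pi> x) y)) (c \<odot>\<^bsub>H\<^esub> z)"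
      using balanced_mapD(4)[OF b1, of "\<pi> x" y c z] x by simp
  qed (simp_all add: pq_balanced s b)
  have coact_eq: "coact \<kappa> = pq (\<pi> \<one>\<^bsub>H\<^esub>) \<kappa>" using \<kappa> mem_K_iff by simp
  have "?E (coact \<kappa>) = sw G (\<lambda>a b. ?E (pq (\<pi> a) b)) \<kappa>"
    unfolding coact_def by (rule hom_sw[OF TQ_comm_group G E \<kappa>H]) simp
  also have "\<dots> = sw G (\<lambda>a b. sw G (\<lambda>u v. \<beta> (s (pq (\<pi> a) u)) v) b) \<kappa>"
    by (rule sw_cong[OF G \<kappa>H])
       (use Ep balanced_mapD(1)[OF bE] in \<open>simp_all add: E_def\<close>)
  also have "\<dots> = sw G (\<lambda>a b. sw G (\<lambda>u v. \<beta> (s (pq (\<pi> u) v)) b) a) \<kappa>"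
    by (rule sw_coassoc[OF G tri \<kappa>H, symmetric])
  also have "\<dots> = sw G (\<lambda>a b. \<beta> (s (coact a)) b) \<kappa>"
  proof (rule sw_cong[OF G \<kappa>H])
    fix a b' assume a: "a \<in> carrier H" "b' \<in> carrier H"
    have "(\<lambda>X. \<beta> (s X) b') \<in> hom TQ G" by (rule homI) (use a in \<open>simp_all add: s b\<close>)
    then show "sw G (\<lambda>u v. \<beta> (s (pq (\<pi> u) v)) b') a = \<beta> (s (coact a)) b'"
      unfolding coact_def
      by (intro hom_sw[OF TQ_comm_group G _ a(1), symmetric, where \<phi> = "\<lambda>X. \<beta> (s X) b'"]) simp_all
    show "\<beta> (s (coact a)) b' \<in> carrier G"
      using a linear_mapD(1)[OF coact_linear] by (simp add: s b QH.tensor_module_simps)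
  qed
  finally have 1: "?E (coact \<kappa>) = sw G (\<lambda>a b. \<beta> (s (coact a)) b) \<kappa>" .
  have 2: "?E (coact \<kappa>) = sw G (\<lambda>a b. \<beta> (s (pq (\<pi> \<one>\<^bsub>H\<^esub>) a)) b) \<kappa>"
    unfolding coact_eq using Ep \<kappa>H by (simp add: E_def)
  have dc: "coinv_defect a \<in> carrier TQ" if "a \<in> carrier H" for a
    using linear_mapD(1)[OF coinv_defect_linear that] by (simp add: QH.tensor_module_simps)
  have "sw G (\<lambda>a b. \<beta> (s (coinv_defect a)) b) \<kappa> \<otimes>\<^bsub>G\<^esub> sw G (\<lambda>a b. \<beta> (s (pq (\<pi> \<one>\<^bsub>H\<^esub>) a)) b) \<kappa>
    = sw G (\<lambda>a b. \<beta> (s (coinv_defect a)) b \<otimes>\<^bsub>G\<^esub> \<beta> (s (pq (\<pi> \<one>\<^bsub>H\<^esub>) a)) b) \<kappa>"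
    by (rule sw_pointwise_mult[OF G \<kappa>H, symmetric]) (simp_all add: s b dc)
  also have "\<dots> = sw G (\<lambda>a b. \<beta> (s (coact a)) b) \<kappa>"
  proof (rule sw_cong[OF G \<kappa>H])
    fix a b' assume a: "a \<in> carrier H" "b' \<in> carrier H"
    show "\<beta> (s (coinv_defect a)) b' \<otimes>\<^bsub>G\<^esub> \<beta> (s (pq (\<pi> \<one>\<^bsub>H\<^esub>) a)) b' = \<beta> (s (coact a)) b'"
      using a by (simp add: coinv_defect_add[symmetric] s b dc)
    show "\<beta> (s (coact a)) b' \<in> carrier G"
      using a linear_mapD(1)[OF coact_linear] by (simp add: s b QH.tensor_module_simps)
  qed
  also have "\<dots> = sw G (\<lambda>a b. \<beta> (s (pq (\<pi> \<one>\<^bsub>H\<^esub>) a)) b) \<kappa>" using 1 2 by simp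
  finally show ?thesis
    by (intro eq_one_if_mult_eq_right[OF G]) (simp_all add: sw_closed[OF G \<kappa>H] s b dc)
qed

text \<open>
  The inclusion \<open>\<Delta>(K) \<subseteq> K \<otimes> H\<close>, stated as: a balanced map on \<open>H \<times> H\<close> need only be known on
  \<open>K \<times> H\<close> for its Sweedler sum at \<open>\<kappa> \<in> K\<close>.  With \<open>s\<close> a generalised inverse of the defect map \<open>f\<close>,
  the map \<open>p = id - s f\<close> projects onto \<open>K\<close>, and \<open>s f(\<kappa>\<^sub>1) \<otimes> \<kappa>\<^sub>2 = 0\<close> shows
  \<open>\<kappa>\<^sub>1 \<otimes> \<kappa>\<^sub>2 = p(\<kappa>\<^sub>1) \<otimes> \<kappa>\<^sub>2\<close>.
\<close>

lemma sw_cong_coinvariant: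
  assumes G: "comm_group G" and \<beta>: "bal G \<beta>" and \<beta>': "bal G \<beta>'" and \<kappa>: "\<kappa> \<in> K"
    and eq: "\<And>a b. a \<in> K \<Longrightarrow> b \<in> carrier H \<Longrightarrow> \<beta> a b = \<beta>' a b"
  shows "sw G \<beta> \<kappa> = sw G \<beta>' \<kappa>"
proof -
  interpret TM: module k "tensor_module k Q H" by (rule QH.tensor_module)
  obtain s where s: "linear_map k (tensor_module k Q H) H s"
    and sf: "\<And>x. x \<in> carrier H \<Longrightarrow> coinv_defect (s (coinv_defect x)) = coinv_defect x"
    using linear_map_generalised_inverse[OF k.field_axioms module_H QH.tensor_module coinv_defect_linear]
    by blast
  note d = linear_mapD[OF coinv_defect_linear] and s' = linear_mapD[OF s]
  define p where "p a = a \<ominus>\<^bsub>H\<^esub> s (coinv_defect a)" for a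
  have pc: "p a \<in> carrier H" and sc: "s (coinv_defect a) \<in> carrier H"
    and pa: "p a \<oplus>\<^bsub>H\<^esub> s (coinv_defect a) = a" if "a \<in> carrier H" for a
    using that d s' by (simp_all add: p_def a_minus_def H.a_assoc H.l_neg)
  have pK: "p a \<in> K" if a: "a \<in> carrier H" for a
  proof -
    have "coinv_defect (p a) \<oplus>\<^bsub>tensor_module k Q H\<^esub> coinv_defect a = coinv_defect a"
      using d(2)[OF pc[OF a] sc[OF a]] pa[OF a] sf[OF a] by simp
    then have "coinv_defect (p a) = \<zero>\<^bsub>tensor_module k Q H\<^esub>"
      using eq_one_if_mult_eq_right[OF TM.a_comm_group, of "coinv_defect (p a)" "coinv_defect a"]
        d(1)[OF pc[OF a]] d(1)[OF a] by simp
    then show ?thesis using pc[OF a] by (simp add: mem_K_iff_defect)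
  qed
  have \<kappa>H: "\<kappa> \<in> carrier H" using K_subset \<kappa> .
  have red: "sw G \<gamma> \<kappa> = sw G (\<lambda>a b. \<gamma> (p a) b) \<kappa>" if \<gamma>: "bal G \<gamma>" for \<gamma>
  proof -
    interpret G: comm_group G by fact
    note b = balanced_mapD[OF \<gamma>]
    have "sw G \<gamma> \<kappa> = sw G (\<lambda>a b. \<gamma> (p a) b \<otimes>\<^bsub>G\<^esub> \<gamma> (s (coinv_defect a)) b) \<kappa>"
    proof (rule sw_cong[OF G \<kappa>H])
      fix a b' assume a: "a \<in> carrier H" "b' \<in> carrier H"
      show "\<gamma> a b' = \<gamma> (p a) b' \<otimes>\<^bsub>G\<^esub> \<gamma> (s (coinv_defect a)) b'"
        using b(2)[OF pc[OF a(1)] sc[OF a(1)] a(2)] pa[OF a(1)] by simp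
      show "\<gamma> (p a) b' \<otimes>\<^bsub>G\<^esub> \<gamma> (s (coinv_defect a)) b' \<in> carrier G" using a by (simp add: b pc sc)
    qed
    also have "\<dots> = sw G (\<lambda>a b. \<gamma> (p a) b) \<kappa> \<otimes>\<^bsub>G\<^esub> sw G (\<lambda>a b. \<gamma> (s (coinv_defect a)) b) \<kappa>"
      by (rule sw_pointwise_mult[OF G \<kappa>H]) (simp_all add: b pc sc)
    also have "\<dots> = sw G (\<lambda>a b. \<gamma> (p a) b) \<kappa>"
      using sw_coinv_defect[OF G \<gamma> \<kappa> s] sw_closed[OF G \<kappa>H, of "\<lambda>a b. \<gamma> (p a) b"] by (simp add: b pc)
    finally show ?thesis .
  qed
  have "sw G (\<lambda>a b. \<beta> (p a) b) \<kappa> = sw G (\<lambda>a b. \<beta>' (p a) b) \<kappa>"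
    by (rule sw_cong[OF G \<kappa>H]) (simp_all add: eq pK pc balanced_mapD(1)[OF \<beta>'])
  then show ?thesis using red[OF \<beta>] red[OF \<beta>'] by simp
qed

section \<open>The canonical map\<close>

sublocale HK: tensor_factors H H K "(\<otimes>\<^bsub>H\<^esub>)" "(\<otimes>\<^bsub>H\<^esub>)"
  by (intro tensor_factors.intro tensor_factors_axioms.intro H.abelian_group_axioms)
     (simp_all add: K_subset)

abbreviation "TK \<equiv> balanced_tensor K (\<otimes>\<^bsub>H\<^esub>) (\<otimes>\<^bsub>H\<^esub>) H H"
abbreviation "pK \<equiv> pure_tensor TK"

lemmas TK_comm_group = HK.tensor_comm_group
lemmas pK_balanced = balanced_mapD[OF HK.pure_tensor_balanced]
lemmas mult_simps = H.l_distr H.r_distr H.smult_mult_left H.smult_mult_right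

text \<open>
  Scalars can be moved across \<open>\<otimes>\<^sub>K\<close> because \<open>K\<close> contains the scalar multiples of 1.
\<close>

lemma pK_scalar:
  assumes "c \<in> carrier k" "x \<in> carrier H" "y \<in> carrier H"
  shows "pK (c \<odot>\<^bsub>H\<^esub> x) y = pK x (c \<odot>\<^bsub>H\<^esub> y)"
  using pK_balanced(4)[OF assms(2) scalar_in_K[OF assms(1)] assms(3)] assms by (simp add: mult_simps)

lemma pK_hom_right: "a \<in> carrier H \<Longrightarrow> pK a \<in> hom AH TK"
  by (rule homI) (simp_all add: pK_balanced)

lemma pK_hom_left: "b \<in> carrier H \<Longrightarrow> (\<lambda>a. pK a b) \<in> hom AH TK"
  by (rule homI) (simp_all add: pK_balanced)

lemma pq_hom_left: "b \<in> carrier H \<Longrightarrow> (\<lambda>a. pq (\<pi> a) b) \<in> hom AH TQ"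
  by (rule homI) (simp_all add: pq_balanced)

text \<open>
  \<open>I\<close> is a left ideal, so \<open>Q\<close> is a left \<open>H\<close>-module.
\<close>

definition "left_action a q = \<pi> (a \<otimes>\<^bsub>H\<^esub> (SOME x. x \<in> carrier H \<and> q = \<pi> x))"

lemma left_action_proj:
  assumes a: "a \<in> carrier H" and x: "x \<in> carrier H"
  shows "left_action a (\<pi> x) = \<pi> (a \<otimes>\<^bsub>H\<^esub> x)"
proof -
  define y where "y = (SOME y. y \<in> carrier H \<and> \<pi> x = \<pi> y)"
  have y: "y \<in> carrier H \<and> \<pi> x = \<pi> y"
    unfolding y_def by (rule someI[of _ x]) (use x in simp)
  have "y \<ominus>\<^bsub>H\<^esub> x \<in> I" using QS.proj_eq_iff[of y x] x y by simp
  then have "a \<otimes>\<^bsub>H\<^esub> (y \<ominus>\<^bsub>H\<^esub> x) \<in> I" by (rule I_left_ideal[OF a])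
  then have "(a \<otimes>\<^bsub>H\<^esub> y) \<ominus>\<^bsub>H\<^esub> (a \<otimes>\<^bsub>H\<^esub> x) \<in> I"
    using a x y by (simp add: a_minus_def H.r_distr H.r_minus)
  then show ?thesis
    unfolding left_action_def y_def[symmetric] using QS.proj_eq_iff a x y by simp
qed

lemma bal_left_action:
  assumes a: "a \<in> carrier H" and b: "b \<in> carrier H"
  shows "k_balanced k Q H TQ (\<lambda>q d. pq (left_action a q) (b \<otimes>\<^bsub>H\<^esub> d))"
proof -
  have c: "left_action a q \<in> carrier Q" if "q \<in> carrier Q" for q
    using QS.proj_surj[OF that] a by (auto simp: left_action_proj)
  have ad: "left_action a (q \<oplus>\<^bsub>Q\<^esub> q') = left_action a q \<oplus>\<^bsub>Q\<^esub> left_action a q'" if q: "q \<in> carrier Q" "q' \<in> carrier Q" for q q'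
  proof -
    obtain x y where "x \<in> carrier H" "q = \<pi> x" "y \<in> carrier H" "q' = \<pi> y"
      using QS.proj_surj[OF q(1)] QS.proj_surj[OF q(2)] by blast
    then show ?thesis
      using a by (simp add: proj_simps(2)[symmetric] left_action_proj H.r_distr del: proj_simps(2))
  qed
  have sm: "left_action a (c \<odot>\<^bsub>Q\<^esub> q) = c \<odot>\<^bsub>Q\<^esub> left_action a q" if q: "c \<in> carrier k" "q \<in> carrier Q" for c q
  proof -
    obtain x where "x \<in> carrier H" "q = \<pi> x" using QS.proj_surj[OF q(2)] by blast
    then show ?thesis
      using a q by (simp add: proj_simps(3)[symmetric] left_action_proj H.smult_mult_right del: proj_simps(3))
  qed
  show ?thesis
    by (rule balanced_mapI) (use b in \<open>simp_all add: c ad sm pq_balanced mult_simps\<close>)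
qed

definition "canonical_pairing x y = sw TQ (\<lambda>a b. pq (\<pi> a) (b \<otimes>\<^bsub>H\<^esub> y)) x"

lemma bal_canonical_pairing:
  assumes "y \<in> carrier H"
  shows "bal TQ (\<lambda>a b. pq (\<pi> a) (b \<otimes>\<^bsub>H\<^esub> y))"
  by (rule balanced_mapI) (use assms in \<open>simp_all add: pq_balanced mult_simps\<close>)

text \<open>
  The only non-formal point is the \<open>K\<close>-balancedness.  For \<open>\<kappa> \<in> K\<close>, acting with \<open>a\<close> and \<open>b\<close> from the
  left and with \<open>y\<close> from the right on \<open>\<pi>(\<kappa>\<^sub>1) \<otimes> \<kappa>\<^sub>2 = \<pi>(1) \<otimes> \<kappa>\<close> gives
  \<open>\<pi>(a \<kappa>\<^sub>1) \<otimes> b \<kappa>\<^sub>2 y = \<pi>(a) \<otimes> b \<kappa> y\<close>; sum over \<open>a = x\<^sub>1\<close>, \<open>b = x\<^sub>2\<close>.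
\<close>

lemma canonical_pairing_balanced: "balanced_map K (\<otimes>\<^bsub>H\<^esub>) (\<otimes>\<^bsub>H\<^esub>) H H TQ canonical_pairing"
proof (rule balanced_mapI)
  fix x y assume "x \<in> carrier H" "y \<in> carrier H"
  then show "canonical_pairing x y \<in> carrier TQ"
    unfolding canonical_pairing_def by (intro sw_closed[OF TQ_comm_group]) simp_all
next
  fix x x' y assume "x \<in> carrier H" "x' \<in> carrier H" "y \<in> carrier H"
  then show "canonical_pairing (x \<oplus>\<^bsub>H\<^esub> x') y = canonical_pairing x y \<otimes>\<^bsub>TQ\<^esub> canonical_pairing x' y"
    unfolding canonical_pairing_def using hom_mult[OF sw_hom[OF TQ_comm_group bal_canonical_pairing], of y x x'] by simp
next
  fix x y y' assume x: "x \<in> carrier H" "y \<in> carrier H" "y' \<in> carrier H"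
  interpret TQ: comm_group TQ by (rule TQ_comm_group)
  have "canonical_pairing x (y \<oplus>\<^bsub>H\<^esub> y') = sw TQ (\<lambda>a b. pq (\<pi> a) (b \<otimes>\<^bsub>H\<^esub> y) \<otimes>\<^bsub>TQ\<^esub> pq (\<pi> a) (b \<otimes>\<^bsub>H\<^esub> y')) x"
    unfolding canonical_pairing_def
    by (rule sw_cong[OF TQ_comm_group x(1)]) (use x in \<open>simp_all add: pq_balanced mult_simps\<close>)
  also have "\<dots> = canonical_pairing x y \<otimes>\<^bsub>TQ\<^esub> canonical_pairing x y'"
    unfolding canonical_pairing_def by (rule sw_pointwise_mult[OF TQ_comm_group x(1)]) (use x in simp_all)
  finally show "canonical_pairing x (y \<oplus>\<^bsub>H\<^esub> y') = canonical_pairing x y \<otimes>\<^bsub>TQ\<^esub> canonical_pairing x y'" .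
next
  fix x \<kappa> y assume x: "x \<in> carrier H" and \<kappa>: "\<kappa> \<in> K" and y: "y \<in> carrier H"
  have \<kappa>H: "\<kappa> \<in> carrier H" using K_subset \<kappa> .
  have "canonical_pairing (x \<otimes>\<^bsub>H\<^esub> \<kappa>) y =
    sw TQ (\<lambda>a b. sw TQ (\<lambda>c d. pq (\<pi> (a \<otimes>\<^bsub>H\<^esub> c)) ((b \<otimes>\<^bsub>H\<^esub> d) \<otimes>\<^bsub>H\<^esub> y)) \<kappa>) x"
    unfolding canonical_pairing_def by (rule sw_of_product[OF TQ_comm_group bal_canonical_pairing[OF y] x \<kappa>H])
  also have "\<dots> = canonical_pairing x (\<kappa> \<otimes>\<^bsub>H\<^esub> y)"
    unfolding canonical_pairing_def
  proof (rule sw_cong[OF TQ_comm_group x])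
    fix a b assume a: "a \<in> carrier H" "b \<in> carrier H"
    have r: "k_balanced k Q H TQ (\<lambda>q d. pq q (d \<otimes>\<^bsub>H\<^esub> y))"
      by (rule balanced_mapI) (use y in \<open>simp_all add: pq_balanced mult_simps\<close>)
    let ?\<phi> = "\<lambda>X. tensor_lift TQ (\<lambda>q d. pq q (d \<otimes>\<^bsub>H\<^esub> y)) (tensor_lift TQ (\<lambda>q d. pq (left_action a q) (b \<otimes>\<^bsub>H\<^esub> d)) X)"
    have \<phi>: "?\<phi> \<in> hom TQ TQ"
      using hom_compose[OF QH.tensor_lift_hom[OF TQ_comm_group bal_left_action[OF a]] QH.tensor_lift_hom[OF TQ_comm_group r]]
      by (simp add: o_def)
    have \<phi>p: "?\<phi> (pq (\<pi> c) d) = pq (\<pi> (a \<otimes>\<^bsub>H\<^esub> c)) ((b \<otimes>\<^bsub>H\<^esub> d) \<otimes>\<^bsub>H\<^esub> y)"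
      if "c \<in> carrier H" "d \<in> carrier H" for c d
      using that a y
      by (simp add: QH.tensor_lift_pure[OF TQ_comm_group bal_left_action[OF a]] QH.tensor_lift_pure[OF TQ_comm_group r] left_action_proj)
    have "sw TQ (\<lambda>c d. pq (\<pi> (a \<otimes>\<^bsub>H\<^esub> c)) ((b \<otimes>\<^bsub>H\<^esub> d) \<otimes>\<^bsub>H\<^esub> y)) \<kappa> = sw TQ (\<lambda>c d. ?\<phi> (pq (\<pi> c) d)) \<kappa>"
      by (rule sw_cong[OF TQ_comm_group \<kappa>H]) (use a y in \<open>simp_all add: \<phi>p\<close>)
    also have "\<dots> = ?\<phi> (coact \<kappa>)"
      unfolding coact_def by (rule hom_sw[OF TQ_comm_group TQ_comm_group \<phi> \<kappa>H, symmetric]) simp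
    also have "\<dots> = ?\<phi> (pq (\<pi> \<one>\<^bsub>H\<^esub>) \<kappa>)" using \<kappa> mem_K_iff by simp
    also have "\<dots> = pq (\<pi> a) (b \<otimes>\<^bsub>H\<^esub> (\<kappa> \<otimes>\<^bsub>H\<^esub> y))"
      using a y \<kappa>H by (simp add: \<phi>p H.m_assoc)
    finally show "sw TQ (\<lambda>c d. pq (\<pi> (a \<otimes>\<^bsub>H\<^esub> c)) ((b \<otimes>\<^bsub>H\<^esub> d) \<otimes>\<^bsub>H\<^esub> y)) \<kappa> = pq (\<pi> a) (b \<otimes>\<^bsub>H\<^esub> (\<kappa> \<otimes>\<^bsub>H\<^esub> y))" .
  qed (use y \<kappa>H in simp)
  finally show "canonical_pairing (x \<otimes>\<^bsub>H\<^esub> \<kappa>) y = canonical_pairing x (\<kappa> \<otimes>\<^bsub>H\<^esub> y)" .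
qed

abbreviation "can \<equiv> tensor_lift TQ canonical_pairing"

lemma canonical_map_eq: "X \<in> carrier TK \<Longrightarrow> canonical_map k H Q X = can X"
  unfolding canonical_map_def Let_def
  by (rule HK.tensor_lift_cong[OF TQ_comm_group canonical_pairing_balanced])
     (simp_all add: canonical_pairing_def tensor_lift_comult[OF TQ_comm_group bal_canonical_pairing])

lemmas can_hom = HK.tensor_lift_hom[OF TQ_comm_group canonical_pairing_balanced]
lemmas can_pure = HK.tensor_lift_pure[OF TQ_comm_group canonical_pairing_balanced]

definition "translation x y = sw TK (\<lambda>a b. pK a (S b \<otimes>\<^bsub>H\<^esub> y)) x"

lemma bal_translation:
  assumes "y \<in> carrier H"
  shows "bal TK (\<lambda>a b. pK a (S b \<otimes>\<^bsub>H\<^esub> y))"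
  by (rule balanced_mapI) (use assms in \<open>simp_all add: pK_balanced(1-3) pK_scalar mult_simps\<close>)

lemma translation_closed:
  "x \<in> carrier H \<Longrightarrow> y \<in> carrier H \<Longrightarrow> translation x y \<in> carrier TK"
  unfolding translation_def by (intro sw_closed[OF TK_comm_group]) simp_all

text \<open>
  \<open>can (x\<^sub>1 \<otimes> S(x\<^sub>2) y) = \<pi>(x\<^sub>1) \<otimes> x\<^sub>2 S(x\<^sub>3) y\<close>, and \<open>x\<^sub>2 S(x\<^sub>3)\<close> contracts to \<open>\<epsilon>(x\<^sub>2)\<close>.
\<close>

lemma can_translation:
  assumes x: "x \<in> carrier H" and y: "y \<in> carrier H"
  shows "can (translation x y) = pq (\<pi> x) y"
proof -
  note G = TQ_comm_group
  have tri: "trilinear TQ (\<lambda>c d b. pq (\<pi> c) (d \<otimes>\<^bsub>H\<^esub> (S b \<otimes>\<^bsub>H\<^esub> y)))"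
    by (rule trilinearI) (use y in \<open>simp_all add: pq_balanced mult_simps\<close>)
  have "can (translation x y) = sw TQ (\<lambda>a b. can (pK a (S b \<otimes>\<^bsub>H\<^esub> y))) x"
    unfolding translation_def by (rule hom_sw[OF TK_comm_group G can_hom x]) (use y in simp)
  also have "\<dots> = sw TQ (\<lambda>a b. sw TQ (\<lambda>c d. pq (\<pi> c) (d \<otimes>\<^bsub>H\<^esub> (S b \<otimes>\<^bsub>H\<^esub> y))) a) x"
    by (rule sw_cong[OF G x]) (use y balanced_mapD(1)[OF canonical_pairing_balanced] in \<open>simp_all add: can_pure canonical_pairing_def\<close>)
  also have "\<dots> = sw TQ (\<lambda>a b. sw TQ (\<lambda>c d. pq (\<pi> a) (c \<otimes>\<^bsub>H\<^esub> (S d \<otimes>\<^bsub>H\<^esub> y))) b) x"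
    by (rule sw_coassoc[OF G tri x])
  also have "\<dots> = sw TQ (\<lambda>a b. pq (\<pi> (\<epsilon> b \<odot>\<^bsub>H\<^esub> a)) y) x"
  proof (rule sw_cong[OF G x])
    fix a b assume a: "a \<in> carrier H" "b \<in> carrier H"
    have hom: "(\<lambda>u. pq (\<pi> a) (u \<otimes>\<^bsub>H\<^esub> y)) \<in> hom AH TQ"
      by (rule homI) (use a y in \<open>simp_all add: pq_balanced mult_simps\<close>)
    have "sw TQ (\<lambda>c d. pq (\<pi> a) (c \<otimes>\<^bsub>H\<^esub> (S d \<otimes>\<^bsub>H\<^esub> y))) b = sw TQ (\<lambda>c d. pq (\<pi> a) ((c \<otimes>\<^bsub>H\<^esub> S d) \<otimes>\<^bsub>H\<^esub> y)) b"
      by (rule sw_cong[OF G a(2)]) (use a y in \<open>simp_all add: H.m_assoc\<close>)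
    also have "\<dots> = pq (\<pi> a) ((\<epsilon> b \<odot>\<^bsub>H\<^esub> \<one>\<^bsub>H\<^esub>) \<otimes>\<^bsub>H\<^esub> y)"
      by (rule sw_antipode_right[OF G hom a(2)])
    also have "\<dots> = pq (\<pi> (\<epsilon> b \<odot>\<^bsub>H\<^esub> a)) y"
      using a y by (simp add: mult_simps pq_balanced)
    finally show "sw TQ (\<lambda>c d. pq (\<pi> a) (c \<otimes>\<^bsub>H\<^esub> (S d \<otimes>\<^bsub>H\<^esub> y))) b = pq (\<pi> (\<epsilon> b \<odot>\<^bsub>H\<^esub> a)) y" .
    show "pq (\<pi> (\<epsilon> b \<odot>\<^bsub>H\<^esub> a)) y \<in> carrier TQ"
      using a y by (simp del: proj_simps(3))
  qed
  also have "\<dots> = pq (\<pi> x) y"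
    by (rule sw_counit_right[OF G pq_hom_left[OF y] x])
  finally show ?thesis .
qed

lemma can_surj: "can ` carrier TK = carrier TQ"
proof
  show "can ` carrier TK \<subseteq> carrier TQ" using hom_in_carrier[OF can_hom] by blast
  interpret can: group_hom TK TQ can
    using can_hom TK_comm_group TQ_comm_group
    by (simp add: group_hom_def group_hom_axioms_def comm_group_def)
  show "carrier TQ \<subseteq> can ` carrier TK"
  proof
    fix X assume "X \<in> carrier TQ"
    then show "X \<in> can ` carrier TK"
    proof (rule QH.tensor_induct)
      show "\<one>\<^bsub>TQ\<^esub> \<in> can ` carrier TK" by (metis can.G.one_closed can.hom_one imageI)
    next
      fix q y assume q: "q \<in> carrier Q" "y \<in> carrier H"
      then obtain x where x: "x \<in> carrier H" "q = \<pi> x" using QS.proj_surj by blast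
      then show "pq q y \<in> can ` carrier TK"
        using can_translation[OF x(1) q(2)] translation_closed[OF x(1) q(2)] by (metis imageI)
    next
      fix X Y assume "X \<in> can ` carrier TK" "Y \<in> can ` carrier TK"
      then obtain U V where "U \<in> carrier TK" "X = can U" "V \<in> carrier TK" "Y = can V" by blast
      then have "X \<otimes>\<^bsub>TQ\<^esub> inv\<^bsub>TQ\<^esub> Y = can (U \<otimes>\<^bsub>TK\<^esub> inv\<^bsub>TK\<^esub> V)" "U \<otimes>\<^bsub>TK\<^esub> inv\<^bsub>TK\<^esub> V \<in> carrier TK"
        by simp_all
      then show "X \<otimes>\<^bsub>TQ\<^esub> inv\<^bsub>TQ\<^esub> Y \<in> can ` carrier TK" by blast
    qed
  qed
qed

abbreviation "Kplus \<equiv> augmentation k H K"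
abbreviation "HKplus \<equiv> ideal_prod H (carrier H) Kplus"

text \<open>
  Apply \<open>\<epsilon>\<close> to the second leg of \<open>\<pi>(\<kappa>\<^sub>1) \<otimes> \<kappa>\<^sub>2 = \<pi>(1) \<otimes> \<kappa>\<close>.
\<close>

lemma Kplus_subset_I: "Kplus \<subseteq> I"
proof
  fix \<kappa> assume "\<kappa> \<in> Kplus"
  then have \<kappa>: "\<kappa> \<in> K" "\<epsilon> \<kappa> = \<zero>\<^bsub>k\<^esub>" by (auto simp: augmentation_def)
  then have \<kappa>H: "\<kappa> \<in> carrier H" using K_subset by blast
  let ?AQ = "add_monoid Q"
  have GQ: "comm_group ?AQ" by (rule QH.M.a_comm_group)
  have b: "k_balanced k Q H ?AQ (\<lambda>q h. \<epsilon> h \<odot>\<^bsub>Q\<^esub> q)"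
    by (rule balanced_mapI)
      (simp_all add: QH.M.smult_l_distr QH.M.smult_r_distr QH.M.smult_assoc1[symmetric] k.m_comm)
  let ?\<phi> = "tensor_lift ?AQ (\<lambda>q h. \<epsilon> h \<odot>\<^bsub>Q\<^esub> q)"
  note \<phi> = QH.tensor_lift_hom[OF GQ b] and \<phi>p = QH.tensor_lift_pure[OF GQ b]
  have hp: "\<pi> \<in> hom AH ?AQ" by (rule homI) simp_all
  have "\<pi> \<kappa> = sw ?AQ (\<lambda>a b. \<pi> (\<epsilon> b \<odot>\<^bsub>H\<^esub> a)) \<kappa>"
    by (rule sw_counit_right[OF GQ hp \<kappa>H, symmetric])
  also have "\<dots> = sw ?AQ (\<lambda>a b. ?\<phi> (pq (\<pi> a) b)) \<kappa>"
    by (rule sw_cong[OF GQ \<kappa>H]) (simp_all add: \<phi>p)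
  also have "\<dots> = ?\<phi> (coact \<kappa>)"
    unfolding coact_def by (rule hom_sw[OF TQ_comm_group GQ \<phi> \<kappa>H, symmetric]) simp
  also have "\<dots> = ?\<phi> (pq (\<pi> \<one>\<^bsub>H\<^esub>) \<kappa>)" using \<kappa> mem_K_iff by simp
  also have "\<dots> = \<zero>\<^bsub>Q\<^esub>" using \<kappa> \<kappa>H by (simp add: \<phi>p)
  also have "\<dots> = \<pi> \<zero>\<^bsub>H\<^esub>" by (simp add: QS.proj_eq QS.quotient_simps(2) QS.J.a_subset)
  finally have "\<kappa> \<ominus>\<^bsub>H\<^esub> \<zero>\<^bsub>H\<^esub> \<in> I" using QS.proj_eq_iff \<kappa>H by simp
  then show "\<kappa> \<in> I" using \<kappa>H by (simp add: a_minus_def)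
qed

lemma HKplus_subset_I: "HKplus \<subseteq> I"
proof
  fix x assume "x \<in> HKplus"
  then show "x \<in> I"
    by (induction rule: ideal_prod.induct) (use Kplus_subset_I I_left_ideal in auto)
qed

lemma I_subset: "x \<in> I \<Longrightarrow> x \<in> carrier H"
  using QS.J.a_subset by blast

lemma HKplus_submodule: "submodule HKplus k H"
proof (rule H.submoduleI)
  show "HKplus \<subseteq> carrier H" using HKplus_subset_I I_subset by blast
  have "\<zero>\<^bsub>H\<^esub> \<in> Kplus"
    using submodule.smult_closed[OF K_submodule k.zero_closed one_in_K] counit_simps(5)[of "\<zero>\<^bsub>k\<^esub>" "\<one>\<^bsub>H\<^esub>"]
    by (simp add: augmentation_def)
  then show z: "\<zero>\<^bsub>H\<^esub> \<in> HKplus" using ideal_prod.prod[of "\<zero>\<^bsub>H\<^esub>" "carrier H" "\<zero>\<^bsub>H\<^esub>" Kplus H] by simp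
  show sm: "c \<odot>\<^bsub>H\<^esub> x \<in> HKplus" if "c \<in> carrier k" "x \<in> HKplus" for c x
    using that(2)
  proof (induction rule: ideal_prod.induct)
    case (prod i j)
    then have "j \<in> carrier H" using K_subset by (simp add: augmentation_def)
    then have "c \<odot>\<^bsub>H\<^esub> (i \<otimes>\<^bsub>H\<^esub> j) = (c \<odot>\<^bsub>H\<^esub> i) \<otimes>\<^bsub>H\<^esub> j"
      using prod that(1) by (simp add: H.smult_mult_left)
    then show ?case using ideal_prod.prod[of "c \<odot>\<^bsub>H\<^esub> i" "carrier H" j Kplus H] prod that(1) by simp
  next
    case (sum s1 s2)
    then have "s1 \<in> carrier H" "s2 \<in> carrier H" using HKplus_subset_I I_subset by blast+
    then show ?case using sum ideal_prod.sum that(1) by (simp add: H.smult_r_distr ideal_prod.sum)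
  qed
  show "\<ominus>\<^bsub>H\<^esub> a \<in> HKplus" if "a \<in> HKplus" for a
    using sm[of "\<ominus>\<^bsub>k\<^esub> \<one>\<^bsub>k\<^esub>", OF _ that] H.smult_l_minus[of "\<one>\<^bsub>k\<^esub>" a] HKplus_subset_I I_subset that
    by auto
qed (rule ideal_prod.sum)

lemma translation_hom: "y \<in> carrier H \<Longrightarrow> (\<lambda>x. translation x y) \<in> hom AH TK"
  unfolding translation_def by (rule sw_hom[OF TK_comm_group bal_translation])

text \<open>
  \<open>h\<^sub>1 \<kappa>\<^sub>1 \<otimes> S(h\<^sub>2 \<kappa>\<^sub>2) y = h\<^sub>1 \<kappa>\<^sub>1 \<otimes> S(\<kappa>\<^sub>2) S(h\<^sub>2) y = h\<^sub>1 \<otimes> \<kappa>\<^sub>1 S(\<kappa>\<^sub>2) S(h\<^sub>2) y\<close>, where the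
  last step needs \<open>\<kappa>\<^sub>1\<close> to lie in \<open>K\<close>, and \<open>\<kappa>\<^sub>1 S(\<kappa>\<^sub>2) = \<epsilon>(\<kappa>) = 0\<close>.
\<close>

lemma translation_mult_Kplus:
  assumes h: "h \<in> carrier H" and \<kappa>: "\<kappa> \<in> Kplus" and y: "y \<in> carrier H"
  shows "translation (h \<otimes>\<^bsub>H\<^esub> \<kappa>) y = \<one>\<^bsub>TK\<^esub>"
proof -
  note G = TK_comm_group
  interpret TK: comm_group TK by (rule G)
  have \<kappa>K: "\<kappa> \<in> K" and \<epsilon>\<kappa>: "\<epsilon> \<kappa> = \<zero>\<^bsub>k\<^esub>" using \<kappa> by (auto simp: augmentation_def)
  have \<kappa>H: "\<kappa> \<in> carrier H" using K_subset \<kappa>K .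
  have "translation (h \<otimes>\<^bsub>H\<^esub> \<kappa>) y =
    sw TK (\<lambda>a b. sw TK (\<lambda>c d. pK (a \<otimes>\<^bsub>H\<^esub> c) (S (b \<otimes>\<^bsub>H\<^esub> d) \<otimes>\<^bsub>H\<^esub> y)) \<kappa>) h"
    unfolding translation_def by (rule sw_of_product[OF G bal_translation[OF y] h \<kappa>H])
  also have "\<dots> = sw TK (\<lambda>a b. \<one>\<^bsub>TK\<^esub>) h"
  proof (rule sw_cong[OF G h])
    fix a b assume a: "a \<in> carrier H" "b \<in> carrier H"
    define z where "z = S b \<otimes>\<^bsub>H\<^esub> y"
    have z: "z \<in> carrier H" using a y by (simp add: z_def)
    have b1: "bal TK (\<lambda>c d. pK (a \<otimes>\<^bsub>H\<^esub> c) (S d \<otimes>\<^bsub>H\<^esub> z))"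
      by (rule balanced_mapI) (use a z in \<open>simp_all add: pK_balanced(1-3) pK_scalar mult_simps\<close>)
    have b2: "bal TK (\<lambda>c d. pK a ((c \<otimes>\<^bsub>H\<^esub> S d) \<otimes>\<^bsub>H\<^esub> z))"
      by (rule balanced_mapI) (use a z in \<open>simp_all add: pK_balanced(1-3) pK_scalar mult_simps\<close>)
    have hom: "(\<lambda>u. pK a (u \<otimes>\<^bsub>H\<^esub> z)) \<in> hom AH TK"
      by (rule homI) (use a z in \<open>simp_all add: pK_balanced(1-3) mult_simps\<close>)
    have "sw TK (\<lambda>c d. pK (a \<otimes>\<^bsub>H\<^esub> c) (S (b \<otimes>\<^bsub>H\<^esub> d) \<otimes>\<^bsub>H\<^esub> y)) \<kappa> =
      sw TK (\<lambda>c d. pK (a \<otimes>\<^bsub>H\<^esub> c) (S d \<otimes>\<^bsub>H\<^esub> z)) \<kappa>"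
      by (rule sw_cong[OF G \<kappa>H]) (use a y in \<open>simp_all add: z_def antipode_mult H.m_assoc\<close>)
    also have "\<dots> = sw TK (\<lambda>c d. pK a ((c \<otimes>\<^bsub>H\<^esub> S d) \<otimes>\<^bsub>H\<^esub> z)) \<kappa>"
      by (rule sw_cong_coinvariant[OF G b1 b2 \<kappa>K])
         (use a z K_subset in \<open>simp add: pK_balanced(4) H.m_assoc\<close>)
    also have "\<dots> = pK a ((\<epsilon> \<kappa> \<odot>\<^bsub>H\<^esub> \<one>\<^bsub>H\<^esub>) \<otimes>\<^bsub>H\<^esub> z)"
      by (rule sw_antipode_right[OF G hom \<kappa>H])
    also have "\<dots> = pK a \<zero>\<^bsub>H\<^esub>" using z by (simp add: \<epsilon>\<kappa>)
    also have "\<dots> = \<one>\<^bsub>TK\<^esub>"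
      using hom_one[OF pK_hom_right[OF a(1)]] H.add.is_group TK.is_group by simp
    finally show "sw TK (\<lambda>c d. pK (a \<otimes>\<^bsub>H\<^esub> c) (S (b \<otimes>\<^bsub>H\<^esub> d) \<otimes>\<^bsub>H\<^esub> y)) \<kappa> = \<one>\<^bsub>TK\<^esub>" .
  qed simp
  also have "\<dots> = \<one>\<^bsub>TK\<^esub>" by (rule sw_const_one[OF G])
  finally show ?thesis .
qed

lemma translation_HKplus:
  assumes "x \<in> HKplus" and y: "y \<in> carrier H"
  shows "translation x y = \<one>\<^bsub>TK\<^esub>"
  using assms(1)
proof (induction rule: ideal_prod.induct)
  case (prod i j) then show ?case using translation_mult_Kplus y by simp
next
  interpret TK: comm_group TK by (rule TK_comm_group)
  case (sum s1 s2)
  then have "s1 \<in> carrier H" "s2 \<in> carrier H" using HKplus_subset_I I_subset by blast+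
  then show ?case using hom_mult[OF translation_hom[OF y], of s1 s2] sum by simp
qed

text \<open>
  The identity \<open>x\<^sub>1 \<otimes> S(x\<^sub>2) x\<^sub>3 y = x \<otimes> y\<close>, which makes the translation map a left inverse of \<open>can\<close>
  once it is defined on \<open>Q \<otimes> H\<close>.
\<close>

lemma translation_canonical_pairing:
  assumes x: "x \<in> carrier H" and y: "y \<in> carrier H"
  shows "sw TK (\<lambda>a b. translation a (b \<otimes>\<^bsub>H\<^esub> y)) x = pK x y"
proof -
  note G = TK_comm_group
  have tri: "trilinear TK (\<lambda>c d b. pK c (S d \<otimes>\<^bsub>H\<^esub> (b \<otimes>\<^bsub>H\<^esub> y)))"
    by (rule trilinearI) (use y in \<open>simp_all add: pK_balanced(1-3) pK_scalar mult_simps\<close>)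
  have "sw TK (\<lambda>a b. translation a (b \<otimes>\<^bsub>H\<^esub> y)) x =
    sw TK (\<lambda>a b. sw TK (\<lambda>c d. pK a (S c \<otimes>\<^bsub>H\<^esub> (d \<otimes>\<^bsub>H\<^esub> y))) b) x"
    unfolding translation_def by (rule sw_coassoc[OF G tri x])
  also have "\<dots> = sw TK (\<lambda>a b. pK (\<epsilon> b \<odot>\<^bsub>H\<^esub> a) y) x"
  proof (rule sw_cong[OF G x])
    fix a b assume a: "a \<in> carrier H" "b \<in> carrier H"
    have hom: "(\<lambda>u. pK a (u \<otimes>\<^bsub>H\<^esub> y)) \<in> hom AH TK"
      by (rule homI) (use a y in \<open>simp_all add: pK_balanced(1-3) mult_simps\<close>)
    have "sw TK (\<lambda>c d. pK a (S c \<otimes>\<^bsub>H\<^esub> (d \<otimes>\<^bsub>H\<^esub> y))) b = sw TK (\<lambda>c d. pK a ((S c \<otimes>\<^bsub>H\<^esub> d) \<otimes>\<^bsub>H\<^esub> y)) b"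
      by (rule sw_cong[OF G a(2)]) (use a y in \<open>simp_all add: H.m_assoc\<close>)
    also have "\<dots> = pK a ((\<epsilon> b \<odot>\<^bsub>H\<^esub> \<one>\<^bsub>H\<^esub>) \<otimes>\<^bsub>H\<^esub> y)"
      by (rule sw_antipode_left[OF G hom a(2)])
    also have "\<dots> = pK (\<epsilon> b \<odot>\<^bsub>H\<^esub> a) y"
      using a y by (simp add: mult_simps pK_scalar)
    finally show "sw TK (\<lambda>c d. pK a (S c \<otimes>\<^bsub>H\<^esub> (d \<otimes>\<^bsub>H\<^esub> y))) b = pK (\<epsilon> b \<odot>\<^bsub>H\<^esub> a) y" .
  qed (use y in simp)
  also have "\<dots> = pK x y"
    by (rule sw_counit_right[OF G pK_hom_left[OF y] x])
  finally show ?thesis .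
qed

text \<open>
  If \<open>I = HK\<^sup>+\<close>, the translation map depends only on \<open>\<pi>(x)\<close> and so induces a left inverse of \<open>can\<close>.
\<close>

lemma can_inj:
  assumes eq: "HKplus = I"
  shows "inj_on can (carrier TK)"
proof -
  note G = TK_comm_group
  interpret TK: comm_group TK by (rule G)
  \<comment> \<open>A set-theoretic section of the projection; well-definedness below makes the choice irrelevant.\<close>
  define \<rho> where "\<rho> q = (SOME x. x \<in> carrier H \<and> q = \<pi> x)" for q
  have \<rho>: "\<rho> q \<in> carrier H" "\<pi> (\<rho> q) = q" if "q \<in> carrier Q" for q
    using someI_ex[of "\<lambda>x. x \<in> carrier H \<and> q = \<pi> x"] QS.proj_surj[OF that] unfolding \<rho>_def by auto
  define \<gamma>0 where "\<gamma>0 q y = translation (\<rho> q) y" for q y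
  have \<gamma>0: "\<gamma>0 (\<pi> x) y = translation x y" if x: "x \<in> carrier H" and y: "y \<in> carrier H" for x y
  proof -
    let ?r = "\<rho> (\<pi> x)"
    have r: "?r \<in> carrier H" "\<pi> ?r = \<pi> x" using \<rho>[of "\<pi> x"] x by auto
    then have "?r \<ominus>\<^bsub>H\<^esub> x \<in> HKplus" using QS.proj_eq_iff[OF r(1) x] eq by simp
    moreover have "?r = (?r \<ominus>\<^bsub>H\<^esub> x) \<oplus>\<^bsub>H\<^esub> x" using r x by (simp add: a_minus_def H.a_assoc H.l_neg)
    ultimately show ?thesis
      unfolding \<gamma>0_def
      using hom_mult[OF translation_hom[OF y], of "?r \<ominus>\<^bsub>H\<^esub> x" x] r(1) x y translation_HKplus translation_closed
      by simp
  qed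
  have repr: "\<exists>x\<in>carrier H. q = \<pi> x" if "q \<in> carrier Q" for q using QS.proj_surj[OF that] .
  have bal: "k_balanced k Q H TK \<gamma>0"
  proof (rule balanced_mapI)
    fix q y assume "q \<in> carrier Q" "y \<in> carrier H"
    then show "\<gamma>0 q y \<in> carrier TK" using \<rho> translation_closed by (simp add: \<gamma>0_def)
  next
    fix q q' y assume q: "q \<in> carrier Q" "q' \<in> carrier Q" and y: "y \<in> carrier H"
    obtain x x' where x: "x \<in> carrier H" "q = \<pi> x" "x' \<in> carrier H" "q' = \<pi> x'"
      using repr[OF q(1)] repr[OF q(2)] by blast
    then show "\<gamma>0 (q \<oplus>\<^bsub>Q\<^esub> q') y = \<gamma>0 q y \<otimes>\<^bsub>TK\<^esub> \<gamma>0 q' y"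
      using hom_mult[OF translation_hom[OF y], of x x'] y
      by (simp add: proj_simps(2)[symmetric] \<gamma>0 del: proj_simps(2))
  next
    fix q y y' assume q: "q \<in> carrier Q" and y: "y \<in> carrier H" "y' \<in> carrier H"
    have r: "\<rho> q \<in> carrier H" using \<rho> q by blast
    have "translation (\<rho> q) (y \<oplus>\<^bsub>H\<^esub> y') = sw TK (\<lambda>a b. pK a (S b \<otimes>\<^bsub>H\<^esub> y) \<otimes>\<^bsub>TK\<^esub> pK a (S b \<otimes>\<^bsub>H\<^esub> y')) (\<rho> q)"
      unfolding translation_def
      by (rule sw_cong[OF G r]) (use y in \<open>simp_all add: pK_balanced(1-3) mult_simps\<close>)
    also have "\<dots> = translation (\<rho> q) y \<otimes>\<^bsub>TK\<^esub> translation (\<rho> q) y'"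
      unfolding translation_def by (rule sw_pointwise_mult[OF G r]) (use y in simp_all)
    finally show "\<gamma>0 q (y \<oplus>\<^bsub>H\<^esub> y') = \<gamma>0 q y \<otimes>\<^bsub>TK\<^esub> \<gamma>0 q y'" by (simp add: \<gamma>0_def)
  next
    fix q c y assume q: "q \<in> carrier Q" and c: "c \<in> carrier k" and y: "y \<in> carrier H"
    obtain x where x: "x \<in> carrier H" "q = \<pi> x" using repr[OF q] by blast
    have "translation (c \<odot>\<^bsub>H\<^esub> x) y = sw TK (\<lambda>a b. pK (c \<odot>\<^bsub>H\<^esub> a) (S b \<otimes>\<^bsub>H\<^esub> y)) x"
      unfolding translation_def by (rule sw_smult[OF G bal_translation[OF y] c x(1)])
    also have "\<dots> = translation x (c \<odot>\<^bsub>H\<^esub> y)"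
      unfolding translation_def
      by (rule sw_cong[OF G x(1)]) (use c y in \<open>simp_all add: pK_scalar mult_simps\<close>)
    finally show "\<gamma>0 (c \<odot>\<^bsub>Q\<^esub> q) y = \<gamma>0 q (c \<odot>\<^bsub>H\<^esub> y)"
      using x c y by (simp add: proj_simps(3)[symmetric] \<gamma>0 del: proj_simps(3))
  qed
  let ?\<gamma> = "tensor_lift TK \<gamma>0"
  note \<gamma> = QH.tensor_lift_hom[OF G bal] and \<gamma>p = QH.tensor_lift_pure[OF G bal]
  have "?\<gamma> (can X) = X" if X: "X \<in> carrier TK" for X
  proof -
    have "(?\<gamma> \<circ> can) X = id X"
    proof (rule HK.tensor_hom_eqI[OF TK.is_group hom_compose[OF can_hom \<gamma>] _ _ X])
      show "id \<in> hom TK TK" by (simp add: hom_def)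
      fix x y assume x: "x \<in> carrier H" and y: "y \<in> carrier H"
      have "?\<gamma> (can (pK x y)) = ?\<gamma> (sw TQ (\<lambda>a b. pq (\<pi> a) (b \<otimes>\<^bsub>H\<^esub> y)) x)"
        using x y by (simp add: can_pure canonical_pairing_def)
      also have "\<dots> = sw TK (\<lambda>a b. ?\<gamma> (pq (\<pi> a) (b \<otimes>\<^bsub>H\<^esub> y))) x"
        by (rule hom_sw[OF TQ_comm_group G \<gamma> x]) (use y in simp)
      also have "\<dots> = sw TK (\<lambda>a b. translation a (b \<otimes>\<^bsub>H\<^esub> y)) x"
        by (rule sw_cong[OF G x]) (use y in \<open>simp_all add: \<gamma>p \<gamma>0 translation_closed\<close>)
      also have "\<dots> = pK x y" by (rule translation_canonical_pairing[OF x y])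
      finally show "(?\<gamma> \<circ> can) (pK x y) = id (pK x y)" by simp
    qed
    then show ?thesis by simp
  qed
  then show ?thesis by (rule inj_on_inverseI)
qed

text \<open>
  For \<open>x \<in> I\<close> the element \<open>x\<^sub>1 \<otimes> S(x\<^sub>2)\<close> of \<open>H \<otimes>\<^sub>K H\<close> is killed by \<open>can\<close>, hence zero.  The map
  \<open>a \<otimes> b \<mapsto> \<epsilon>(b) a\<close> to \<open>H / HK\<^sup>+\<close> is well defined because \<open>a \<kappa> - \<epsilon>(\<kappa>) a \<in> HK\<^sup>+\<close>, and it sends that
  element to the class of \<open>x\<close>.
\<close>

lemma I_subset_HKplus:
  assumes inj: "inj_on can (carrier TK)"
  shows "I \<subseteq> HKplus"
proof
  fix x assume xI: "x \<in> I"
  have x: "x \<in> carrier H" by (rule I_subset[OF xI])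
  interpret TK: comm_group TK by (rule TK_comm_group)
  interpret TQ: comm_group TQ by (rule TQ_comm_group)
  interpret J: quotient_space k H HKplus
    by (intro quotient_space.intro quotient_space_axioms.intro HKplus_submodule module_H)
  let ?QJ = "quotient_module H HKplus"
  let ?p = "quotient_proj H ?QJ"
  interpret QJ: module k ?QJ by (rule J.quotient_module)
  let ?A = "add_monoid ?QJ"
  have GA: "comm_group ?A" by (rule QJ.a_comm_group)
  have z: "\<pi> x = \<zero>\<^bsub>Q\<^esub>"
  proof -
    have "\<pi> x = \<pi> \<zero>\<^bsub>H\<^esub>" using QS.proj_eq_iff[OF x H.zero_closed] xI x by (simp add: a_minus_def)
    then show ?thesis by (simp add: QS.proj_eq QS.quotient_simps(2) QS.J.a_subset)
  qed
  have "pq \<zero>\<^bsub>Q\<^esub> \<one>\<^bsub>H\<^esub> = \<one>\<^bsub>TQ\<^esub>"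
    by (rule eq_one_if_mult_eq_right[OF TQ_comm_group, of _ "pq \<zero>\<^bsub>Q\<^esub> \<one>\<^bsub>H\<^esub>"])
       (simp_all add: pq_balanced(2)[symmetric])
  then have "can (translation x \<one>\<^bsub>H\<^esub>) = can \<one>\<^bsub>TK\<^esub>"
    using can_translation[OF x H.one_closed] z hom_one[OF can_hom TK.is_group TQ.is_group] by simp
  then have w: "translation x \<one>\<^bsub>H\<^esub> = \<one>\<^bsub>TK\<^esub>"
    using inj translation_closed[OF x H.one_closed] by (simp add: inj_on_eq_iff)
  have p_simps: "?p (a \<oplus>\<^bsub>H\<^esub> b) = ?p a \<oplus>\<^bsub>?QJ\<^esub> ?p b" if "a \<in> carrier H" "b \<in> carrier H" for a b
    using that by (rule J.proj_add)
  have bal: "balanced_map K (\<otimes>\<^bsub>H\<^esub>) (\<otimes>\<^bsub>H\<^esub>) H H ?A (\<lambda>a b. ?p (\<epsilon> b \<odot>\<^bsub>H\<^esub> a))"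
  proof (rule balanced_mapI)
    fix a \<kappa> b assume a: "a \<in> carrier H" and \<kappa>: "\<kappa> \<in> K" and b: "b \<in> carrier H"
    have \<kappa>H: "\<kappa> \<in> carrier H" using K_subset \<kappa> .
    \<comment> \<open>The component of \<open>\<kappa>\<close> in \<open>K\<^sup>+\<close>.\<close>
    let ?d = "\<kappa> \<ominus>\<^bsub>H\<^esub> \<epsilon> \<kappa> \<odot>\<^bsub>H\<^esub> \<one>\<^bsub>H\<^esub>"
    have dK: "?d \<in> K" by (rule K_diff[OF \<kappa> scalar_in_K]) (use \<kappa>H in simp)
    have "?d \<oplus>\<^bsub>H\<^esub> \<epsilon> \<kappa> \<odot>\<^bsub>H\<^esub> \<one>\<^bsub>H\<^esub> = \<kappa>"
      using \<kappa>H by (simp add: a_minus_def H.a_assoc H.l_neg)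
    then have "\<epsilon> ?d \<oplus>\<^bsub>k\<^esub> \<epsilon> \<kappa> = \<epsilon> \<kappa>"
      using counit_simps(2)[of ?d "\<epsilon> \<kappa> \<odot>\<^bsub>H\<^esub> \<one>\<^bsub>H\<^esub>"] \<kappa>H K_subset[OF dK] by simp
    then have "\<epsilon> ?d = \<zero>\<^bsub>k\<^esub>"
      using eq_one_if_mult_eq_right[OF k.a_comm_group, of "\<epsilon> ?d" "\<epsilon> \<kappa>"] \<kappa>H K_subset[OF dK] by simp
    then have dp: "?d \<in> Kplus" using dK by (simp add: augmentation_def)
    have "(\<epsilon> b \<odot>\<^bsub>H\<^esub> a) \<otimes>\<^bsub>H\<^esub> ?d \<in> HKplus"
      by (rule ideal_prod.prod) (use a b dp in simp_all)
    moreover have "\<epsilon> b \<odot>\<^bsub>H\<^esub> (a \<otimes>\<^bsub>H\<^esub> \<kappa>) \<ominus>\<^bsub>H\<^esub> \<epsilon> (\<kappa> \<otimes>\<^bsub>H\<^esub> b) \<odot>\<^bsub>H\<^esub> a = (\<epsilon> b \<odot>\<^bsub>H\<^esub> a) \<otimes>\<^bsub>H\<^esub> ?d"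
    proof -
      have "(\<epsilon> b \<odot>\<^bsub>H\<^esub> a) \<otimes>\<^bsub>H\<^esub> (\<epsilon> \<kappa> \<odot>\<^bsub>H\<^esub> \<one>\<^bsub>H\<^esub>) = \<epsilon> (\<kappa> \<otimes>\<^bsub>H\<^esub> b) \<odot>\<^bsub>H\<^esub> a"
        using a b \<kappa>H by (simp add: mult_simps H.smult_assoc1)
      then show ?thesis
        using a b \<kappa>H by (simp add: a_minus_def H.r_distr H.r_minus H.smult_mult_left)
    qed
    ultimately show "?p (\<epsilon> b \<odot>\<^bsub>H\<^esub> (a \<otimes>\<^bsub>H\<^esub> \<kappa>)) = ?p (\<epsilon> (\<kappa> \<otimes>\<^bsub>H\<^esub> b) \<odot>\<^bsub>H\<^esub> a)"
      using a b \<kappa>H by (subst J.proj_eq_iff) simp_all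
  qed (simp_all add: H.smult_r_distr H.smult_l_distr p_simps)
  note \<omega> = HK.tensor_lift_hom[OF GA bal] and \<omega>p = HK.tensor_lift_pure[OF GA bal]
  let ?\<omega> = "tensor_lift ?A (\<lambda>a b. ?p (\<epsilon> b \<odot>\<^bsub>H\<^esub> a))"
  have hp: "?p \<in> hom AH ?A" by (rule homI) (simp_all add: p_simps)
  have "?p x = sw ?A (\<lambda>a b. ?p (\<epsilon> b \<odot>\<^bsub>H\<^esub> a)) x"
    by (rule sw_counit_right[OF GA hp x, symmetric])
  also have "\<dots> = sw ?A (\<lambda>a b. ?\<omega> (pK a (S b \<otimes>\<^bsub>H\<^esub> \<one>\<^bsub>H\<^esub>))) x"
    by (rule sw_cong[OF GA x]) (simp_all add: \<omega>p counit_antipode)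
  also have "\<dots> = ?\<omega> (translation x \<one>\<^bsub>H\<^esub>)"
    unfolding translation_def by (rule hom_sw[OF TK_comm_group GA \<omega> x, symmetric]) simp
  also have "\<dots> = \<zero>\<^bsub>?QJ\<^esub>"
    unfolding w using hom_one[OF \<omega> TK.is_group] QJ.add.is_group by simp
  also have "\<dots> = ?p \<zero>\<^bsub>H\<^esub>" by (simp add: J.proj_eq J.quotient_simps(2) J.J.a_subset)
  finally have "x \<ominus>\<^bsub>H\<^esub> \<zero>\<^bsub>H\<^esub> \<in> HKplus" using J.proj_eq_iff x by simp
  then show "x \<in> HKplus" using x by (simp add: a_minus_def)
qed

lemma galois_extension_iff: "galois_extension k H Q \<longleftrightarrow> HKplus = I"
proof -
  have "galois_extension k H Q \<longleftrightarrow> bij_betw can (carrier TK) (carrier TQ)"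
    unfolding galois_extension_def by (rule bij_betw_cong[OF canonical_map_eq])
  also have "\<dots> \<longleftrightarrow> inj_on can (carrier TK)"
    using can_surj by (simp add: bij_betw_def)
  also have "\<dots> \<longleftrightarrow> HKplus = I"
    using can_inj I_subset_HKplus HKplus_subset_I by blast
  finally show ?thesis .
qed

lemma closed_iff: "closed_in_orderB (hopf_galcon k H) Q \<longleftrightarrow> HKplus = I"
proof -
  have "Q \<in> carrier (orderB (hopf_galcon k H))"
    using I by (auto simp: hopf_galcon_def left_ideal_coideal_quotients_def)
  moreover have "subalgebra_quotient k H K = Q \<longleftrightarrow> HKplus = I"
    unfolding subalgebra_quotient_def by (metis zero_quotient_module)
  ultimately show ?thesis
    by (simp add: closed_in_orderB_def hopf_galcon_def)
qed

end

theorem proposition6p7: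
  fixes k :: "('k, 'f) ring_scheme" and H :: "('k, 'h, 'm) hopf_scheme"
    and Q :: "('k, 'h set) module" and I :: "'h set"
  assumes "hopf_algebra k H"
    and "left_ideal_coideal k H I"
    and "Q = quotient_module H I"
  shows "closed_in_orderB (hopf_galcon k H) Q \<longleftrightarrow> galois_extension k H Q"
proof -
  interpret hopf_quotient k H I
    using assms by (intro hopf_quotient.intro hopf_quotient_axioms.intro)
  show ?thesis unfolding assms(3) closed_iff galois_extension_iff ..
qed

end
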